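(* Let $E$ be a complex Banach lattice and $(e^{tA})_{t\ge0}$ a real $C_0$-semigroup on $E$ with $\sigma(A)\neq\emptyset$. Suppose that the peripheral spectrum $\sigma_{\mathrm{per}}(A)$ is finite and consists of poles of the resolvent. Let $u\in E_+$ be a quasi-interior point and suppose there exists $t_0\ge0$ with $e^{t_0A}E\subseteq E_u$. Then the following are equivalent: (i) The semigroup $(e^{tA})_{t\ge0}$ is individually eventually strongly positive with respect to $u$. (ii) The semigroup $(e^{t(A-s(A)I)})_{t\ge0}$ is bounded, $s(A)$ is a dominant spectral value of $A$, and its associated spectral projection $P$ satisfies $P\gg_u0$. (iii) The operators $e^{t(A-s(A)I)}$ converge, with respect to the strong operator topology as $t\to\infty$, to some operator $Q\gg_u0$. If (i)--(iii) hold, then $P=Q$.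
   Context: $E$ is the complexification of a real Banach lattice $E_\mathbb{R}$; $E_+$ is the positive cone; $f>0$ means $f\in E_+\setminus\{0\}$. For $u\in E_+$, $E_u=\{f:|f|\le cu \text{ for some }c\ge0\}$; $u$ is quasi-interior if $E_u$ is dense in $E$. $f\gg_u0$ means $f\ge cu$ for some $c>0$; $T\gg_u0$ means $Tf\gg_u0$ for all $f>0$. A semigroup is real if each $e^{tA}$ maps $E_\mathbb{R}$ into $E_\mathbb{R}$. $s(A)$ is the spectral bound, $\sigma_{\mathrm{per}}(A)=\sigma(A)\cap(s(A)+i\mathbb{R})$, and $s(A)$ is a dominant spectral value if $\sigma_{\mathrm{per}}(A)=\{s(A)\}$. The semigroup is individually eventually strongly positive with respect to $u$ if for each $f>0$ there is $t_0>0$ with $e^{tA}f\gg_u0$ for all $t\ge t_0$. *)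

theory Defs
  imports "HOL-Analysis.Analysis"
begin

(* ---------------------------------------------------------------------
   Real Banach lattice E_R : a type 'r of class {banach, ordered_real_vector,
   lattice} together with the Banach lattice norm axiom
   |x| <= |y|  ==>  ||x|| <= ||y||,  where |x| = sup x (-x).
   Its complexification E = E_R + i E_R is modelled as pairs (x,y) = x + i y.
   --------------------------------------------------------------------- *)

type_synonym 'r cplx = "'r \<times> 'r"

definition lat_abs :: "'r::{ordered_ab_group_add,lattice} \<Rightarrow> 'r" where
  "lat_abs x = sup x (- x)"

definition banach_lattice_norm :: "'r::{banach,ordered_real_vector,lattice} itself \<Rightarrow> bool" where
  "banach_lattice_norm _ \<longleftrightarrow> (\<forall>x y::'r. lat_abs x \<le> lat_abs y \<longrightarrow> norm x \<le> norm y)"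

definition cscale :: "complex \<Rightarrow> 'r::real_vector cplx \<Rightarrow> 'r cplx" where
  "cscale c f = (Re c *\<^sub>R fst f - Im c *\<^sub>R snd f, Im c *\<^sub>R fst f + Re c *\<^sub>R snd f)"

definition is_lub_in :: "'r::order set \<Rightarrow> 'r \<Rightarrow> bool" where
  "is_lub_in S z \<longleftrightarrow> (\<forall>s\<in>S. s \<le> z) \<and> (\<forall>w. (\<forall>s\<in>S. s \<le> w) \<longrightarrow> z \<le> w)"

definition cmodulus :: "'r::{real_vector,order} cplx \<Rightarrow> 'r" where
  "cmodulus f = (THE z. is_lub_in {cos \<theta> *\<^sub>R fst f + sin \<theta> *\<^sub>R snd f | \<theta>. True} z)"

definition cnorm :: "'r::{real_normed_vector,order} cplx \<Rightarrow> real" where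
  "cnorm f = norm (cmodulus f)"

definition cpos :: "'r::{real_vector,order} cplx set" where
  "cpos = {(x, 0) | x. 0 \<le> x}"

definition strictly_pos :: "'r::{real_vector,order} cplx \<Rightarrow> bool" where
  "strictly_pos f \<longleftrightarrow> f \<in> cpos \<and> f \<noteq> 0"

definition principal_ideal :: "'r::{real_vector,order} \<Rightarrow> 'r cplx set" where
  "principal_ideal u = {f. \<exists>c\<ge>0. cmodulus f \<le> c *\<^sub>R u}"

definition quasi_interior :: "'r::{real_normed_vector,order} \<Rightarrow> bool" where
  "quasi_interior u \<longleftrightarrow> 0 \<le> u \<and>
     (\<forall>f. \<forall>\<epsilon>>0. \<exists>g\<in>principal_ideal u. cnorm (f - g) < \<epsilon>)"

definition gg_u :: "'r::{real_vector,order} \<Rightarrow> 'r cplx \<Rightarrow> bool" where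
  "gg_u u f \<longleftrightarrow> (\<exists>c>0. f - (c *\<^sub>R u, 0) \<in> cpos)"

definition op_gg_u :: "'r::{real_vector,order} \<Rightarrow> ('r cplx \<Rightarrow> 'r cplx) \<Rightarrow> bool" where
  "op_gg_u u B \<longleftrightarrow> (\<forall>f. strictly_pos f \<longrightarrow> gg_u u (B f))"

definition bounded_op :: "('r::{real_normed_vector,order} cplx \<Rightarrow> 'r cplx) \<Rightarrow> bool" where
  "bounded_op B \<longleftrightarrow> (\<forall>f g. B (f + g) = B f + B g) \<and> (\<forall>c f. B (cscale c f) = cscale c (B f))
     \<and> (\<exists>K. \<forall>f. cnorm (B f) \<le> K * cnorm f)"

definition op_norm :: "('r::{real_normed_vector,order} cplx \<Rightarrow> 'r cplx) \<Rightarrow> real" where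
  "op_norm B = Sup {cnorm (B f) | f. cnorm f \<le> 1}"

definition C0_semigroup :: "(real \<Rightarrow> 'r::{real_normed_vector,order} cplx \<Rightarrow> 'r cplx) \<Rightarrow> bool" where
  "C0_semigroup T \<longleftrightarrow> (\<forall>t\<ge>0. bounded_op (T t)) \<and> T 0 = id
     \<and> (\<forall>s\<ge>0. \<forall>t\<ge>0. T (s + t) = T s \<circ> T t)
     \<and> (\<forall>f. ((\<lambda>t. cnorm (T t f - f)) \<longlongrightarrow> 0) (at_right 0))"

definition real_semigroup :: "(real \<Rightarrow> 'r::real_vector cplx \<Rightarrow> 'r cplx) \<Rightarrow> bool" where
  "real_semigroup T \<longleftrightarrow> (\<forall>t\<ge>0. \<forall>x. snd (T t (x, 0)) = 0)"

definition gen_dom :: "(real \<Rightarrow> 'r::{real_normed_vector,order} cplx \<Rightarrow> 'r cplx) \<Rightarrow> 'r cplx set" where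
  "gen_dom T = {f. \<exists>g. ((\<lambda>h. cnorm (inverse h *\<^sub>R (T h f - f) - g)) \<longlongrightarrow> 0) (at_right 0)}"

definition gen :: "(real \<Rightarrow> 'r::{real_normed_vector,order} cplx \<Rightarrow> 'r cplx) \<Rightarrow> 'r cplx \<Rightarrow> 'r cplx" where
  "gen T f = (THE g. ((\<lambda>h. cnorm (inverse h *\<^sub>R (T h f - f) - g)) \<longlongrightarrow> 0) (at_right 0))"

definition resolvent :: "(real \<Rightarrow> 'r::{real_normed_vector,order} cplx \<Rightarrow> 'r cplx) \<Rightarrow> complex \<Rightarrow> 'r cplx \<Rightarrow> 'r cplx" where
  "resolvent T z = the_inv_into (gen_dom T) (\<lambda>f. cscale z f - gen T f)"

definition resolvent_set :: "(real \<Rightarrow> 'r::{real_normed_vector,order} cplx \<Rightarrow> 'r cplx) \<Rightarrow> complex set" where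
  "resolvent_set T = {z. bij_betw (\<lambda>f. cscale z f - gen T f) (gen_dom T) UNIV
                        \<and> (\<exists>K. \<forall>g. cnorm (resolvent T z g) \<le> K * cnorm g)}"

definition gen_spectrum :: "(real \<Rightarrow> 'r::{real_normed_vector,order} cplx \<Rightarrow> 'r cplx) \<Rightarrow> complex set" where
  "gen_spectrum T = - resolvent_set T"

definition spectral_bound :: "(real \<Rightarrow> 'r::{real_normed_vector,order} cplx \<Rightarrow> 'r cplx) \<Rightarrow> real" where
  "spectral_bound T = Sup (Re ` gen_spectrum T)"

definition peripheral_spectrum :: "(real \<Rightarrow> 'r::{real_normed_vector,order} cplx \<Rightarrow> 'r cplx) \<Rightarrow> complex set" where
  "peripheral_spectrum T = {z \<in> gen_spectrum T. Re z = spectral_bound T}"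

text \<open>mu is a pole of the resolvent: on a punctured disc around mu the resolvent
  exists and has a Laurent expansion (in operator norm) with finitely many
  negative powers: R(lambda) = sum_{n>=0} (lambda - mu)^(n - m) B_n.\<close>
definition resolvent_pole :: "(real \<Rightarrow> 'r::{real_normed_vector,order} cplx \<Rightarrow> 'r cplx) \<Rightarrow> complex \<Rightarrow> bool" where
  "resolvent_pole T \<mu> \<longleftrightarrow> (\<exists>r>0. \<exists>m::nat. \<exists>B::nat \<Rightarrow> 'r cplx \<Rightarrow> 'r cplx.
     (\<forall>n. bounded_op (B n)) \<and>
     (\<forall>z. 0 < cmod (z - \<mu>) \<and> cmod (z - \<mu>) < r \<longrightarrow>
        z \<in> resolvent_set T \<and>
        ((\<lambda>N. op_norm (\<lambda>f. resolvent T z f -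
             (\<Sum>n<N. cscale ((z - \<mu>) powi (int n - int m)) (B n f)))) \<longlonglongrightarrow> 0)))"

text \<open>spectral (Riesz) projection for an isolated spectral value mu:
  P = (1 / (2 pi i)) * contour integral of R(lambda) over a small circle around mu\<close>
definition spectral_proj :: "(real \<Rightarrow> 'r::{real_normed_vector,order} cplx \<Rightarrow> 'r cplx) \<Rightarrow> complex \<Rightarrow> 'r cplx \<Rightarrow> 'r cplx" where
  "spectral_proj T \<mu> f =
     (let r = (SOME r. r > 0 \<and> cball \<mu> r \<inter> gen_spectrum T = {\<mu>}) in
      cscale (1 / (2 * of_real pi * \<i>))
        (integral {0..2*pi} (\<lambda>\<theta>. cscale (\<i> * of_real r * exp (\<i> * of_real \<theta>))
                                 (resolvent T (\<mu> + of_real r * exp (\<i> * of_real \<theta>)) f))))"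

definition indiv_ev_strongly_pos :: "'r::{real_normed_vector,order} \<Rightarrow> (real \<Rightarrow> 'r cplx \<Rightarrow> 'r cplx) \<Rightarrow> bool" where
  "indiv_ev_strongly_pos u T \<longleftrightarrow>
     (\<forall>f. strictly_pos f \<longrightarrow> (\<exists>t0>0. \<forall>t\<ge>t0. gg_u u (T t f)))"

end

theory Submission
  imports Defs
begin

text \<open>Let \<open>V(t) = e\<^bsup>t(A - s(A))\<^esup>\<close>.

  (i) to (ii): Eventual positivity lets the resolvent preserve the cone of vectors with positive orbit,
  first far to the right on the real axis and then, by stepping with the fixed point equation
  \<open>R(\<lambda>)f = R(\<mu>)(f + (\<mu> - \<lambda>)R(\<lambda>)f)\<close>, as far as the real axis stays in the resolvent set. Wherever
  this holds on a half-line, Laplace integrals converge on the corresponding half-plane, so \<open>s(A)\<close> is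
  spectral and thus a pole. The leading Laurent coefficient is positive and its range consists of fixed
  vectors of \<open>V\<close>; a positive fixed vector \<open>v\<close> dominates \<open>u\<close>. Since \<open>V(\<tau>)\<close> maps into the ideal of
  \<open>u\<close>, orbits are eventually squeezed between multiples of \<open>v\<close>, so \<open>V\<close> is bounded and the pole is
  simple. For an eigenvalue \<open>i\<omega> \<noteq> 0\<close> the real part \<open>x\<close> of an eigenvector is \<open>V\<close>-periodic; if \<open>c\<close> is
  minimal with \<open>x \<le> cv\<close>, strong positivity forces \<open>x = cv\<close>, which is then fixed, a contradiction.

  (ii) to (iii): On the kernel of the spectral projection the imaginary axis lies in the resolvent
  set. Convolving a bounded orbit with a Fejer kernel replaces the orbit by
  a Fourier integral of the resolvent over a compact piece of the imaginary axis, which tends to zero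
  by the Riemann-Lebesgue lemma; as the orbit is uniformly continuous, it tends to zero itself.

  (iii) to (i): \<open>V(\<tau>)\<close> is bounded from \<open>E\<close> to \<open>E\<^sub>u\<close> with the gauge norm, so the convergence to \<open>Qf\<close>
  holds in the gauge norm.\<close>

text \<open>The obstacle is that in (i) the time after which an orbit becomes positive depends on
  the vector. No single \<open>T t\<close> need be a positive operator, the resolvent need not be
  positive on \<open>cpos\<close>, and bounds are first obtained orbit by orbit and then made
  uniform by Baire's theorem. The vectors whose whole orbit is positive form a closed invariant cone
  which every positive vector enters under (i); a leading Laurent coefficient at 0 takes the same
  value on \<open>f\<close> and on \<open>T t f\<close>, so its positivity on this cone reaches all
  of \<open>cpos\<close>. Analyticity enters only through the resolvent identity: a pole is recorded
  by its leading coefficient with an error bound, and the Riesz integral is evaluated by shrinking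
  the circle. The spectral arguments are made with the spectral bound moved to 0. The working norm
  is the product norm on pairs. It is equivalent to \<open>cnorm\<close> with a factor 2 each way
  and need not be homogeneous under complex scalars, which explains most factors 2 and 4. As vectors
  of the complexification are pairs, quantifiers over them are kept unsplit.\<close>

declare split_paired_All [simp del] split_paired_Ex [simp del]

subsection \<open>Banach lattices\<close>

lemma le_lat_abs: "x \<le> lat_abs x" "- x \<le> lat_abs x"
  by (simp_all add: lat_abs_def)

lemma lat_abs_le_iff: "lat_abs x \<le> y \<longleftrightarrow> x \<le> y \<and> - x \<le> y"
  by (simp add: lat_abs_def)

lemma lat_abs_nonneg: "0 \<le> lat_abs (x :: 'r :: {ordered_real_vector,lattice})"
proof -
  have "0 \<le> lat_abs x + lat_abs x"
    using add_mono[OF le_lat_abs(1)[of x] le_lat_abs(2)[of x]] by simp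
  then have "(1/2) *\<^sub>R 0 \<le> (1/2) *\<^sub>R (lat_abs x + lat_abs x)"
    by (intro scaleR_left_mono) auto
  then show ?thesis
    by (simp add: scaleR_2[symmetric])
qed

lemma lat_abs_of_nonneg: "0 \<le> x \<Longrightarrow> lat_abs x = (x :: 'r :: {ordered_ab_group_add,lattice})"
  by (intro antisym) (auto simp: lat_abs_le_iff le_lat_abs intro: order_trans[of _ 0])

lemma scaleR_le_scaleR_lat_abs:
  fixes x :: "'r :: {ordered_real_vector,lattice}"
  assumes "\<bar>c\<bar> \<le> d"
  shows "c *\<^sub>R x \<le> d *\<^sub>R lat_abs x"
proof (cases "c \<ge> 0")
  case True
  have "c *\<^sub>R x \<le> c *\<^sub>R lat_abs x" using True by (intro scaleR_left_mono le_lat_abs)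
  also have "\<dots> \<le> d *\<^sub>R lat_abs x"
    using assms by (intro scaleR_right_mono lat_abs_nonneg) auto
  finally show ?thesis .
next
  case False
  have "c *\<^sub>R x = (- c) *\<^sub>R (- x)" by simp
  also have "\<dots> \<le> (- c) *\<^sub>R lat_abs x" using False by (intro scaleR_left_mono le_lat_abs) auto
  also have "\<dots> \<le> d *\<^sub>R lat_abs x"
    using assms by (intro scaleR_right_mono lat_abs_nonneg) auto
  finally show ?thesis .
qed

locale banach_lattice =
  fixes R :: "'r::{banach,ordered_real_vector,lattice} itself"
  assumes lattice_norm: "banach_lattice_norm TYPE('r)"
begin

lemma norm_mono_lat_abs: "lat_abs x \<le> lat_abs y \<Longrightarrow> norm (x::'r) \<le> norm y"
  using lattice_norm by (auto simp: banach_lattice_norm_def)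

lemma norm_lat_abs: "norm (lat_abs (x::'r)) = norm x"
  by (intro antisym norm_mono_lat_abs) (simp_all add: lat_abs_of_nonneg lat_abs_nonneg)

lemma norm_mono_dominated:
  assumes "(x::'r) \<le> y" "- x \<le> y"
  shows "norm x \<le> norm y"
  using assms le_lat_abs(1)[of y]
  by (intro norm_mono_lat_abs) (auto simp: lat_abs_le_iff intro: order_trans)

text \<open>The negative part \<open>sup (- x) 0\<close> of a limit is dominated by the modulus of
  \<open>X n - x\<close>, because \<open>X n\<close> is positive; the lattice norm then forces it to
  vanish.\<close>

lemma closed_nonneg: "closed {x::'r. 0 \<le> x}"
proof (unfold closed_sequential_limits, safe)
  fix X :: "nat \<Rightarrow> 'r" and x
  assume X: "\<forall>n. X n \<in> {x. 0 \<le> x}" and lim: "X \<longlonglongrightarrow> x"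
  have "norm (sup (- x) 0) \<le> norm (X n - x)" for n
  proof -
    have "- x \<le> X n - x" using X by simp
    also have "\<dots> \<le> lat_abs (X n - x)" by (rule le_lat_abs)
    finally have le: "sup (- x) 0 \<le> lat_abs (X n - x)" by (simp add: lat_abs_nonneg)
    have "- sup (- x) 0 \<le> 0" by simp
    also have "\<dots> \<le> lat_abs (X n - x)" by (rule lat_abs_nonneg)
    finally have "norm (sup (- x) 0) \<le> norm (lat_abs (X n - x))"
      using le by (rule norm_mono_dominated[rotated])
    then show ?thesis by (simp add: norm_lat_abs)
  qed
  moreover have "(\<lambda>n. norm (X n - x)) \<longlonglongrightarrow> 0"
    using lim by (simp add: LIM_zero tendsto_norm_zero)
  ultimately have "norm (sup (- x) 0) \<le> 0"
    by (intro LIMSEQ_le_const[of "\<lambda>n. norm (X n - x)"]) auto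
  then show "0 \<le> x" by (simp add: sup.absorb_iff2[symmetric])
qed

lemma lat_tendsto_le:
  assumes "(f \<longlongrightarrow> (x::'r)) F" "(g \<longlongrightarrow> y) F" "eventually (\<lambda>a. f a \<le> g a) F" "F \<noteq> bot"
  shows "x \<le> y"
proof -
  have "((\<lambda>a. g a - f a) \<longlongrightarrow> y - x) F" using assms by (intro tendsto_intros)
  then have "y - x \<in> {x. 0 \<le> x}"
    using assms(3,4) by (intro Lim_in_closed_set[OF closed_nonneg _ assms(4)]) (auto elim: eventually_mono)
  then show ?thesis by simp
qed

end

text \<open>Sine and cosine are 1-Lipschitz, so the family of rotations whose supremum is the
  modulus is Lipschitz in the angle, measured by the fixed vector \<open>e\<close>. This lets
  finitely many angles stand for all.\<close>

lemma cos_sin_combination_le: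
  fixes x y e :: "'r::{ordered_real_vector,lattice}"
  assumes "e = lat_abs x + lat_abs y"
  shows "cos s *\<^sub>R x + sin s *\<^sub>R y \<le> cos t *\<^sub>R x + sin t *\<^sub>R y + \<bar>s - t\<bar> *\<^sub>R e"
proof -
  have c: "\<bar>cos s - cos t\<bar> \<le> \<bar>s - t\<bar>" for s t :: real
  proof (induction s t rule: linorder_wlog)
    case (le s t)
    show ?case
    proof (cases "s = t")
      case False
      with le obtain z where "cos t - cos s = (t - s) * (- sin z)"
        using MVT2[of s t cos "\<lambda>z. - sin z"] by (auto intro: derivative_eq_intros)
      then have "\<bar>cos t - cos s\<bar> = \<bar>t - s\<bar> * \<bar>sin z\<bar>" by (simp add: abs_mult)
      also have "\<dots> \<le> \<bar>t - s\<bar> * 1" by (intro mult_left_mono) auto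
      finally show ?thesis by (simp add: abs_minus_commute)
    qed simp
  qed (simp add: abs_minus_commute)
  have s: "\<bar>sin s - sin t\<bar> \<le> \<bar>s - t\<bar>"
    using c[of "pi/2 - s" "pi/2 - t"] by (simp add: cos_diff)
  have "(cos s - cos t) *\<^sub>R x + (sin s - sin t) *\<^sub>R y \<le> \<bar>s - t\<bar> *\<^sub>R lat_abs x + \<bar>s - t\<bar> *\<^sub>R lat_abs y"
    using c[of s t] s by (intro add_mono scaleR_le_scaleR_lat_abs)
  then show ?thesis
    by (simp add: assms algebra_simps)
qed

text \<open>A lattice supplies finite suprema only. Those over equidistant angles form a Cauchy
  sequence by the Lipschitz bound, and completeness together with closedness of the order yields the
  supremum over all angles.\<close>

lemma (in banach_lattice) exists_cmodulus:
  fixes x y :: 'r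
  shows "\<exists>z. is_lub_in {cos \<theta> *\<^sub>R x + sin \<theta> *\<^sub>R y | \<theta>. True} z"
proof -
  define S where "S \<theta> = cos \<theta> *\<^sub>R x + sin \<theta> *\<^sub>R y" for \<theta> :: real
  define e where "e = lat_abs x + lat_abs y"
  have e0: "0 \<le> e" by (simp add: e_def lat_abs_nonneg)
  \<comment> \<open>The grid has \<open>Suc n\<close> steps and includes both 0 and 2 pi, so every
    angle has a grid point at most one step to its left.\<close>
  define Z where "Z n = Sup_fin ((\<lambda>k. S (2 * pi * real k / real (Suc n))) ` {..Suc n})" for n :: nat
  have ub: "S \<theta> \<le> Z n + (7 / real (Suc n)) *\<^sub>R e" for \<theta> n
  proof -
    have "(cos \<theta>)\<^sup>2 + (sin \<theta>)\<^sup>2 = 1" by simp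
    then obtain t where t: "0 \<le> t" "t < 2 * pi" "cos \<theta> = cos t" "sin \<theta> = sin t"
      using sincos_total_2pi by metis
    define k where "k = nat \<lfloor>t * real (Suc n) / (2 * pi)\<rfloor>"
    define a where "a = 2 * pi * real k / real (Suc n)"
    have k: "real k \<le> t * real (Suc n) / (2 * pi)" "t * real (Suc n) / (2 * pi) \<le> real k + 1"
      using t by (auto simp: k_def)
    have "t * real (Suc n) \<le> 2 * pi * real (Suc n)"
      using t by (intro mult_right_mono) auto
    then have "t * real (Suc n) / (2 * pi) \<le> real (Suc n)"
      by (simp add: divide_le_eq mult.commute)
    with k have kn: "k \<le> Suc n" by linarith
    have "a + 2 * pi / real (Suc n) = 2 * pi * (real k + 1) / real (Suc n)"
      by (simp add: a_def add_divide_distrib algebra_simps)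
    then have "a \<le> t" "t \<le> a + 2 * pi / real (Suc n)"
      using k by (simp_all add: a_def pos_divide_le_eq pos_le_divide_eq mult.commute)
    then have "\<bar>t - a\<bar> \<le> 2 * pi / real (Suc n)" by auto
    \<comment> \<open>7 is a rational bound for 2 pi.\<close>
    also have "\<dots> \<le> 7 / real (Suc n)" using pi_approx by (intro divide_right_mono) auto
    finally have at: "\<bar>t - a\<bar> \<le> 7 / real (Suc n)" .
    have "S \<theta> \<le> S a + \<bar>t - a\<bar> *\<^sub>R e"
      unfolding S_def t by (rule cos_sin_combination_le) (fact e_def)
    also have "\<dots> \<le> S a + (7 / real (Suc n)) *\<^sub>R e"
      using at e0 by (intro add_left_mono scaleR_right_mono)
    also have "S a \<le> Z n"
      unfolding Z_def using kn by (intro Sup_fin.coboundedI) (auto simp: a_def)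
    finally show ?thesis by simp
  qed
  have Z_le: "Z n \<le> w" if "\<And>\<theta>. S \<theta> \<le> w" for n w
    unfolding Z_def by (intro Sup_fin.boundedI) (auto intro: that)
  \<comment> \<open>The grids need not be nested: \<open>Z m\<close> is a supremum of some of the
    rotations, and each of these is below \<open>Z n\<close> plus its error.\<close>
  have ZZ: "Z m \<le> Z n + (7 / real (Suc n)) *\<^sub>R e" for m n
    by (rule Z_le) (rule ub)
  have inv: "(\<lambda>n. 7 / real (Suc n)) \<longlonglongrightarrow> 0"
    using LIMSEQ_inverse_real_of_nat tendsto_mult_right_zero by (fastforce simp: divide_inverse)
  have "Cauchy Z"
  proof (rule CauchyI)
    fix \<epsilon> :: real assume "\<epsilon> > 0"
    have "(\<lambda>n. 7 / real (Suc n) * norm e) \<longlonglongrightarrow> 0"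
      using tendsto_mult_left_zero[OF inv] by simp
    with \<open>\<epsilon> > 0\<close> have "eventually (\<lambda>n. 7 / real (Suc n) * norm e < \<epsilon>) sequentially"
      by (simp add: order_tendstoD)
    then obtain N where N: "\<And>n. n \<ge> N \<Longrightarrow> 7 / real (Suc n) * norm e < \<epsilon>"
      by (auto simp: eventually_sequentially)
    have "norm (Z m - Z n) < \<epsilon>" if "m \<ge> N" "n \<ge> N" for m n
    proof -
      define k where "k = min m n"
      have *: "Z a \<le> Z b + (7 / real (Suc k)) *\<^sub>R e" if "b \<in> {m, n}" for a b
      proof -
        have "(7 / real (Suc b)) *\<^sub>R e \<le> (7 / real (Suc k)) *\<^sub>R e"
          using that e0 by (intro scaleR_right_mono) (auto simp: k_def field_simps)
        then show ?thesis using ZZ[of a b] by (meson add_left_mono order_trans)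
      qed
      have "Z m - Z n \<le> (7 / real (Suc k)) *\<^sub>R e" "- (Z m - Z n) \<le> (7 / real (Suc k)) *\<^sub>R e"
        using *[of n m] *[of m n] by (simp_all add: algebra_simps)
      then have "norm (Z m - Z n) \<le> norm ((7 / real (Suc k)) *\<^sub>R e)"
        by (rule norm_mono_dominated)
      also have "\<dots> < \<epsilon>" using N[of k] that by (simp add: k_def)
      finally show ?thesis .
    qed
    then show "\<exists>M. \<forall>m\<ge>M. \<forall>n\<ge>M. norm (Z m - Z n) < \<epsilon>" by blast
  qed
  then obtain z where z: "Z \<longlonglongrightarrow> z" using Cauchy_convergent_iff convergent_def by blast
  have "S \<theta> \<le> z" for \<theta>
  proof (rule lat_tendsto_le[OF tendsto_const])
    have "(\<lambda>n. Z n + (7 / real (Suc n)) *\<^sub>R e) \<longlonglongrightarrow> z + 0 *\<^sub>R e"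
      by (intro tendsto_intros z inv)
    then show "(\<lambda>n. Z n + (7 / real (Suc n)) *\<^sub>R e) \<longlonglongrightarrow> z" by simp
  qed (use ub in auto)
  moreover have "z \<le> w" if "\<And>\<theta>. S \<theta> \<le> w" for w
    by (rule lat_tendsto_le[OF z tendsto_const]) (use Z_le[OF that] in auto)
  ultimately show ?thesis
    by (intro exI[of _ z]) (auto simp: is_lub_in_def S_def)
qed

lemma (in banach_lattice) cmodulus_is_lub:
  "is_lub_in {cos \<theta> *\<^sub>R fst f + sin \<theta> *\<^sub>R snd f | \<theta>. True} (cmodulus (f :: 'r cplx))"
  unfolding cmodulus_def
proof (rule theI')
  show "\<exists>!z. is_lub_in {cos \<theta> *\<^sub>R fst f + sin \<theta> *\<^sub>R snd f | \<theta>. True} z"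
    using exists_cmodulus[of "fst f" "snd f"]
    by (auto simp: is_lub_in_def intro: antisym)
qed

context banach_lattice
begin

lemma lat_abs_fst_le_cmodulus: "lat_abs (fst f) \<le> cmodulus (f :: 'r cplx)"
proof -
  have *: "cos \<theta> *\<^sub>R fst f + sin \<theta> *\<^sub>R snd f \<le> cmodulus f" for \<theta>
    using cmodulus_is_lub[of f] unfolding is_lub_in_def by blast
  show ?thesis using *[of 0] *[of pi] by (simp add: lat_abs_le_iff)
qed

lemma lat_abs_snd_le_cmodulus: "lat_abs (snd f) \<le> cmodulus (f :: 'r cplx)"
proof -
  have *: "cos \<theta> *\<^sub>R fst f + sin \<theta> *\<^sub>R snd f \<le> cmodulus f" for \<theta>
    using cmodulus_is_lub[of f] unfolding is_lub_in_def by blast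
  show ?thesis using *[of "pi/2"] *[of "-(pi/2)"] by (simp add: lat_abs_le_iff)
qed

lemma cmodulus_le: "cmodulus (f :: 'r cplx) \<le> lat_abs (fst f) + lat_abs (snd f)"
proof -
  have "cos \<theta> *\<^sub>R fst f + sin \<theta> *\<^sub>R snd f \<le> 1 *\<^sub>R lat_abs (fst f) + 1 *\<^sub>R lat_abs (snd f)" for \<theta>
    by (intro add_mono scaleR_le_scaleR_lat_abs) auto
  then show ?thesis
    using cmodulus_is_lub[of f] unfolding is_lub_in_def by auto
qed

lemma cmodulus_nonneg: "0 \<le> cmodulus (f :: 'r cplx)"
  by (rule order_trans[OF lat_abs_nonneg lat_abs_fst_le_cmodulus])

lemma norm_le_cnorm: "norm (f :: 'r cplx) \<le> 2 * cnorm f"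
proof -
  have "norm (fst f) \<le> cnorm f" "norm (snd f) \<le> cnorm f"
    unfolding cnorm_def
    by (intro norm_mono_lat_abs, simp add: lat_abs_of_nonneg cmodulus_nonneg
        lat_abs_fst_le_cmodulus lat_abs_snd_le_cmodulus)+
  moreover have "norm f \<le> norm (fst f) + norm (snd f)"
    by (metis norm_Pair_le prod.collapse)
  ultimately show ?thesis by simp
qed

lemma cnorm_le_norm: "cnorm (f :: 'r cplx) \<le> 2 * norm f"
proof -
  have "cnorm f \<le> norm (lat_abs (fst f) + lat_abs (snd f))"
    unfolding cnorm_def
    by (intro norm_mono_lat_abs) (simp add: lat_abs_of_nonneg cmodulus_nonneg lat_abs_nonneg cmodulus_le)
  also have "\<dots> \<le> norm (fst f) + norm (snd f)"
    using norm_triangle_ineq[of "lat_abs (fst f)" "lat_abs (snd f)"] by (simp add: norm_lat_abs)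
  also have "\<dots> \<le> 2 * norm f" using norm_fst_le[of "fst f" "snd f"] norm_snd_le[of "snd f" "fst f"] by simp
  finally show ?thesis .
qed

lemma cnorm_nonneg: "0 \<le> cnorm (f :: 'r cplx)" by (simp add: cnorm_def)

lemma cnorm_tendsto_iff: "((\<lambda>x. cnorm (g x :: 'r cplx)) \<longlongrightarrow> 0) F \<longleftrightarrow> (g \<longlongrightarrow> 0) F"
proof
  assume *: "((\<lambda>x. cnorm (g x)) \<longlongrightarrow> 0) F"
  show "(g \<longlongrightarrow> 0) F"
    by (rule Lim_null_comparison[OF always_eventually[OF allI[OF norm_le_cnorm]]])
       (rule tendsto_mult_right_zero[OF *])
next
  assume *: "(g \<longlongrightarrow> 0) F"
  show "((\<lambda>x. cnorm (g x)) \<longlongrightarrow> 0) F"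
    by (rule Lim_null_comparison[OF always_eventually, of _ "\<lambda>x. 2 * norm (g x)"])
       (auto simp: cnorm_nonneg cnorm_le_norm intro!: tendsto_mult_right_zero tendsto_norm_zero *)
qed

text \<open>Stated for a family so that it serves both a single operator, over a one-element index
  set, and the uniform boundedness of a whole semigroup.\<close>

lemma bounded_by_cnorm_iff:
  "(\<exists>K. \<forall>i\<in>I. \<forall>f. cnorm (B i f :: 'r cplx) \<le> K * cnorm (f :: 'r cplx)) \<longleftrightarrow>
   (\<exists>K. \<forall>i\<in>I. \<forall>f. norm (B i f) \<le> K * norm f)"
proof safe
  fix K assume K: "\<forall>i\<in>I. \<forall>f. cnorm (B i f) \<le> K * cnorm f"
  have "norm (B i f) \<le> 4 * \<bar>K\<bar> * norm f" if "i \<in> I" for i f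
  proof -
    have "norm (B i f) \<le> 2 * cnorm (B i f)" by (rule norm_le_cnorm)
    also have "cnorm (B i f) \<le> \<bar>K\<bar> * cnorm f"
      using K that cnorm_nonneg[of f] by (meson abs_ge_self mult_right_mono order_trans)
    also have "\<bar>K\<bar> * cnorm f \<le> \<bar>K\<bar> * (2 * norm f)" by (intro mult_left_mono cnorm_le_norm) auto
    finally show ?thesis by simp
  qed
  then show "\<exists>K. \<forall>i\<in>I. \<forall>f. norm (B i f) \<le> K * norm f" by blast
next
  fix K assume K: "\<forall>i\<in>I. \<forall>f. norm (B i f) \<le> K * norm f"
  have "cnorm (B i f) \<le> 4 * \<bar>K\<bar> * cnorm f" if "i \<in> I" for i f
  proof -
    have "cnorm (B i f) \<le> 2 * norm (B i f)" by (rule cnorm_le_norm)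
    also have "norm (B i f) \<le> \<bar>K\<bar> * norm f"
      using K that by (meson abs_ge_self mult_right_mono norm_ge_zero order_trans)
    also have "\<bar>K\<bar> * norm f \<le> \<bar>K\<bar> * (2 * cnorm f)" by (intro mult_left_mono norm_le_cnorm) auto
    finally show ?thesis by simp
  qed
  then show "\<exists>K. \<forall>i\<in>I. \<forall>f. cnorm (B i f) \<le> K * cnorm f" by blast
qed

end

subsection \<open>Complex scalars on pairs\<close>

lemma bounded_bilinear_cscale: "bounded_bilinear (cscale :: complex \<Rightarrow> 'r::real_normed_vector cplx \<Rightarrow> _)"
proof
  fix c d :: complex and f g :: "'r cplx" and r :: real
  show "cscale (c + d) f = cscale c f + cscale d f" "cscale c (f + g) = cscale c f + cscale c g"
    "cscale (r *\<^sub>R c) f = r *\<^sub>R cscale c f" "cscale c (r *\<^sub>R f) = r *\<^sub>R cscale c f"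
    by (simp_all add: cscale_def algebra_simps)
  have "norm (cscale c f) \<le> norm f * norm c * 4" for c and f :: "'r cplx"
  proof -
    have "norm (cscale c f) \<le> norm (fst (cscale c f)) + norm (snd (cscale c f))"
      by (metis norm_Pair_le prod.collapse)
    also have "\<dots> \<le> (\<bar>Re c\<bar> + \<bar>Im c\<bar>) * (norm (fst f) + norm (snd f))"
      by (simp add: cscale_def algebra_simps
          order_trans[OF norm_triangle_ineq4] order_trans[OF norm_triangle_ineq])
         (smt (verit, best) norm_scaleR norm_triangle_ineq norm_triangle_ineq4)
    also have "\<dots> \<le> (2 * norm c) * (2 * norm f)"
      using abs_Re_le_cmod[of c] abs_Im_le_cmod[of c] norm_fst_le[of "fst f" "snd f"] norm_snd_le[of "snd f" "fst f"]
      by (intro mult_mono) auto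
    finally show ?thesis by (simp add: algebra_simps)
  qed
  then show "\<exists>K. \<forall>a b. norm (cscale a (b :: 'r cplx)) \<le> norm a * norm b * K"
    by (metis mult.commute)
qed

interpretation cscale: bounded_bilinear "cscale :: complex \<Rightarrow> 'r::real_normed_vector cplx \<Rightarrow> _"
  by (rule bounded_bilinear_cscale)

lemma cscale_cscale [simp]: "cscale c (cscale d f) = cscale (c * d) f"
  by (simp add: cscale_def algebra_simps)

lemma cscale_one [simp]: "cscale 1 f = f"
  by (simp add: cscale_def)

lemma cscale_of_real [simp]: "cscale (of_real r) f = r *\<^sub>R f"
  by (simp add: cscale_def prod_eq_iff)

lemma cscale_scaleR [simp]: "cscale c (r *\<^sub>R f) = r *\<^sub>R cscale c f"
  by (simp add: cscale_def algebra_simps)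

text \<open>The product norm is Euclidean in the two components, so rotating a pair can enlarge it.
  The estimate of the squares gives the square root of 2, rounded up to 2.\<close>

lemma norm_cscale_le: "norm (cscale c f) \<le> 2 * cmod c * norm (f :: 'r::real_normed_vector cplx)"
proof -
  obtain x y where f: "f = (x, y)" by (cases f)
  have sq: "(a + b)\<^sup>2 \<le> 2 * (a\<^sup>2 + b\<^sup>2)" for a b :: real
    using sum_squares_bound[of a b] by (simp add: power2_sum)
  have "(norm (cscale c f))\<^sup>2 = (norm (Re c *\<^sub>R x - Im c *\<^sub>R y))\<^sup>2 + (norm (Im c *\<^sub>R x + Re c *\<^sub>R y))\<^sup>2"
    by (simp add: cscale_def f norm_Pair)
  also have "\<dots> \<le> (\<bar>Re c\<bar> * norm x + \<bar>Im c\<bar> * norm y)\<^sup>2 + (\<bar>Im c\<bar> * norm x + \<bar>Re c\<bar> * norm y)\<^sup>2"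
    by (intro add_mono power_mono order_trans[OF norm_triangle_ineq4] order_trans[OF norm_triangle_ineq]) auto
  also have "\<dots> \<le> 2 * ((\<bar>Re c\<bar> * norm x)\<^sup>2 + (\<bar>Im c\<bar> * norm y)\<^sup>2 + (\<bar>Im c\<bar> * norm x)\<^sup>2 + (\<bar>Re c\<bar> * norm y)\<^sup>2)"
    using add_mono[OF sq[of "\<bar>Re c\<bar> * norm x" "\<bar>Im c\<bar> * norm y"]
      sq[of "\<bar>Im c\<bar> * norm x" "\<bar>Re c\<bar> * norm y"]]
    by (simp only: distrib_left add.assoc)
  also have "\<dots> = 2 * ((cmod c)\<^sup>2 * (norm f)\<^sup>2)"
    by (simp add: f norm_Pair cmod_power2 algebra_simps power_mult_distrib)
  also have "\<dots> \<le> (2 * cmod c * norm f)\<^sup>2"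
    by (simp add: power_mult_distrib)
  finally show ?thesis by (rule power2_le_imp_le) simp
qed

subsection \<open>Consequences of the Baire category theorem\<close>

text \<open>Baire gives a ball around some \<open>x\<close>; averaging \<open>x + y\<close> with the
  reflected point \<open>- (x - y)\<close> moves it to the origin. Both the uniform boundedness
  principle and the boundedness of \<open>T \<tau>\<close> into the ideal of \<open>u\<close> rest
  on this form.\<close>

lemma baire_symmetric_convex:
  fixes A :: "nat \<Rightarrow> 'a::banach set"
  assumes cl: "\<And>n. closed (A n)" and conv: "\<And>n. convex (A n)"
    and sym: "\<And>n x. x \<in> A n \<Longrightarrow> - x \<in> A n" and un: "(\<Union>n. A n) = UNIV"
  obtains n r where "r > 0" "cball 0 r \<subseteq> A n"
proof -
  have "\<exists>n. interior (A n) \<noteq> {}"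
  proof (rule ccontr)
    assume "\<nexists>n. interior (A n) \<noteq> {}"
    moreover have "Met_TC.mcomplete TYPE('a)"
      by (simp add: mcomplete_iff_complete complete_UNIV)
    ultimately have "Met_TC.mtopology interior_of \<Union>(range A) = {}"
      using cl by (intro Met_TC.metric_Baire_category_alt) auto
    then show False using un by simp
  qed
  then obtain n x e where e: "e > 0" "ball x e \<subseteq> A n"
    by (meson ex_in_conv mem_interior)
  have "y \<in> A n" if "norm y \<le> e/2" for y
  proof -
    have "x + y \<in> A n" "x - y \<in> A n"
      using e that by (auto simp: dist_norm intro!: subsetD[OF e(2)])
    then have "(1/2) *\<^sub>R (x + y) + (1/2) *\<^sub>R (- (x - y)) \<in> A n"
      by (intro convexD[OF conv] sym) auto
    moreover have "(1/2) *\<^sub>R (x + y) + (1/2) *\<^sub>R (- (x - y)) = y"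
      by (simp add: algebra_simps flip: scaleR_add_left)
    ultimately show ?thesis by simp
  qed
  then show thesis using e by (intro that[of "e/2" n]) auto
qed

text \<open>The sets on which the whole family is bounded by \<open>n\<close> are closed, convex and
  symmetric and exhaust the space, so one of them contains a ball around 0; scaling does the
  rest.\<close>

lemma uniform_boundedness:
  fixes B :: "'i \<Rightarrow> 'a::banach \<Rightarrow> 'b::real_normed_vector"
  assumes lin: "\<And>i. i \<in> I \<Longrightarrow> bounded_linear (B i)"
    and bdd: "\<And>f. \<exists>K. \<forall>i\<in>I. norm (B i f) \<le> K"
  obtains K where "K \<ge> 0" "\<And>i f. i \<in> I \<Longrightarrow> norm (B i f) \<le> K * norm f"
proof -
  define A where "A n = (\<Inter>i\<in>I. {f. norm (B i f) \<le> real n})" for n :: nat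
  obtain n r where r: "r > 0" "cball 0 r \<subseteq> A n"
  proof (rule baire_symmetric_convex[of A])
    show "closed (A n)" for n
      unfolding A_def
      by (intro closed_INT ballI closed_Collect_le continuous_intros)
         (auto intro: linear_continuous_on lin)
    show "convex (A n)" for n
      unfolding A_def
    proof (intro convex_INT convexI)
      fix i x y and u v :: real
      assume i: "i \<in> I" and *: "x \<in> {f. norm (B i f) \<le> real n}" "y \<in> {f. norm (B i f) \<le> real n}"
        "0 \<le> u" "0 \<le> v" "u + v = 1"
      interpret bounded_linear "B i" by (rule lin[OF i])
      have "norm (B i (u *\<^sub>R x + v *\<^sub>R y)) \<le> u * norm (B i x) + v * norm (B i y)"
        using * norm_triangle_ineq[of "u *\<^sub>R B i x" "v *\<^sub>R B i y"] by (simp add: add scaleR)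
      also have "\<dots> \<le> u * n + v * n" using * by (intro add_mono mult_left_mono) auto
      also have "\<dots> = n" using * by (simp flip: distrib_right)
      finally show "u *\<^sub>R x + v *\<^sub>R y \<in> {f. norm (B i f) \<le> real n}" by simp
    qed
    show "- x \<in> A n" if "x \<in> A n" for n x
      using that by (auto simp: A_def linear_neg bounded_linear.linear lin)
    have "\<exists>n. f \<in> A n" for f
    proof -
      obtain K where "\<forall>i\<in>I. norm (B i f) \<le> K" using bdd by blast
      moreover obtain n :: nat where "K \<le> real n" using real_arch_simple by blast
      ultimately show ?thesis by (auto simp: A_def intro!: exI[of _ n])
    qed
    then show "(\<Union>n. A n) = UNIV" by auto
  qed
  have "norm (B i f) \<le> (real n / r) * norm f" if i: "i \<in> I" for i f
  proof (cases "f = 0")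
    case False
    interpret bounded_linear "B i" by (rule lin[OF i])
    have "(r / norm f) *\<^sub>R f \<in> A n" using r False by (intro subsetD[OF r(2)]) auto
    then have "norm (B i ((r / norm f) *\<^sub>R f)) \<le> n" using i by (auto simp: A_def)
    then show ?thesis using r False by (simp add: scaleR field_simps)
  qed (use linear_0[OF bounded_linear.linear[OF lin[OF i]]] in simp)
  then show thesis using r by (intro that[of "real n / r"]) auto
qed

section \<open>Limits of exponentials and of real parameters\<close>

lemma filterlim_of_real_at_right: "filterlim (of_real :: real \<Rightarrow> complex) (at 0) (at_right 0)"
  by (auto simp: filterlim_at eventually_at_filter intro!: tendsto_eq_intros)

lemma exp_minus_one_div_tendsto:
  fixes z :: complex
  shows "((\<lambda>h::real. (exp (z * of_real h) - 1) / of_real h) \<longlongrightarrow> z) (at_right 0)"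
proof -
  have "((\<lambda>w. exp (z * w)) has_field_derivative z) (at 0)"
    by (auto intro!: derivative_eq_intros)
  then have *: "((\<lambda>w. (exp (z * w) - 1) / w) \<longlongrightarrow> z) (at 0)"
    by (simp add: has_field_derivative_iff)
  from filterlim_compose[OF * filterlim_of_real_at_right] show ?thesis .
qed

lemma filterlim_const_plus_at_top: "filterlim (\<lambda>N. h + N) at_top (at_top :: real filter)"
  by (rule filterlim_tendsto_add_at_top[OF tendsto_const filterlim_ident])

lemma exp_neg_mult_tendsto_0:
  assumes "a > 0" shows "((\<lambda>x. exp (- a * x)) \<longlongrightarrow> (0::real)) at_top"
proof -
  have "filterlim (\<lambda>x. (- a) * x) at_bot at_top"
    using assms by (intro filterlim_tendsto_neg_mult_at_bot[OF tendsto_const]) (auto intro: filterlim_ident)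
  then show ?thesis by (rule filterlim_compose[OF exp_at_bot])
qed

subsection \<open>Strongly continuous semigroups\<close>

text \<open>The generator is treated as a relation: \<open>gen_rel T f g\<close> says that \<open>f\<close> is in its domain and is
  mapped to \<open>g\<close>. Limits are taken in the product norm, which is equivalent to \<^const>\<open>cnorm\<close>.\<close>

definition gen_rel :: "(real \<Rightarrow> 'r::real_normed_vector cplx \<Rightarrow> 'r cplx) \<Rightarrow> 'r cplx \<Rightarrow> 'r cplx \<Rightarrow> bool" where
  "gen_rel T f g \<longleftrightarrow> ((\<lambda>h. inverse h *\<^sub>R (T h f - f)) \<longlongrightarrow> g) (at_right 0)"

text \<open>The two clauses say \<open>(z - A) B = I\<close> on the whole space and
  \<open>B (z - A) = I\<close> on the domain of the generator \<open>A\<close>. Complex linearity of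
  \<open>B\<close> follows from them.\<close>

definition res_op :: "(real \<Rightarrow> 'r::real_normed_vector cplx \<Rightarrow> 'r cplx) \<Rightarrow> complex \<Rightarrow> ('r cplx \<Rightarrow> 'r cplx) \<Rightarrow> bool" where
  "res_op T z B \<longleftrightarrow> bounded_linear B \<and> (\<forall>f. gen_rel T (B f) (cscale z (B f) - f))
     \<and> (\<forall>f g. gen_rel T f g \<longrightarrow> B (cscale z f - g) = f)"

definition rho :: "(real \<Rightarrow> 'r::real_normed_vector cplx \<Rightarrow> 'r cplx) \<Rightarrow> complex set" where
  "rho T = {z. \<exists>B. res_op T z B}"

definition Res :: "(real \<Rightarrow> 'r::real_normed_vector cplx \<Rightarrow> 'r cplx) \<Rightarrow> complex \<Rightarrow> 'r cplx \<Rightarrow> 'r cplx" where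
  "Res T z = (SOME B. res_op T z B)"

text \<open>This is the semigroup generated by \<open>A - z\<close>: a question about the resolvent
  at \<open>z\<close> becomes one at 0.\<close>

definition rescale :: "complex \<Rightarrow> (real \<Rightarrow> 'r::real_normed_vector cplx \<Rightarrow> 'r cplx) \<Rightarrow> real \<Rightarrow> 'r cplx \<Rightarrow> 'r cplx" where
  "rescale z T = (\<lambda>t f. cscale (exp (- (z * of_real t))) (T t f))"

text \<open>\<open>bounded_linear\<close> means real linearity only, hence the separate law for
  \<open>cscale\<close>.\<close>

locale c0_semigroup =
  fixes T :: "real \<Rightarrow> 'r::banach cplx \<Rightarrow> 'r cplx"
  assumes lin: "0 \<le> t \<Longrightarrow> bounded_linear (T t)"
    and T_cscale: "0 \<le> t \<Longrightarrow> T t (cscale c f) = cscale c (T t f)"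
    and T_at_0 [simp]: "T 0 f = f"
    and T_plus: "0 \<le> s \<Longrightarrow> 0 \<le> t \<Longrightarrow> T (s + t) f = T s (T t f)"
    and tendsto_at_0: "((\<lambda>t. T t f) \<longlongrightarrow> f) (at_right 0)"
begin

lemma T_add: "0 \<le> t \<Longrightarrow> T t (f + g) = T t f + T t g"
  and T_diff: "0 \<le> t \<Longrightarrow> T t (f - g) = T t f - T t g"
  and T_minus: "0 \<le> t \<Longrightarrow> T t (- f) = - T t f"
  and T_scaleR: "0 \<le> t \<Longrightarrow> T t (c *\<^sub>R f) = c *\<^sub>R T t f"
  and T_zero: "0 \<le> t \<Longrightarrow> T t 0 = 0"
  using lin[of t, THEN bounded_linear.linear]
  by (auto simp: linear_add linear_diff linear_neg linear_cmul linear_0)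

lemma T_commute: "0 \<le> s \<Longrightarrow> 0 \<le> t \<Longrightarrow> T s (T t f) = T t (T s f)"
  by (metis T_plus add.commute)

text \<open>Otherwise there are times tending to 0 along which the operators are not uniformly
  bounded although every orbit converges, against the uniform boundedness principle.\<close>

lemma locally_bounded: "\<exists>\<delta>>0. \<exists>M. \<forall>t. 0 \<le> t \<and> t \<le> \<delta> \<longrightarrow> (\<forall>f. norm (T t f) \<le> M * norm f)"
proof (rule ccontr)
  assume "\<not> ?thesis"
  then have "\<forall>n. \<exists>t f. 0 \<le> t \<and> t \<le> 1 / real (Suc n) \<and> norm (T t f) > real n * norm f"
    by (metis not_less divide_pos_pos of_nat_0_less_iff zero_less_Suc zero_less_one)
  then obtain t f where t: "\<And>n. 0 \<le> t n" "\<And>n. t n \<le> 1 / real (Suc n)"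
    and big: "\<And>n. norm (T (t n) (f n)) > real n * norm (f n)"
    by metis
  have t0: "t \<longlonglongrightarrow> 0"
    by (rule tendsto_sandwich[OF _ _ tendsto_const LIMSEQ_inverse_real_of_nat])
       (use t in \<open>auto simp: divide_inverse\<close>)
  have "(\<lambda>n. T (t n) g) \<longlonglongrightarrow> g" for g
  proof -
    have "continuous (at 0 within {0..}) (\<lambda>t. T t g)"
      using tendsto_at_0[of g] unfolding continuous_within at_within_Ici_at_right by simp
    then show ?thesis
      using t t0 by (auto simp: continuous_within_sequentially comp_def)
  qed
  then have "Bseq (\<lambda>n. T (t n) g)" for g by (intro convergent_imp_Bseq convergentI)
  then have "\<exists>K. \<forall>n\<in>UNIV. norm (T (t n) g) \<le> K" for g by (meson BseqD)
  then obtain K where K: "\<And>n f. norm (T (t n) f) \<le> K * norm f"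
    using uniform_boundedness[of UNIV "\<lambda>n. T (t n)", OF lin[OF t(1)]] by (metis UNIV_I)
  obtain n :: nat where n: "K \<le> real n" using real_arch_simple by blast
  have "real n * norm (f n) < K * norm (f n)" using big K by (rule less_le_trans)
  also have "\<dots> \<le> real n * norm (f n)" using n by (intro mult_right_mono) auto
  finally show False by simp
qed

text \<open>A time \<open>t\<close> takes at most \<open>t / \<delta> + 1\<close> steps of length
  \<open>\<delta>\<close>, each costing a factor \<open>M\<close>. Rounding up accounts for the
  prefactor, and \<open>w = ln M / \<delta>\<close>.\<close>

lemma exponential_growth:
  obtains M w where "M \<ge> 1" "w \<ge> 0" "\<And>t f. 0 \<le> t \<Longrightarrow> norm (T t f) \<le> M * exp (w * t) * norm f"
proof -
  obtain \<delta> M' where \<delta>: "\<delta> > 0" "\<And>t f. 0 \<le> t \<Longrightarrow> t \<le> \<delta> \<Longrightarrow> norm (T t f) \<le> M' * norm f"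
    using locally_bounded by blast
  define M where "M = max M' 1"
  have M1: "M \<ge> 1" by (simp add: M_def)
  have M: "norm (T t f) \<le> M * norm f" if "0 \<le> t" "t \<le> \<delta>" for t f
    using \<delta>(2)[OF that, of f] mult_right_mono[of M' M "norm f"] by (auto simp: M_def)
  have P: "norm (T t f) \<le> M ^ n * norm f" if "0 \<le> t" "t \<le> real n * \<delta>" for n t f
    using that
  proof (induction n arbitrary: t)
    case (Suc n)
    show ?case
    proof (cases "t \<le> \<delta>")
      case True
      have "norm (T t f) \<le> M * norm f" using Suc True by (intro M)
      also have "\<dots> \<le> M ^ Suc n * norm f"
        using M1 self_le_power[of M "Suc n"] by (intro mult_right_mono) auto
      finally show ?thesis .
    next
      case False
      have "T t f = T \<delta> (T (t - \<delta>) f)" using T_plus[of \<delta> "t - \<delta>" f] False \<delta> by simp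
      also have "norm \<dots> \<le> M * norm (T (t - \<delta>) f)" using \<delta> by (intro M) auto
      also have "\<dots> \<le> M * (M ^ n * norm f)"
        using M1 Suc.prems False by (intro mult_left_mono Suc.IH) (auto simp: algebra_simps)
      finally show ?thesis by simp
    qed
  qed simp
  define w where "w = ln M / \<delta>"
  have "norm (T t f) \<le> M * exp (w * t) * norm f" if t: "0 \<le> t" for t f
  proof -
    define n where "n = nat \<lceil>t / \<delta>\<rceil>"
    have n: "t / \<delta> \<le> n" "n \<le> t / \<delta> + 1" using t \<delta> by (auto simp: n_def)
    have "norm (T t f) \<le> M ^ n * norm f" using t n \<delta> by (intro P) (auto simp: field_simps)
    also have "M ^ n = exp (real n * ln M)" using M1 by (simp add: exp_of_nat_mult)
    also have "\<dots> \<le> exp ((t / \<delta> + 1) * ln M)" using n M1 by (simp add: mult_right_mono)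
    also have "\<dots> = M * exp (w * t)" using M1 by (simp add: w_def distrib_right exp_add)
    finally show ?thesis by (simp add: mult_right_mono)
  qed
  then show thesis using that[of M w] M1 \<delta> by (auto simp: w_def)
qed

lemma bounded_on_interval:
  obtains K where "K \<ge> 1" "\<And>t f. 0 \<le> t \<Longrightarrow> t \<le> b \<Longrightarrow> norm (T t f) \<le> K * norm f"
proof -
  obtain M w where M: "M \<ge> 1" "w \<ge> 0" "\<And>t f. 0 \<le> t \<Longrightarrow> norm (T t f) \<le> M * exp (w * t) * norm f"
    using exponential_growth by metis
  have "norm (T t f) \<le> M * exp (w * \<bar>b\<bar>) * norm f" if "0 \<le> t" "t \<le> b" for t f
  proof -
    have "norm (T t f) \<le> M * exp (w * t) * norm f" by (rule M) (fact that)
    also have "\<dots> \<le> M * exp (w * \<bar>b\<bar>) * norm f"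
      using that M by (intro mult_right_mono mult_left_mono) (auto intro!: mult_left_mono)
    finally show ?thesis .
  qed
  moreover have "1 * 1 \<le> M * exp (w * \<bar>b\<bar>)" using M by (intro mult_mono) auto
  ultimately show thesis using that by auto
qed

text \<open>Pulling out the operator at the earlier time reduces continuity anywhere to continuity
  at 0, with a modulus that is uniform as long as the operators are bounded by
  \<open>K\<close>.\<close>

lemma norm_T_diff_le:
  assumes K: "\<And>t f. 0 \<le> t \<Longrightarrow> t \<le> b \<Longrightarrow> norm (T t f) \<le> K * norm f"
    and st: "0 \<le> s" "s \<le> b" "0 \<le> t" "t \<le> b"
  shows "norm (T s f - T t f) \<le> K * norm (T \<bar>s - t\<bar> f - f)"
  using st
proof (induction s t rule: linorder_wlog)
  case (le s t)
  have "T t f - T s f = T s (T (t - s) f - f)"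
    using le T_plus[of s "t - s" f] by (simp add: T_diff)
  then show ?case using K[of s "T (t - s) f - f"] le by (simp add: norm_minus_commute[of "T s f"])
qed (simp add: abs_minus_commute norm_minus_commute)

lemma continuous_on_T: "continuous_on {0..} (\<lambda>t. T t f)"
  unfolding continuous_on_def
proof
  fix t :: real assume t: "t \<in> {0..}"
  obtain K where K: "K \<ge> 1" "\<And>s f. 0 \<le> s \<Longrightarrow> s \<le> t + 1 \<Longrightarrow> norm (T s f) \<le> K * norm f"
    using bounded_on_interval[of "t + 1"] by metis
  have "eventually (\<lambda>s. \<bar>s - t\<bar> < 1) (at t within {0..})"
    by (auto simp: eventually_at dist_real_def intro!: exI[of _ 1])
  then have ev: "eventually (\<lambda>s. norm (T s f - T t f) \<le> K * norm (T \<bar>s - t\<bar> f - f)) (at t within {0..})"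
  proof (rule eventually_elim2)
    show "eventually (\<lambda>s. s \<in> {0..}) (at t within {0..})" by (simp add: eventually_at_topological) auto
    fix s assume "\<bar>s - t\<bar> < 1" "s \<in> {0..}"
    then show "norm (T s f - T t f) \<le> K * norm (T \<bar>s - t\<bar> f - f)"
      using t by (intro norm_T_diff_le[of "t + 1"] K(2)) auto
  qed
  have "filterlim (\<lambda>s. \<bar>s - t\<bar>) (at_right 0) (at t within {0..})"
    unfolding filterlim_at
    by (auto simp: eventually_at_filter intro!: tendsto_eq_intros)
  then have "((\<lambda>s. K * norm (T \<bar>s - t\<bar> f - f)) \<longlongrightarrow> K * norm (f - f)) (at t within {0..})"
    by (intro tendsto_intros filterlim_compose[OF tendsto_at_0])
  then have "((\<lambda>s. T s f - T t f) \<longlongrightarrow> 0) (at t within {0..})"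
    by (intro Lim_null_comparison[OF ev]) simp
  then show "((\<lambda>t. T t f) \<longlongrightarrow> T t f) (at t within {0..})" by (rule LIM_zero_cancel)
qed

lemma continuous_on_T' [continuous_intros]:
  "continuous_on A h \<Longrightarrow> (\<And>x. x \<in> A \<Longrightarrow> 0 \<le> h x) \<Longrightarrow> continuous_on A (\<lambda>x. T (h x) f)"
  by (rule continuous_on_compose2[OF continuous_on_T]) auto

lemma integrable_T: "0 \<le> a \<Longrightarrow> (\<lambda>t. T t f) integrable_on {a..b}"
  by (intro integrable_continuous_interval continuous_intros) auto

end

lemma c0_semigroup_rescale:
  assumes "c0_semigroup T"
  shows "c0_semigroup (rescale z T)"
proof -
  interpret c0_semigroup T by fact
  show ?thesis
  proof (rule c0_semigroup.intro)
    show "bounded_linear (rescale z T t)" if "0 \<le> t" for t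
      using bounded_linear_compose[OF cscale.bounded_linear_right lin[OF that]]
      by (simp add: rescale_def)
    show "rescale z T t (cscale c f) = cscale c (rescale z T t f)" if "0 \<le> t" for t c f
      using that by (simp add: rescale_def T_cscale mult.commute)
    show "rescale z T 0 f = f" for f by (simp add: rescale_def)
    show "rescale z T (s + t) f = rescale z T s (rescale z T t f)" if "0 \<le> s" "0 \<le> t" for s t f
      using that by (simp add: rescale_def T_cscale T_plus mult_exp_exp algebra_simps)
    have "((\<lambda>t. rescale z T t f) \<longlongrightarrow> cscale (exp (- (z * of_real 0))) f) (at_right 0)" for f
      unfolding rescale_def by (intro cscale.tendsto tendsto_intros tendsto_at_0)
    then show "((\<lambda>t. rescale z T t f) \<longlongrightarrow> f) (at_right 0)" for f by simp
  qed
qed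

lemma rescale_rescale: "rescale z (rescale w T) = rescale (z + w) T"
  by (simp add: rescale_def fun_eq_iff mult_exp_exp algebra_simps)

lemma rescale_0 [simp]: "rescale 0 T = T"
  by (simp add: rescale_def)

context c0_semigroup
begin

text \<open>This is the product rule: the increment of the rescaled orbit splits into the
  exponential times the increment of the orbit, and the increment of the exponential times
  \<open>f\<close>.\<close>

lemma gen_rel_resc_imp:
  assumes "gen_rel T f g" shows "gen_rel (rescale z T) f (g - cscale z f)"
proof -
  have "((\<lambda>h. cscale (exp (- (z * of_real h))) (inverse h *\<^sub>R (T h f - f))
          + cscale ((exp ((- z) * of_real h) - 1) / of_real h) f) \<longlongrightarrow>
        cscale (exp (- (z * of_real 0))) g + cscale (- z) f) (at_right 0)"
    by (intro tendsto_add cscale.tendsto tendsto_const exp_minus_one_div_tendsto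
        assms[unfolded gen_rel_def] tendsto_intros)
  also have "cscale (exp (- (z * of_real 0))) g + cscale (- z) f = g - cscale z f"
    by (simp add: cscale.minus_left)
  finally show ?thesis
    unfolding gen_rel_def
  proof (rule Lim_transform_eventually)
    show "eventually (\<lambda>h. cscale (exp (- (z * of_real h))) (inverse h *\<^sub>R (T h f - f))
          + cscale ((exp ((- z) * of_real h) - 1) / of_real h) f =
        inverse h *\<^sub>R (rescale z T h f - f)) (at_right 0)"
    proof (intro eventually_at_right_less[THEN eventually_mono])
      fix h :: real
      have *: "cscale ((exp ((- z) * of_real h) - 1) / of_real h) f
        = inverse h *\<^sub>R (cscale (exp (- (z * of_real h))) f - f)"
        by (simp add: divide_inverse cscale.diff_left cscale.diff_right algebra_simps flip: cscale_of_real)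
      show "cscale (exp (- (z * of_real h))) (inverse h *\<^sub>R (T h f - f))
          + cscale ((exp ((- z) * of_real h) - 1) / of_real h) f =
        inverse h *\<^sub>R (rescale z T h f - f)"
        unfolding * by (simp add: rescale_def cscale.diff_right scaleR_diff_right)
    qed
  qed
qed

end

lemma gen_rel_rescale:
  assumes "c0_semigroup T"
  shows "gen_rel (rescale z T) f g \<longleftrightarrow> gen_rel T f (g + cscale z f)"
proof
  assume "gen_rel (rescale z T) f g"
  from c0_semigroup.gen_rel_resc_imp[OF c0_semigroup_rescale[OF assms] this, of "- z"]
  show "gen_rel T f (g + cscale z f)" by (simp add: rescale_rescale cscale.minus_left)
next
  assume "gen_rel T f (g + cscale z f)"
  from c0_semigroup.gen_rel_resc_imp[OF assms this, of z] show "gen_rel (rescale z T) f g" by simp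
qed

lemma res_op_rescale:
  assumes "c0_semigroup T"
  shows "res_op (rescale z T) w B \<longleftrightarrow> res_op T (w + z) B"
proof -
  have "cscale w f - (g - cscale z f) = cscale (w + z) f - g" for f g :: "'a cplx"
    by (simp add: cscale.add_left)
  then have "(\<forall>f g. gen_rel T f (g + cscale z f) \<longrightarrow> B (cscale w f - g) = f) \<longleftrightarrow>
      (\<forall>f g. gen_rel T f g \<longrightarrow> B (cscale (w + z) f - g) = f)"
    by (metis add_diff_cancel diff_add_cancel)
  moreover have "cscale w f - g + cscale z f = cscale (w + z) f - g" for f g :: "'a cplx"
    by (simp add: cscale.add_left)
  ultimately show ?thesis
    unfolding res_op_def gen_rel_rescale[OF assms] by (simp only:)
qed

lemma rho_rescale: "c0_semigroup T \<Longrightarrow> w \<in> rho (rescale z T) \<longleftrightarrow> w + z \<in> rho T"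
  by (simp add: rho_def res_op_rescale)

lemma Res_rescale: "c0_semigroup T \<Longrightarrow> Res (rescale z T) w = Res T (w + z)"
  by (simp add: Res_def res_op_rescale)

subsection \<open>Generator and resolvent\<close>

context c0_semigroup
begin

lemma gen_rel_add: "gen_rel T f g \<Longrightarrow> gen_rel T f' g' \<Longrightarrow> gen_rel T (f + f') (g + g')"
  unfolding gen_rel_def
  by (rule Lim_transform_eventually[OF tendsto_add], assumption+,
      rule eventually_mono[OF eventually_at_right_less])
     (simp add: T_add scaleR_add_right scaleR_diff_right)

text \<open>What commutes with the semigroup commutes with its generator. This is used with scalars,
  with \<open>L N\<close>, and through \<open>Res_map\<close> with \<open>T t\<close> and with
  residues.\<close>

lemma gen_rel_map:
  assumes "bounded_linear P" and comm: "\<And>t f. 0 \<le> t \<Longrightarrow> P (T t f) = T t (P f)" and "gen_rel T f g"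
  shows "gen_rel T (P f) (P g)"
proof -
  interpret P: bounded_linear P by fact
  have "((\<lambda>h. P (inverse h *\<^sub>R (T h f - f))) \<longlongrightarrow> P g) (at_right 0)"
    using assms(3) unfolding gen_rel_def by (rule P.tendsto)
  then show ?thesis
    unfolding gen_rel_def
    by (rule Lim_transform_eventually)
       (auto intro!: eventually_mono[OF eventually_at_right_less] simp: P.scaleR P.diff comm)
qed

lemma gen_rel_cscale: "gen_rel T f g \<Longrightarrow> gen_rel T (cscale c f) (cscale c g)"
  by (rule gen_rel_map[of "cscale c"]) (auto simp: cscale.bounded_linear_right T_cscale)

lemma gen_rel_scaleR: "gen_rel T f g \<Longrightarrow> gen_rel T (r *\<^sub>R f) (r *\<^sub>R g)"
  using gen_rel_cscale[of f g "of_real r"] by simp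

lemma gen_rel_minus: "gen_rel T f g \<Longrightarrow> gen_rel T (- f) (- g)"
  using gen_rel_cscale[of f g "- 1"] by (simp add: cscale.minus_left)

lemma gen_rel_diff: "gen_rel T f g \<Longrightarrow> gen_rel T f' g' \<Longrightarrow> gen_rel T (f - f') (g - g')"
  using gen_rel_add[of f g "- f'" "- g'"] gen_rel_minus[of f' g'] by simp

lemma gen_rel_zero: "gen_rel T 0 0"
  unfolding gen_rel_def
  by (rule Lim_transform_eventually[OF tendsto_const])
     (auto intro!: eventually_mono[OF eventually_at_right_less] simp: T_zero)

lemma gen_rel_unique: "gen_rel T f g \<Longrightarrow> gen_rel T f g' \<Longrightarrow> g = g'"
  unfolding gen_rel_def by (rule tendsto_unique[OF trivial_limit_at_right_real])

text \<open>The Laplace integral at 0, cut off at \<open>N\<close>. For a rescaled semigroup it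
  becomes the truncated Laplace transform \<open>lap z N\<close>.\<close>

definition L :: "real \<Rightarrow> 'r cplx \<Rightarrow> 'r cplx" where
  "L N f = integral {0..N} (\<lambda>t. T t f)"

lemma L_bounded_linear: "bounded_linear (L N)"
proof -
  obtain K where K: "K \<ge> 1" "\<And>t f. 0 \<le> t \<Longrightarrow> t \<le> N \<Longrightarrow> norm (T t f) \<le> K * norm f"
    using bounded_on_interval[of N] by metis
  show ?thesis
  proof (rule bounded_linear_intro[of _ "K * \<bar>N\<bar>"])
    show "L N (f + g) = L N f + L N g" for f g
      unfolding L_def by (subst integral_add[symmetric]) (auto intro!: integrable_T integral_cong simp: T_add)
    show "L N (c *\<^sub>R f) = c *\<^sub>R L N f" for c f
      unfolding L_def integral_cmul[symmetric] by (rule integral_cong) (simp add: T_scaleR)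
    show "norm (L N f) \<le> norm f * (K * \<bar>N\<bar>)" for f
    proof (cases "N \<ge> 0")
      case True
      have "norm (integral {0..N} (\<lambda>t. T t f)) \<le> K * norm f * (N - 0)"
        using True K by (intro integral_bound continuous_intros) auto
      then show ?thesis using True by (simp add: L_def mult_ac)
    next
      case False
      then have "L N f = 0" by (simp add: L_def)
      then show ?thesis using K by simp
    qed
  qed
qed

lemma L_map:
  assumes "bounded_linear P" and comm: "\<And>t f. 0 \<le> t \<Longrightarrow> P (T t f) = T t (P f)"
  shows "P (L N f) = L N (P f)"
proof -
  have "P (L N f) = integral {0..N} (P \<circ> (\<lambda>t. T t f))"
    unfolding L_def by (rule integral_linear[symmetric, OF integrable_T assms(1)]) simp
  also have "\<dots> = L N (P f)" unfolding L_def by (rule integral_cong) (simp add: comm)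
  finally show ?thesis .
qed

lemma T_L_commute: "0 \<le> t \<Longrightarrow> T t (L N f) = L N (T t f)"
  by (rule L_map) (auto intro: lin T_commute)

lemma T_L: 
  assumes "0 \<le> s" "0 \<le> t"
  shows "T s (L t f) = L (s + t) f - L s f"
proof -
  have "T s (L t f) = L t (T s f)" using assms by (intro T_L_commute)
  also have "\<dots> = integral {0..t} (\<lambda>r. T (r + s) f)"
    unfolding L_def using assms by (intro integral_cong) (simp add: T_plus)
  also have "\<dots> = integral {s..t + s} (\<lambda>r. T r f)"
    using integral_shift_real_ivl[of s s "t + s" "\<lambda>r. T r f"] by simp
  also have "\<dots> = L (s + t) f - L s f"
  proof -
    have "integral {0..s} (\<lambda>r. T r f) + integral {s..s + t} (\<lambda>r. T r f) = integral {0..s + t} (\<lambda>r. T r f)"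
      using assms by (intro Henstock_Kurzweil_Integration.integral_combine integrable_T) auto
    then show ?thesis unfolding L_def by (metis add.commute add_diff_cancel_left')
  qed
  finally show ?thesis .
qed

lemma L_0 [simp]: "L 0 f = 0" by (simp add: L_def)

lemma L_div_tendsto: "((\<lambda>h. inverse h *\<^sub>R L h f) \<longlongrightarrow> f) (at_right 0)"
proof -
  have "((\<lambda>u. L u f) has_vector_derivative T 0 f) (at 0 within {0..1})"
    unfolding L_def by (rule integral_has_vector_derivative) (auto intro!: continuous_intros)
  then have "((\<lambda>h. (1 / norm (h - 0)) *\<^sub>R (L h f - (L 0 f + (h - 0) *\<^sub>R f))) \<longlongrightarrow> 0) (at_right 0)"
    by (simp add: has_vector_derivative_def has_derivative_within at_within_Icc_at_right)
  then have "((\<lambda>h. inverse h *\<^sub>R L h f - f) \<longlongrightarrow> 0) (at_right 0)"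
    by (rule Lim_transform_eventually)
       (auto intro!: eventually_mono[OF eventually_at_right_less] simp: divide_inverse scaleR_diff_right)
  then show ?thesis by (rule LIM_zero_cancel)
qed

lemma gen_rel_L: 
  assumes "0 \<le> N" shows "gen_rel T (L N f) (T N f - f)"
proof -
  have "((\<lambda>h. T N (inverse h *\<^sub>R L h f) - inverse h *\<^sub>R L h f) \<longlongrightarrow> T N f - f) (at_right 0)"
    by (intro tendsto_diff bounded_linear.tendsto[OF lin[OF assms]] L_div_tendsto)
  then show ?thesis
    unfolding gen_rel_def
  proof (rule Lim_transform_eventually)
    \<comment> \<open>Both sides are \<open>L (h + N) f - L h f - L N f\<close> divided by
      \<open>h\<close>: the increment of \<open>L N f\<close> over time \<open>h\<close> equals that
      of \<open>L h f\<close> over time \<open>N\<close>.\<close>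
    show "eventually (\<lambda>h. T N (inverse h *\<^sub>R L h f) - inverse h *\<^sub>R L h f =
        inverse h *\<^sub>R (T h (L N f) - L N f)) (at_right 0)"
    proof (rule eventually_mono[OF eventually_at_right_less])
      fix h :: real assume "0 < h"
      then show "T N (inverse h *\<^sub>R L h f) - inverse h *\<^sub>R L h f = inverse h *\<^sub>R (T h (L N f) - L N f)"
        using assms T_L[of h N f] T_L[of N h f]
        by (simp add: T_scaleR scaleR_diff_right add.commute)
    qed
  qed
qed

text \<open>The generator has two values at \<open>L N f\<close>: \<open>T N f - f\<close> by
  integration of the orbit, and \<open>L N g\<close> because \<open>L N\<close> commutes with the
  semigroup. They agree by uniqueness.\<close>

lemma L_gen_rel:
  assumes "gen_rel T f g" "0 \<le> N" shows "L N g = T N f - f"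
proof (rule gen_rel_unique)
  show "gen_rel T (L N f) (T N f - f)" by (rule gen_rel_L) fact
  show "gen_rel T (L N f) (L N g)"
    by (rule gen_rel_map[OF L_bounded_linear _ assms(1)]) (simp add: T_L_commute)
qed

text \<open>The integrated form replaces the limit at time 0 by equations between bounded operators.
  These survive limits in \<open>f\<close> and \<open>g\<close>, which is how the generator is shown
  to be closed.\<close>

lemma gen_rel_iff_L: "gen_rel T f g \<longleftrightarrow> (\<forall>N\<ge>0. L N g = T N f - f)"
proof
  assume *: "\<forall>N\<ge>0. L N g = T N f - f"
  have "eventually (\<lambda>h. inverse h *\<^sub>R L h g = inverse h *\<^sub>R (T h f - f)) (at_right (0::real))"
    using * by (intro eventually_mono[OF eventually_at_right_less]) simp
  then show "gen_rel T f g"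
    unfolding gen_rel_def by (rule Lim_transform_eventually[OF L_div_tendsto[of g]])
next
  assume "gen_rel T f g"
  then show "\<forall>N\<ge>0. L N g = T N f - f" using L_gen_rel by blast
qed

lemma gen_rel_closed:
  assumes "(X \<longlongrightarrow> f) F" "(Y \<longlongrightarrow> g) F" "eventually (\<lambda>n. gen_rel T (X n) (Y n)) F" "F \<noteq> bot"
  shows "gen_rel T f g"
  unfolding gen_rel_iff_L
proof (intro allI impI)
  fix N :: real assume N: "0 \<le> N"
  have "((\<lambda>n. L N (Y n)) \<longlongrightarrow> L N g) F"
    by (intro bounded_linear.tendsto[OF L_bounded_linear] assms)
  moreover have "((\<lambda>n. T N (X n) - X n) \<longlongrightarrow> T N f - f) F"
    using N by (intro tendsto_diff bounded_linear.tendsto[OF lin] assms)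
  then have "((\<lambda>n. L N (Y n)) \<longlongrightarrow> T N f - f) F"
    by (rule Lim_transform_eventually) (use assms(3) N in \<open>auto elim: eventually_mono simp: L_gen_rel\<close>)
  ultimately show "L N g = T N f - f" using assms(4) tendsto_unique by blast
qed

lemma gen_rel_0_iff: "gen_rel T f 0 \<longleftrightarrow> (\<forall>t\<ge>0. T t f = f)"
  unfolding gen_rel_iff_L by (auto simp: linear_0[OF bounded_linear.linear[OF L_bounded_linear]])

lemma res_op_unique: "res_op T z B \<Longrightarrow> res_op T z B' \<Longrightarrow> B = B'"
  unfolding res_op_def by (metis diff_diff_eq2 add_diff_cancel_left' ext)

lemma res_op_Res: "z \<in> rho T \<Longrightarrow> res_op T z (Res T z)"
  using someI_ex[of "res_op T z"] by (simp add: rho_def Res_def)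

lemma Res_eqI: "res_op T z B \<Longrightarrow> Res T z = B"
  by (metis res_op_unique res_op_Res rho_def mem_Collect_eq)

lemma Res_bounded_linear: "z \<in> rho T \<Longrightarrow> bounded_linear (Res T z)"
  using res_op_Res by (auto simp: res_op_def)

lemma gen_rel_Res: "z \<in> rho T \<Longrightarrow> gen_rel T (Res T z f) (cscale z (Res T z f) - f)"
  using res_op_Res by (auto simp: res_op_def)

lemma Res_gen_rel: "z \<in> rho T \<Longrightarrow> gen_rel T f g \<Longrightarrow> Res T z (cscale z f - g) = f"
  using res_op_Res by (auto simp: res_op_def)

lemma Res_map:
  assumes "z \<in> rho T" "bounded_linear P" "\<And>t f. 0 \<le> t \<Longrightarrow> P (T t f) = T t (P f)"
    "\<And>f. P (cscale z f) = cscale z (P f)"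
  shows "P (Res T z f) = Res T z (P f)"
proof -
  have "gen_rel T (P (Res T z f)) (P (cscale z (Res T z f) - f))"
    using assms(3) by (rule gen_rel_map[OF assms(2) _ gen_rel_Res[OF assms(1)]])
  from Res_gen_rel[OF assms(1) this] show ?thesis
    by (simp add: assms(4) linear_diff[OF bounded_linear.linear[OF assms(2)]])
qed

lemma Res_T: "z \<in> rho T \<Longrightarrow> 0 \<le> t \<Longrightarrow> T t (Res T z f) = Res T z (T t f)"
  by (rule Res_map) (auto intro: lin T_commute T_cscale)

lemma Res_cscale: "z \<in> rho T \<Longrightarrow> Res T z (cscale c f) = cscale c (Res T z f)"
  by (rule Res_map[symmetric]) (auto simp: cscale.bounded_linear_right T_cscale mult.commute)

lemma Res_add: "z \<in> rho T \<Longrightarrow> Res T z (f + g) = Res T z f + Res T z g"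
  and Res_diff: "z \<in> rho T \<Longrightarrow> Res T z (f - g) = Res T z f - Res T z g"
  and Res_scaleR: "z \<in> rho T \<Longrightarrow> Res T z (r *\<^sub>R f) = r *\<^sub>R Res T z f"
  and Res_zero: "z \<in> rho T \<Longrightarrow> Res T z 0 = 0"
  using Res_bounded_linear[of z, THEN bounded_linear.linear]
  by (auto simp: linear_add linear_diff linear_cmul linear_0)

lemma resolvent_identity:
  assumes "z \<in> rho T" "w \<in> rho T"
  shows "Res T z f - Res T w f = cscale (w - z) (Res T z (Res T w f))"
proof -
  have "cscale z (Res T w f) - (cscale w (Res T w f) - f) = f - cscale (w - z) (Res T w f)"
    by (simp add: cscale.diff_left)
  with Res_gen_rel[OF assms(1) gen_rel_Res[OF assms(2), of f]]
  have "Res T z (f - cscale (w - z) (Res T w f)) = Res T w f" by (simp only:)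
  then show ?thesis using assms(1) by (simp add: Res_diff Res_cscale algebra_simps)
qed

text \<open>To invert \<open>z - A\<close> it suffices to solve with a norm bound and to know that
  the kernel is trivial; linearity of the solution map comes from uniqueness.\<close>

lemma res_op_exI:
  assumes ex: "\<And>f. \<exists>h. gen_rel T h (cscale z h - f) \<and> norm h \<le> K * norm f"
    and inj: "\<And>h. gen_rel T h (cscale z h) \<Longrightarrow> h = 0"
  shows "z \<in> rho T" "norm (Res T z f) \<le> K * norm f"
proof -
  obtain B where B: "\<And>f. gen_rel T (B f) (cscale z (B f) - f)" "\<And>f. norm (B f) \<le> K * norm f"
    using ex by metis
  have uniq: "h = B f" if "gen_rel T h (cscale z h - f)" for h f
  proof -
    have "gen_rel T (h - B f) (cscale z (h - B f))"
      using gen_rel_diff[OF that B(1)[of f]] by (simp add: cscale.diff_right)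
    from inj[OF this] show ?thesis by simp
  qed
  have "bounded_linear B"
  proof (rule bounded_linear_intro)
    show "B (f + g) = B f + B g" for f g
      using gen_rel_add[OF B(1)[of f] B(1)[of g]]
      by (intro uniq[symmetric]) (simp add: cscale.add_right algebra_simps)
    show "B (r *\<^sub>R f) = r *\<^sub>R B f" for r f
      using gen_rel_scaleR[OF B(1)[of f], of r]
      by (intro uniq[symmetric]) (simp add: scaleR_diff_right)
    show "norm (B f) \<le> norm f * K" for f using B(2)[of f] by (simp add: mult.commute)
  qed
  moreover have "B (cscale z f - g) = f" if "gen_rel T f g" for f g
    using that by (intro uniq[symmetric]) simp
  ultimately have "res_op T z B" using B by (auto simp: res_op_def)
  then show "z \<in> rho T" "norm (Res T z f) \<le> K * norm f"
    using B by (auto simp: Res_eqI rho_def)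
qed

lemma Res_neighbour_fix:
  assumes "z \<in> rho T" "w \<in> rho T"
  shows "Res T w f = Res T z (f + cscale (z - w) (Res T w f))"
proof -
  have "cscale (z - w) x = - cscale (w - z) x" for x :: "'r cplx"
    by (simp flip: cscale.minus_left)
  then show ?thesis
    using resolvent_identity[OF assms, of f] assms(1)
    by (simp add: Res_diff Res_cscale algebra_simps)
qed

text \<open>The Neumann series in the form of a contraction: \<open>h\<close> solves the equation at
  \<open>w\<close> as the fixed point of an affine map built from \<open>Res T z\<close>. The 4
  absorbs the factor 2 of \<open>norm_cscale_le\<close> and leaves the contraction constant 1/2,
  hence the bound \<open>2 * K\<close>.\<close>

lemma rho_neighbour:
  assumes z: "z \<in> rho T" and K: "\<And>f. norm (Res T z f) \<le> K * norm f" and w: "4 * K * cmod (w - z) \<le> 1"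
  shows "w \<in> rho T" "norm (Res T w f) \<le> 2 * K * norm f"
proof -
  have lip: "norm (Res T z (cscale (z - w) h)) \<le> (1/2) * norm h" for h
  proof (cases "K \<ge> 0")
    case True
    have "norm (Res T z (cscale (z - w) h)) \<le> K * norm (cscale (z - w) h)" by (rule K)
    also have "\<dots> \<le> K * (2 * cmod (z - w) * norm h)"
      using True by (intro mult_left_mono norm_cscale_le)
    also have "\<dots> = (2 * K * cmod (w - z)) * norm h" by (simp add: norm_minus_commute)
    also have "\<dots> \<le> (1/2) * norm h" using w by (intro mult_right_mono) auto
    finally show ?thesis .
  next
    case False
    then have "K * norm (cscale (z - w) h) \<le> 0" by (simp add: mult_nonpos_nonneg)
    with K[of "cscale (z - w) h"] have "norm (Res T z (cscale (z - w) h)) \<le> 0" by linarith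
    then show ?thesis using norm_ge_zero[of h] by linarith
  qed
  have ex: "\<exists>h. gen_rel T h (cscale w h - f) \<and> norm h \<le> 2 * K * norm f" for f
  proof -
    have "\<exists>!h. Res T z (f + cscale (z - w) h) = h"
    proof (rule banach_fix_type)
      show "\<forall>x y. dist (Res T z (f + cscale (z - w) x)) (Res T z (f + cscale (z - w) y)) \<le> (1/2) * dist x y"
        using lip z by (simp add: dist_norm flip: Res_diff cscale.diff_right)
    qed auto
    then obtain h where h: "Res T z (f + cscale (z - w) h) = h" by blast
    have "gen_rel T h (cscale z h - (f + cscale (z - w) h))"
      using gen_rel_Res[OF z, of "f + cscale (z - w) h"] h by simp
    then have "gen_rel T h (cscale w h - f)" by (simp add: cscale.diff_left)
    moreover have "norm h \<le> K * norm f + (1/2) * norm h"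
    proof -
      have "h = Res T z f + Res T z (cscale (z - w) h)" using h z by (simp add: Res_add)
      then have "norm h \<le> norm (Res T z f) + norm (Res T z (cscale (z - w) h))"
        by (metis norm_triangle_ineq)
      also have "\<dots> \<le> K * norm f + (1/2) * norm h" by (intro add_mono K lip)
      finally show ?thesis .
    qed
    ultimately show ?thesis by auto
  qed
  have inj: "h = 0" if "gen_rel T h (cscale w h)" for h
  proof -
    have "h = Res T z (cscale (z - w) h)" using Res_gen_rel[OF z that] by (simp add: cscale.diff_left)
    with lip[of h] show ?thesis by simp
  qed
  show "w \<in> rho T" "norm (Res T w f) \<le> 2 * K * norm f"
    using res_op_exI[OF ex inj] by auto
qed

lemma rho_local:
  assumes "z \<in> rho T"
  obtains K d where "K > 0" "d > 0" "\<And>w. cmod (w - z) \<le> d \<Longrightarrow> w \<in> rho T"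
    "\<And>w f. cmod (w - z) \<le> d \<Longrightarrow> norm (Res T w f) \<le> K * norm f"
proof -
  obtain K where K: "K > 0" "\<And>f. norm (Res T z f) \<le> norm f * K"
    using bounded_linear.pos_bounded[OF Res_bounded_linear[OF assms]] by blast
  show thesis
  proof (rule that[of "2 * K" "1 / (4 * K)"])
    fix w f assume "cmod (w - z) \<le> 1 / (4 * K)"
    then have "4 * K * cmod (w - z) \<le> 1" using K by (simp add: field_simps)
    from rho_neighbour[OF assms _ this] K
    show "w \<in> rho T" "norm (Res T w f) \<le> 2 * K * norm f" by (auto simp: mult.commute)
  qed (use K in auto)
qed

lemma open_rho: "open (rho T)"
  unfolding open_contains_ball
proof
  fix z assume "z \<in> rho T"
  then obtain d where "d > 0" "\<And>w. cmod (w - z) \<le> d \<Longrightarrow> w \<in> rho T" using rho_local by metis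
  then show "\<exists>e>0. ball z e \<subseteq> rho T"
    by (intro exI[of _ d]) (auto simp: dist_norm norm_minus_commute)
qed

text \<open>Parameters with growing resolvents would accumulate at a point of \<open>S\<close>, near
  which resolvents are uniformly bounded.\<close>

lemma Res_bounded_on_compact:
  assumes "compact S" "S \<subseteq> rho T"
  obtains K where "K > 0" "\<And>z f. z \<in> S \<Longrightarrow> norm (Res T z f) \<le> K * norm f"
proof -
  have "\<exists>K. \<forall>z\<in>S. \<forall>f. norm (Res T z f) \<le> K * norm f"
  proof (rule ccontr)
    assume "\<nexists>K. \<forall>z\<in>S. \<forall>f. norm (Res T z f) \<le> K * norm f"
    then have "\<not> (\<forall>z\<in>S. \<forall>f. norm (Res T z f) \<le> real n * norm f)" for n by blast
    then have "\<exists>z f. z \<in> S \<and> norm (Res T z f) > real n * norm f" for n by (simp add: not_le) blast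
    then obtain z f where z: "\<And>n. z n \<in> S" and big: "\<And>n. norm (Res T (z n) (f n)) > real n * norm (f n)"
      by metis
    obtain z0 r where zr: "z0 \<in> S" "strict_mono r" "(z \<circ> r) \<longlonglongrightarrow> z0"
      by (rule seq_compactE[OF compact_imp_seq_compact[OF assms(1)], of z]) (use z in auto)
    obtain K d where K: "K > 0" "d > 0" "\<And>w f. cmod (w - z0) \<le> d \<Longrightarrow> norm (Res T w f) \<le> K * norm f"
      by (rule rho_local[OF subsetD[OF assms(2) zr(1)]]) blast
    have "eventually (\<lambda>n. dist ((z \<circ> r) n) z0 < d) sequentially"
      using zr(3) K(2) by (rule tendstoD)
    moreover have "eventually (\<lambda>n. real n \<ge> K) sequentially"
      using filterlim_real_sequentially unfolding filterlim_at_top by blast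
    ultimately have "eventually (\<lambda>n. dist ((z \<circ> r) n) z0 < d \<and> real n \<ge> K) sequentially"
      by (rule eventually_conj)
    then obtain n where n: "dist ((z \<circ> r) n) z0 < d" "real n \<ge> K"
      by (auto simp: eventually_sequentially)
    have "norm (Res T (z (r n)) (f (r n))) \<le> K * norm (f (r n))"
      using n by (intro K(3)) (simp add: dist_norm)
    also have "\<dots> \<le> real (r n) * norm (f (r n))"
      using n seq_suble[OF zr(2), of n] by (intro mult_right_mono) auto
    finally show False using big[of "r n"] by simp
  qed
  then obtain K where K: "\<forall>z\<in>S. \<forall>f. norm (Res T z f) \<le> K * norm f" by blast
  have "norm (Res T z f) \<le> max K 1 * norm f" if "z \<in> S" for z f
  proof -
    have "norm (Res T z f) \<le> K * norm f" using K that by blast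
    also have "\<dots> \<le> max K 1 * norm f" by (intro mult_right_mono) auto
    finally show ?thesis .
  qed
  then show thesis using that[of "max K 1"] by auto
qed

lemma continuous_Res:
  assumes h: "continuous_on S h" and g: "continuous_on S g" and S: "\<And>x. x \<in> S \<Longrightarrow> g x \<in> rho T"
  shows "continuous_on S (\<lambda>x. Res T (g x) (h x))"
  unfolding continuous_on_def
proof
  fix x assume x: "x \<in> S"
  obtain K d where K: "K > 0" "d > 0" "\<And>w. cmod (w - g x) \<le> d \<Longrightarrow> w \<in> rho T"
    "\<And>w f. cmod (w - g x) \<le> d \<Longrightarrow> norm (Res T w f) \<le> K * norm f"
    by (rule rho_local[OF S[OF x]]) blast
  have gx: "(g \<longlongrightarrow> g x) (at x within S)" and hx: "(h \<longlongrightarrow> h x) (at x within S)"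
    using g h x by (auto simp: continuous_on_def)
  have bd: "norm (Res T (g y) (h y) - Res T (g x) (h x)) \<le>
      K * norm (h y - h x) + 2 * cmod (g x - g y) * (K * norm (Res T (g x) (h x)))"
    if "dist (g y) (g x) < d" for y
  proof -
    have le: "cmod (g y - g x) \<le> d" using that by (simp add: dist_norm)
    have tri: "a - b = (a - c) + (c - b)" for a b c :: "'r cplx" by simp
    \<comment> \<open>First the vector varies with the parameter fixed at \<open>g y\<close>, where
      the local bound \<open>K\<close> holds; then the parameter varies by the resolvent
      identity.\<close>
    have "Res T (g y) (h y) - Res T (g x) (h x) =
        Res T (g y) (h y - h x) + cscale (g x - g y) (Res T (g y) (Res T (g x) (h x)))"
      unfolding resolvent_identity[OF K(3)[OF le] S[OF x], of "h x", symmetric]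
      unfolding Res_diff[OF K(3)[OF le]] by (rule tri)
    also have "norm \<dots> \<le> norm (Res T (g y) (h y - h x)) + norm (cscale (g x - g y) (Res T (g y) (Res T (g x) (h x))))"
      by (rule norm_triangle_ineq)
    also have "\<dots> \<le> K * norm (h y - h x) + 2 * cmod (g x - g y) * norm (Res T (g y) (Res T (g x) (h x)))"
      by (intro add_mono K(4) le norm_cscale_le)
    also have "\<dots> \<le> K * norm (h y - h x) + 2 * cmod (g x - g y) * (K * norm (Res T (g x) (h x)))"
      by (intro add_mono mult_left_mono K(4) le order_refl) auto
    finally show ?thesis .
  qed
  have "((\<lambda>y. K * norm (h y - h x) + 2 * cmod (g x - g y) * (K * norm (Res T (g x) (h x)))) \<longlongrightarrow>
      K * norm (h x - h x) + 2 * cmod (g x - g x) * (K * norm (Res T (g x) (h x)))) (at x within S)"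
    by (intro tendsto_intros gx hx)
  then have "((\<lambda>y. K * norm (h y - h x) + 2 * cmod (g x - g y) * (K * norm (Res T (g x) (h x)))) \<longlongrightarrow> 0)
      (at x within S)" by simp
  moreover have "eventually (\<lambda>y. norm (Res T (g y) (h y) - Res T (g x) (h x)) \<le>
      K * norm (h y - h x) + 2 * cmod (g x - g y) * (K * norm (Res T (g x) (h x)))) (at x within S)"
    using tendstoD[OF gx K(2)] by (rule eventually_mono) (rule bd)
  ultimately have "((\<lambda>y. Res T (g y) (h y) - Res T (g x) (h x)) \<longlongrightarrow> 0) (at x within S)"
    by (rule Lim_null_comparison[rotated])
  then show "((\<lambda>x. Res T (g x) (h x)) \<longlongrightarrow> Res T (g x) (h x)) (at x within S)"
    by (rule LIM_zero_cancel)
qed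

text \<open>Convergence of the truncated integrals, even if not absolute, already produces the
  resolvent at 0. Boundedness of the limit comes from the uniform boundedness principle along the
  integers, the range condition from shifting the integral.\<close>

lemma laplace_converges_0:
  assumes B: "\<And>f. ((\<lambda>N. L N f) \<longlongrightarrow> B f) at_top"
  shows "res_op T 0 B"
  unfolding res_op_def
proof (intro conjI allI impI)
  have bdd: "\<exists>K. \<forall>n\<in>UNIV. norm (L (real n) f) \<le> K" for f
  proof -
    have "(\<lambda>n. L (real n) f) \<longlonglongrightarrow> B f"
      by (rule filterlim_compose[OF B filterlim_real_sequentially])
    then have "Bseq (\<lambda>n. L (real n) f)" by (rule convergent_imp_Bseq[OF convergentI])
    then show ?thesis unfolding Bseq_def by blast
  qed
  obtain K where K: "K \<ge> 0" "\<And>n f. norm (L (real n) f) \<le> K * norm f"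
    by (rule uniform_boundedness[of UNIV "\<lambda>n. L (real n)", OF L_bounded_linear bdd]) auto
  show B_lin: "bounded_linear B"
  proof (rule bounded_linear_intro)
    note lin_L = bounded_linear.linear[OF L_bounded_linear]
    have "((\<lambda>N. L N (f + g)) \<longlongrightarrow> B f + B g) at_top" for f g
      unfolding linear_add[OF lin_L] by (intro tendsto_add B)
    then show "B (f + g) = B f + B g" for f g
      using tendsto_unique[OF trivial_limit_at_top_linorder B] by blast
    have "((\<lambda>N. L N (r *\<^sub>R f)) \<longlongrightarrow> r *\<^sub>R B f) at_top" for r f
      unfolding linear_cmul[OF lin_L] by (intro tendsto_scaleR tendsto_const B)
    then show "B (r *\<^sub>R f) = r *\<^sub>R B f" for r f
      using tendsto_unique[OF trivial_limit_at_top_linorder B] by blast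
    have "(\<lambda>n. norm (L (real n) f)) \<longlonglongrightarrow> norm (B f)" for f
      by (intro tendsto_norm filterlim_compose[OF B filterlim_real_sequentially])
    then have "norm (B f) \<le> K * norm f" for f
      by (rule LIMSEQ_le_const2) (use K in auto)
    then show "norm (B f) \<le> norm f * K" for f by (simp add: mult.commute)
  qed
  fix f
  have T_B: "T h (B f) - B f = - L h f" if h: "0 \<le> h" for h
  proof -
    have "((\<lambda>N. T h (L N f)) \<longlongrightarrow> T h (B f)) at_top"
      by (intro bounded_linear.tendsto[OF lin[OF h]] B)
    moreover have "((\<lambda>N. L (h + N) f - L h f) \<longlongrightarrow> B f - L h f) at_top"
      by (rule tendsto_diff[OF filterlim_compose[OF B filterlim_const_plus_at_top] tendsto_const])
    then have "((\<lambda>N. T h (L N f)) \<longlongrightarrow> B f - L h f) at_top"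
      by (rule Lim_transform_eventually)
         (use h in \<open>auto intro!: eventually_mono[OF eventually_ge_at_top[of 0]] simp: T_L\<close>)
    ultimately have "T h (B f) = B f - L h f"
      using tendsto_unique[OF trivial_limit_at_top_linorder] by blast
    then show ?thesis by simp
  qed
  have "gen_rel T (B f) (- f)"
    unfolding gen_rel_def
    by (rule Lim_transform_eventually[OF tendsto_minus[OF L_div_tendsto[of f]]])
       (auto intro!: eventually_mono[OF eventually_at_right_less] simp: T_B)
  then show "gen_rel T (B f) (cscale 0 (B f) - f)" by (simp add: cscale.zero_left)
  fix f g assume fg: "gen_rel T f g"
  have "((\<lambda>N. L N g + f) \<longlongrightarrow> B g + f) at_top" by (intro tendsto_intros B)
  then have *: "((\<lambda>N. T N f) \<longlongrightarrow> B g + f) at_top"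
    by (rule Lim_transform_eventually)
       (auto intro!: eventually_mono[OF eventually_ge_at_top[of 0]] simp: L_gen_rel[OF fg])
  \<comment> \<open>\<open>y\<close> is the limit of the orbit of \<open>f\<close>, hence fixed by
    the semigroup. Then \<open>L N y\<close> is \<open>N\<close> times \<open>y\<close>, which can
    converge only if \<open>y = 0\<close>; this is the left inverse law.\<close>
  define y where "y = B g + f"
  have y: "T h y = y" if h: "0 \<le> h" for h
  proof -
    have "((\<lambda>N. T h (T N f)) \<longlongrightarrow> T h y) at_top"
      unfolding y_def by (intro bounded_linear.tendsto[OF lin[OF h]] *)
    moreover have "((\<lambda>N. T (h + N) f) \<longlongrightarrow> y) at_top"
      unfolding y_def by (rule filterlim_compose[OF * filterlim_const_plus_at_top])
    then have "((\<lambda>N. T h (T N f)) \<longlongrightarrow> y) at_top"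
      by (rule Lim_transform_eventually)
         (use h in \<open>auto intro!: eventually_mono[OF eventually_ge_at_top[of 0]] simp: T_plus\<close>)
    ultimately show ?thesis using tendsto_unique[OF trivial_limit_at_top_linorder] by blast
  qed
  have Ly: "L N y = N *\<^sub>R y" if "0 \<le> N" for N
  proof -
    have "L N y = integral {0..N} (\<lambda>t. y)" unfolding L_def by (rule integral_cong) (simp add: y)
    then show ?thesis using that by simp
  qed
  have "((\<lambda>N. L (1 + N) y - L N y) \<longlongrightarrow> B y - B y) at_top"
    by (rule tendsto_diff[OF filterlim_compose[OF B filterlim_const_plus_at_top] B])
  moreover have "eventually (\<lambda>N. L (1 + N) y - L N y = y) (at_top :: real filter)"
    by (rule eventually_mono[OF eventually_ge_at_top[of 0]]) (simp add: Ly scaleR_left_distrib)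
  ultimately have "((\<lambda>N. y) \<longlongrightarrow> B y - B y) (at_top :: real filter)"
    by (rule Lim_transform_eventually)
  then have "y = B y - B y"
    by (rule tendsto_unique[OF trivial_limit_at_top_linorder tendsto_const])
  then have "y = 0" by simp
  then show "B (cscale 0 f - g) = f"
    using linear_neg[OF bounded_linear.linear[OF B_lin], of g]
    by (simp add: y_def cscale.zero_left add_eq_0_iff)
qed

end

text \<open>The tail bound \<open>g\<close> is kept for the limit: when \<open>F 0 = 0\<close>, as
  for \<open>L\<close>, its value at 0 bounds the limit itself.\<close>

lemma cauchy_at_top_real:
  fixes F :: "real \<Rightarrow> 'a::banach"
  assumes F: "\<And>N N'. 0 \<le> N \<Longrightarrow> N \<le> N' \<Longrightarrow> norm (F N' - F N) \<le> g N"
    and g: "(g \<longlongrightarrow> 0) at_top"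
  obtains l where "(F \<longlongrightarrow> l) at_top" "\<And>N. 0 \<le> N \<Longrightarrow> norm (F N - l) \<le> g N"
proof -
  have "Cauchy (\<lambda>n. F (real n))"
  proof (rule CauchyI)
    fix e :: real assume e: "e > 0"
    have "(\<lambda>n. g (real n)) \<longlonglongrightarrow> 0" by (rule filterlim_compose[OF g filterlim_real_sequentially])
    then have "eventually (\<lambda>n. g (real n) < e) sequentially" using e by (rule order_tendstoD)
    then obtain M where M: "\<And>n. n \<ge> M \<Longrightarrow> g (real n) < e" by (auto simp: eventually_sequentially)
    have "norm (F (real m) - F (real n)) < e" if "m \<ge> M" "n \<ge> M" for m n
      using F[of "real (min m n)" "real (max m n)"] M[of "min m n"] that
      by (cases "m \<le> n") (auto simp: norm_minus_commute min_def max_def)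
    then show "\<exists>M. \<forall>m\<ge>M. \<forall>n\<ge>M. norm (F (real m) - F (real n)) < e" by blast
  qed
  then obtain l where l: "(\<lambda>n. F (real n)) \<longlonglongrightarrow> l" using Cauchy_convergent_iff convergent_def by blast
  have le: "norm (F N - l) \<le> g N" if "0 \<le> N" for N
  proof (rule LIMSEQ_le_const2)
    show "(\<lambda>n. norm (F N - F (real n))) \<longlonglongrightarrow> norm (F N - l)" by (intro tendsto_intros l)
    obtain n0 :: nat where "N \<le> real n0" using real_arch_simple by blast
    then show "\<exists>n0. \<forall>n\<ge>n0. norm (F N - F (real n)) \<le> g N"
      using that F[of N] by (intro exI[of _ n0]) (auto simp: norm_minus_commute[of "F N"])
  qed
  have "((\<lambda>N. F N - l) \<longlongrightarrow> 0) at_top"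
    by (rule Lim_null_comparison[OF _ g]) (auto intro!: eventually_mono[OF eventually_ge_at_top[of 0]] le)
  then have "(F \<longlongrightarrow> l) at_top" by (rule LIM_zero_cancel)
  then show thesis using le that by blast
qed

section \<open>Laplace representation of the resolvent under growth bounds\<close>

context c0_semigroup
begin

lemma L_diff:
  assumes "0 \<le> N" "N \<le> N'"
  shows "L N' f - L N f = integral {N..N'} (\<lambda>t. T t f)"
proof -
  have "integral {0..N} (\<lambda>r. T r f) + integral {N..N'} (\<lambda>r. T r f) = integral {0..N'} (\<lambda>r. T r f)"
    using assms by (intro Henstock_Kurzweil_Integration.integral_combine integrable_T) auto
  then show ?thesis unfolding L_def by (metis add_diff_cancel_left')
qed

lemma Res_0_L: "0 \<in> rho T \<Longrightarrow> 0 \<le> N \<Longrightarrow> Res T 0 (f - T N f) = L N f"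
  using Res_gen_rel[OF _ gen_rel_L, of 0 N f] by (simp add: cscale.zero_left)

lemma exponentially_stable:
  assumes a: "a > 0" and M: "\<And>t f. 0 \<le> t \<Longrightarrow> norm (T t f) \<le> M * exp (- a * t) * norm f"
  shows "0 \<in> rho T" "((\<lambda>N. L N f) \<longlongrightarrow> Res T 0 f) at_top" "norm (Res T 0 f) \<le> M / a * norm f"
proof -
  have M0: "0 \<le> M * norm f" for f :: "'r cplx"
    using order_trans[OF norm_ge_zero M[of 0 f]] by simp
  have bd: "norm (L N' f - L N f) \<le> M / a * norm f * exp (- a * N)" if N: "0 \<le> N" "N \<le> N'" for N N' f
  proof -
    have I: "((\<lambda>t. M * exp (- a * t) * norm f) has_integral
        (- (M / a) * exp (- a * N') * norm f - - (M / a) * exp (- a * N) * norm f)) {N..N'}"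
      using N a by (intro fundamental_theorem_of_calculus)
        (auto intro!: derivative_eq_intros simp flip: has_real_derivative_iff_has_vector_derivative)
    have "norm (integral {N..N'} (\<lambda>t. T t f)) \<le> integral {N..N'} (\<lambda>t. M * exp (- a * t) * norm f)"
      using N by (intro integral_norm_bound_integral integrable_T has_integral_integrable[OF I] M) auto
    also have "\<dots> = M / a * norm f * exp (- a * N) - (M * norm f) * exp (- a * N') / a"
      unfolding integral_unique[OF I] by (simp add: mult_ac)
    also have "\<dots> \<le> M / a * norm f * exp (- a * N)" using a M0[of f] by simp
    finally show ?thesis using L_diff[OF N, of f] by simp
  qed
  have lim0: "((\<lambda>N. M / a * norm f * exp (- a * N)) \<longlongrightarrow> 0) at_top" for f :: "'r cplx"
  proof -
    have "((\<lambda>N. exp (- a * N)) \<longlongrightarrow> 0) at_top" using a by (rule exp_neg_mult_tendsto_0)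
    then show ?thesis by (rule tendsto_mult_right_zero)
  qed
  have "\<exists>l. ((\<lambda>N. L N f) \<longlongrightarrow> l) at_top \<and> norm l \<le> M / a * norm f" for f
  proof -
    obtain l where "((\<lambda>N. L N f) \<longlongrightarrow> l) at_top" "\<And>N. 0 \<le> N \<Longrightarrow> norm (L N f - l) \<le> M / a * norm f * exp (- a * N)"
      using cauchy_at_top_real[of "\<lambda>N. L N f", OF bd lim0] by blast
    from this(1) this(2)[of 0] show ?thesis by auto
  qed
  then obtain B where B: "\<And>f. ((\<lambda>N. L N f) \<longlongrightarrow> B f) at_top" "\<And>f. norm (B f) \<le> M / a * norm f"
    by metis
  have "res_op T 0 B" by (rule laplace_converges_0[OF B(1)])
  then show "0 \<in> rho T" "((\<lambda>N. L N f) \<longlongrightarrow> Res T 0 f) at_top" "norm (Res T 0 f) \<le> M / a * norm f"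
    using B by (auto simp: Res_eqI rho_def)
qed

definition lap :: "complex \<Rightarrow> real \<Rightarrow> 'r cplx \<Rightarrow> 'r cplx" where
  "lap z N f = integral {0..N} (\<lambda>t. rescale z T t f)"

lemma c0_rescale: "c0_semigroup (rescale z T)"
  by (rule c0_semigroup_rescale) unfold_locales

lemma L_rescale: "c0_semigroup.L (rescale z T) = lap z"
  by (simp add: c0_semigroup.L_def[OF c0_rescale] lap_def fun_eq_iff)

lemma rho_rescale_0: "0 \<in> rho (rescale z T) \<longleftrightarrow> z \<in> rho T" and Res_rescale_0: "Res (rescale z T) 0 = Res T z"
  using rho_rescale[OF c0_semigroup_axioms, of 0 z] Res_rescale[OF c0_semigroup_axioms, of z 0] by simp_all

lemma Res_lap: "z \<in> rho T \<Longrightarrow> 0 \<le> N \<Longrightarrow> Res T z (f - rescale z T N f) = lap z N f"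
  using c0_semigroup.Res_0_L[OF c0_rescale, of z N f] by (simp add: L_rescale rho_rescale_0 Res_rescale_0)

lemma laplace_converges:
  assumes "\<And>f. \<exists>l. ((\<lambda>N. lap z N f) \<longlongrightarrow> l) at_top"
  shows "z \<in> rho T"
proof -
  obtain B where "\<And>f. ((\<lambda>N. lap z N f) \<longlongrightarrow> B f) at_top" using assms by metis
  from c0_semigroup.laplace_converges_0[OF c0_rescale, unfolded L_rescale, OF this]
  have "0 \<in> rho (rescale z T)" by (auto simp: rho_def)
  then show ?thesis by (simp add: rho_rescale_0)
qed

lemma norm_resc_le: "norm (rescale z T t f) \<le> 2 * exp (- (Re z * t)) * norm (T t f)"
  using norm_cscale_le[of "exp (- (z * of_real t))" "T t f"] by (simp add: rescale_def norm_exp_eq_Re)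

lemma laplace_growth:
  assumes M: "\<And>t f. 0 \<le> t \<Longrightarrow> norm (T t f) \<le> M * exp (w * t) * norm f" and z: "Re z > w"
  shows "z \<in> rho T" "((\<lambda>N. lap z N f) \<longlongrightarrow> Res T z f) at_top"
    "norm (Res T z f) \<le> 2 * M / (Re z - w) * norm f"
proof -
  interpret S: c0_semigroup "rescale z T" by (rule c0_rescale)
  have "norm (rescale z T t f) \<le> 2 * M * exp (- (Re z - w) * t) * norm f" if "0 \<le> t" for t f
  proof -
    have "norm (rescale z T t f) \<le> 2 * exp (- (Re z * t)) * norm (T t f)" by (rule norm_resc_le)
    also have "\<dots> \<le> 2 * exp (- (Re z * t)) * (M * exp (w * t) * norm f)"
      using that by (intro mult_left_mono M) auto
    also have "\<dots> = 2 * M * exp (- (Re z - w) * t) * norm f"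
      by (simp add: algebra_simps flip: exp_add)
    finally show ?thesis .
  qed
  note est = this
  have "Re z - w > 0" using z by simp
  note stab = S.exponentially_stable[OF this est]
  show "z \<in> rho T" "((\<lambda>N. lap z N f) \<longlongrightarrow> Res T z f) at_top"
    "norm (Res T z f) \<le> 2 * M / (Re z - w) * norm f"
    using stab(1) stab(2,3)[of f] by (simp_all add: rho_rescale_0 Res_rescale_0 L_rescale)
qed

end

subsection \<open>Stability of bounded semigroups without spectrum on the imaginary axis\<close>

text \<open>Shifting by half a period of the oscillation changes its sign. Twice the integral is
  therefore an integral of increments of \<open>W\<close>, small by the Lipschitz bound, plus two
  end pieces of length \<open>h\<close>.\<close>

lemma riemann_lebesgue_lipschitz:
  fixes W :: "real \<Rightarrow> 'r::banach cplx"
  assumes K: "\<And>x. x \<in> {a..b} \<Longrightarrow> norm (W x) \<le> K"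
    and C: "\<And>x y. x \<in> {a..b} \<Longrightarrow> y \<in> {a..b} \<Longrightarrow> norm (W x - W y) \<le> C * \<bar>x - y\<bar>"
    and cont: "continuous_on {a..b} W"
    and t: "t \<noteq> 0" "pi / \<bar>t\<bar> \<le> b - a"
  shows "norm (integral {a..b} (\<lambda>x. cscale (cis (x * t)) (W x))) \<le> (2 * K + (b - a) * C) * pi / \<bar>t\<bar>"
proof -
  define h where "h = pi / \<bar>t\<bar>"
  have h: "0 < h" "h \<le> b - a" using t by (auto simp: h_def)
  define G where "G x = cscale (cis (x * t)) (W x)" for x
  have cis_h: "cis (h * t) = - 1"
    using t by (auto simp: h_def cis.ctr complex_eq_iff abs_if)
  have ic: "continuous_on {a..b} G"
    unfolding G_def by (intro cscale.continuous_on continuous_intros cont)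
  have int: "G integrable_on {c..d}" if "a \<le> c" "d \<le> b" for c d
    using that by (intro integrable_continuous_interval continuous_on_subset[OF ic]) auto
  have nG: "norm (G x) \<le> 2 * K" if "x \<in> {a..b}" for x
    using norm_cscale_le[of "cis (x * t)" "W x"] K[OF that] by (simp add: G_def)
  have "C * \<bar>a - b\<bar> \<ge> 0" using C[of a b] h by (auto intro: order_trans[OF norm_ge_zero])
  then have C0: "C \<ge> 0" using h by (simp add: zero_le_mult_iff)
  have 1: "integral {a..b} G = integral {a..b - h} G + integral {b - h..b} G"
    using h by (intro Henstock_Kurzweil_Integration.integral_combine[symmetric] int) auto
  have 2: "integral {a..b} G = integral {a..a + h} G + integral {a + h..b} G"
    using h by (intro Henstock_Kurzweil_Integration.integral_combine[symmetric] int) auto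
  have 3: "integral {a + h..b} G = integral {a..b - h} (\<lambda>x. G (x + h))"
    using integral_shift_real_ivl[of "a + h" h b G] by simp
  have int_sh: "(\<lambda>x. G (x + h)) integrable_on {a..b - h}"
    using integrable_shift_real_ivl[OF int[of "a + h" b], of h] h by simp
  \<comment> \<open>The two splittings of the interval are added: the plain copy sheds its right
    end, the shifted copy its left end.\<close>
  have "2 *\<^sub>R integral {a..b} G = integral {b - h..b} G + integral {a..a + h} G
      + (integral {a..b - h} G + integral {a..b - h} (\<lambda>x. G (x + h)))"
    unfolding scaleR_2 by (subst 1, subst 2, subst 3) simp
  also have "integral {a..b - h} G + integral {a..b - h} (\<lambda>x. G (x + h)) =
      integral {a..b - h} (\<lambda>x. G x + G (x + h))"
    using h by (intro integral_add[symmetric] int int_sh) auto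
  also have "norm (integral {b - h..b} G + integral {a..a + h} G + integral {a..b - h} (\<lambda>x. G x + G (x + h)))
      \<le> norm (integral {b - h..b} G) + norm (integral {a..a + h} G) + norm (integral {a..b - h} (\<lambda>x. G x + G (x + h)))"
    by (intro norm_triangle_le add_mono norm_triangle_ineq order_refl)
  also have "\<dots> \<le> 2 * K * (b - (b - h)) + 2 * K * (a + h - a) + 2 * C * h * (b - h - a)"
  proof (intro add_mono integral_bound)
    show "norm (G x + G (x + h)) \<le> 2 * C * h" if "x \<in> {a..b - h}" for x
    proof -
      have "G (x + h) = - cscale (cis (x * t)) (W (x + h))"
        by (simp add: G_def distrib_right cis_mult[symmetric] cis_h cscale.minus_left)
      then have "G x + G (x + h) = cscale (cis (x * t)) (W x - W (x + h))"
        by (simp add: G_def cscale.diff_right)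
      also have "norm \<dots> \<le> 2 * 1 * norm (W x - W (x + h))"
        using norm_cscale_le[of "cis (x * t)"] by simp
      also have "\<dots> \<le> 2 * 1 * (C * \<bar>x - (x + h)\<bar>)"
        using that h by (intro mult_left_mono C) auto
      finally show ?thesis using h by simp
    qed
    show "continuous_on {a..b - h} (\<lambda>x. G x + G (x + h))"
      using h by (intro continuous_intros continuous_on_subset[OF ic] continuous_on_compose2[OF ic]) auto
  qed (use h in \<open>auto intro!: nG continuous_on_subset[OF ic]\<close>)
  also have "\<dots> \<le> 2 * ((2 * K + (b - a) * C) * h)"
  proof -
    have "2 * C * h * (b - h - a) \<le> 2 * C * h * (b - a)" using C0 h by (intro mult_left_mono) auto
    then show ?thesis by (simp add: algebra_simps)
  qed
  finally show ?thesis by (simp add: G_def h_def)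
qed

section \<open>The Fejer kernel and its bounds\<close>

definition fejer :: "real \<Rightarrow> real \<Rightarrow> real" where
  "fejer n t = (if t = 0 then n else 2 * (1 - cos (n * t)) / (n * t\<^sup>2))"

text \<open>The triangle is integrated over its two halves, with the antiderivatives
  \<open>\<Phi>\<close> and \<open>\<Psi>\<close>. The value \<open>n\<close> prescribed for the
  kernel at 0 is the area of the triangle.\<close>

lemma fejer_has_integral:
  assumes n: "n > 0"
  shows "((\<lambda>x. of_real (1 - \<bar>x\<bar> / n) * cis (x * t)) has_integral complex_of_real (fejer n t)) {-n..n}"
proof -
  have cis': "((\<lambda>x. cis (x * t)) has_vector_derivative (\<i> * t * cis (x * t))) (at x within S)" for x S
  proof -
    have "((\<lambda>z. exp (\<i> * (z * t))) has_field_derivative \<i> * t * exp (\<i> * (x * t))) (at (of_real x))"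
      by (auto intro!: derivative_eq_intros)
    from has_vector_derivative_real_field[OF this] show ?thesis by (simp add: cis_conv_exp)
  qed
  \<comment> \<open>The tuple collects the endpoint values of the antiderivatives:
    \<open>A + B\<close> belongs to the right half, \<open>A' + B'\<close> to the left. At
    \<open>t = 0\<close> the denominators vanish, so this case has its own entry.\<close>
  have *: "((\<lambda>x. of_real (1 - x / n) * cis (x * t)) has_integral A + B) {0..n} \<and>
        ((\<lambda>x. of_real (1 + x / n) * cis (x * t)) has_integral A' + B') {-n..0}"
    if "(A, B, A', B') = (if t = 0 then (of_real (n / 2), 0, of_real (n / 2), 0) else
      (- cis (n * t) / (n * t\<^sup>2), 1 / (n * t\<^sup>2) - 1 / (\<i> * t), 1 / (\<i> * t) + 1 / (n * t\<^sup>2), - cis (- n * t) / (n * t\<^sup>2)))"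
    for A B A' B' :: complex
  proof (cases "t = 0")
    case True
    have "((\<lambda>x. 1 - x / n) has_integral (n - n^2/(2*n)) - (0 - 0^2/(2*n))) {0..n}"
      "((\<lambda>x. 1 + x / n) has_integral (0 + 0^2/(2*n)) - (- n + (-n)^2/(2*n))) {-n..0}"
      using n by (intro fundamental_theorem_of_calculus;
          auto intro!: derivative_eq_intros simp flip: has_real_derivative_iff_has_vector_derivative)+
    then have "((\<lambda>x. complex_of_real (1 - x / n)) has_integral of_real (n / 2)) {0..n}"
      "((\<lambda>x. complex_of_real (1 + x / n)) has_integral of_real (n / 2)) {-n..0}"
      using n by (auto dest!: has_integral_linear[OF _ bounded_linear_of_real[where 'a = complex]]
          simp: o_def power2_eq_square)
    moreover have sums: "A + B = of_real (n / 2)" "A' + B' = of_real (n / 2)" using that True by simp_all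
    ultimately show ?thesis unfolding sums by (simp add: True)
  next
    case False
    define \<Phi> where "\<Phi> x = cis (x * t) * (of_real (1 - x / n) / (\<i> * t) - 1 / (n * t\<^sup>2))" for x :: real
    define \<Psi> where "\<Psi> x = cis (x * t) * (of_real (1 + x / n) / (\<i> * t) + 1 / (n * t\<^sup>2))" for x :: real
    have d: "((\<lambda>x. of_real (1 - x / n) / (\<i> * t) - of_real (1 / (n * t\<^sup>2)))
          has_vector_derivative - (of_real (1 / n) / (\<i> * t))) (at x within S)"
      "((\<lambda>x. of_real (1 + x / n) / (\<i> * t) + of_real (1 / (n * t\<^sup>2)))
          has_vector_derivative of_real (1 / n) / (\<i> * t)) (at x within S)" for x S
      using n False
      by (auto intro!: derivative_eq_intros simp: has_vector_derivative_def scaleR_conv_of_real)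
    have "((\<lambda>x. of_real (1 - x / n) * cis (x * t)) has_integral \<Phi> n - \<Phi> 0) {0..n}"
    proof (rule fundamental_theorem_of_calculus)
      show "(\<Phi> has_vector_derivative of_real (1 - x / n) * cis (x * t)) (at x within {0..n})" for x
        unfolding \<Phi>_def
        by (rule has_vector_derivative_eq_rhs[OF has_vector_derivative_mult[OF cis' d(1)]])
           (use False n in \<open>simp add: field_simps power2_eq_square\<close>)
    qed (use n in auto)
    moreover have "((\<lambda>x. of_real (1 + x / n) * cis (x * t)) has_integral \<Psi> 0 - \<Psi> (- n)) {-n..0}"
    proof (rule fundamental_theorem_of_calculus)
      show "(\<Psi> has_vector_derivative of_real (1 + x / n) * cis (x * t)) (at x within {-n..0})" for x
        unfolding \<Psi>_def
        by (rule has_vector_derivative_eq_rhs[OF has_vector_derivative_mult[OF cis' d(2)]])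
           (use False n in \<open>simp add: field_simps power2_eq_square\<close>)
    qed (use n in auto)
    moreover have "\<Phi> n - \<Phi> 0 = A + B" "\<Psi> 0 - \<Psi> (- n) = A' + B'"
      using that False n by (simp_all add: \<Phi>_def \<Psi>_def)
    ultimately show ?thesis by simp
  qed
  obtain A B A' B' :: complex where AB: "(A, B, A', B') = (if t = 0 then (of_real (n / 2), 0, of_real (n / 2), 0) else
      (- cis (n * t) / (n * t\<^sup>2), 1 / (n * t\<^sup>2) - 1 / (\<i> * t), 1 / (\<i> * t) + 1 / (n * t\<^sup>2), - cis (- n * t) / (n * t\<^sup>2)))"
    by (metis prod_cases4)
  have "((\<lambda>x. of_real (1 - \<bar>x\<bar> / n) * cis (x * t)) has_integral A + B) {0..n}"
    using *[OF AB] by (auto intro: has_integral_eq[rotated])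
  moreover have "((\<lambda>x. of_real (1 - \<bar>x\<bar> / n) * cis (x * t)) has_integral A' + B') {-n..0}"
    using *[OF AB] by (auto intro: has_integral_eq[rotated])
  ultimately have "((\<lambda>x. of_real (1 - \<bar>x\<bar> / n) * cis (x * t)) has_integral (A' + B') + (A + B)) {-n..n}"
    using n by (intro has_integral_combine[of "-n" 0 n]) auto
  moreover have "(A' + B') + (A + B) = of_real (fejer n t)"
  proof (cases "t = 0")
    case False
    have cc: "cis (n * t) + cis (- n * t) = of_real (2 * cos (n * t))" by (simp add: complex_eq_iff)
    have "(A' + B') + (A + B) = 2 / (n * t\<^sup>2) - (cis (n * t) + cis (- n * t)) / (n * t\<^sup>2)"
      using AB False by (simp add: add_divide_distrib)
    also have "\<dots> = of_real (fejer n t)"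
      unfolding cc using False by (simp add: fejer_def diff_divide_distrib right_diff_distrib)
    finally show ?thesis .
  next
    case True
    have "((A' + B') + (A + B)) * 2 = of_real (fejer n t) * 2"
      using AB True by (simp add: fejer_def distrib_right)
    then show ?thesis by (rule mult_right_cancel[THEN iffD1, rotated]) simp
  qed
  ultimately show ?thesis by simp
qed

lemma fejer_nonneg: "n > 0 \<Longrightarrow> 0 \<le> fejer n t"
  by (simp add: fejer_def)

text \<open>The upper bound comes from the half-angle formula. The lower one is the Taylor expansion
  to fourth order, where \<open>x ^ 4 \<le> x\<^sup>2\<close> leaves more than a quarter of
  \<open>x\<^sup>2\<close>.\<close>

lemma one_minus_cos_bounds:
  fixes x :: real
  shows "1 - cos x \<le> x\<^sup>2 / 2" "\<bar>x\<bar> \<le> 1 \<Longrightarrow> x\<^sup>2 / 4 \<le> 1 - cos x"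
proof -
  have eq: "1 - cos x = 2 * (sin (x / 2))\<^sup>2"
    using cos_double_sin[of "x/2"] by simp
  have "(sin (x / 2))\<^sup>2 \<le> (x / 2)\<^sup>2"
    using abs_sin_x_le_abs_x[of "x/2"] by (rule abs_le_square_iff[THEN iffD1])
  then show "1 - cos x \<le> x\<^sup>2 / 2" unfolding eq by (simp add: power_divide)
  assume x: "\<bar>x\<bar> \<le> 1"
  obtain t where "cos x = (\<Sum>m<4. cos_coeff m * x ^ m) + (cos (t + 1/2 * real 4 * pi) / fact 4) * x ^ 4"
    using Maclaurin_cos_expansion[of x 4] by blast
  moreover have "cos (t + 1/2 * real 4 * pi) / fact 4 * x ^ 4 \<le> 1 / fact 4 * x ^ 4"
    by (intro mult_right_mono divide_right_mono) auto
  moreover have "(\<Sum>m<4. cos_coeff m * x ^ m) = 1 - x\<^sup>2 / 2"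
  proof -
    have "{..<4::nat} = {0, 1, 2, 3}" by auto
    then show ?thesis by (simp add: cos_coeff_def)
  qed
  moreover have "(fact 4 :: real) = 24" by (simp add: fact_numeral)
  ultimately have "cos x \<le> 1 - x\<^sup>2 / 2 + x ^ 4 / 24" by simp
  moreover have "x ^ 4 \<le> x\<^sup>2"
    using x power_decreasing[of 2 4 "\<bar>x\<bar>"] by simp
  ultimately show "x\<^sup>2 / 4 \<le> 1 - cos x" using zero_le_power2[of x] by linarith
qed

text \<open>The first bound has an arctangent as antiderivative and a total mass independent of
  \<open>n\<close>; the second decays in \<open>n\<close> away from 0. The 5 majorises both
  \<open>n\<close> and \<open>4 / (n * t\<^sup>2)\<close>, the two cases meeting at
  \<open>(n * t)\<^sup>2 = 4\<close>.\<close>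

lemma fejer_le:
  assumes n: "n > 0" shows "fejer n t \<le> 5 * n / (1 + (n * t)\<^sup>2)" "t \<noteq> 0 \<Longrightarrow> fejer n t \<le> 4 / (n * t\<^sup>2)"
proof -
  show 2: "fejer n t \<le> 4 / (n * t\<^sup>2)" if "t \<noteq> 0"
  proof -
    have "2 * (1 - cos (n * t)) \<le> 2 * 2"
      by (intro mult_left_mono) (use cos_ge_minus_one[of "n * t"] in auto)
    then show ?thesis using that n by (auto simp: fejer_def intro!: divide_right_mono)
  qed
  have 1: "fejer n t \<le> n" if "t \<noteq> 0"
  proof -
    have "2 * (1 - cos (n * t)) / (n * t\<^sup>2) \<le> 2 * ((n * t)\<^sup>2 / 2) / (n * t\<^sup>2)"
      using n by (intro divide_right_mono mult_left_mono one_minus_cos_bounds) auto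
    also have "\<dots> = n" using that n by (simp add: power2_eq_square)
    finally show ?thesis using that by (simp add: fejer_def)
  qed
  show "fejer n t \<le> 5 * n / (1 + (n * t)\<^sup>2)"
  proof (cases "t = 0")
    case True
    then show ?thesis using n by (simp add: fejer_def)
  next
    case False
    show ?thesis
    proof (cases "(n * t)\<^sup>2 \<le> 4")
      case True
      have "n \<le> 5 * n / (1 + (n * t)\<^sup>2)" using True n by (simp add: pos_le_divide_eq add_pos_nonneg algebra_simps)
      with 1[OF False] show ?thesis by simp
    next
      case *: False
      have "4 / (n * t\<^sup>2) = n * (4 / (n * t)\<^sup>2)" using n by (simp add: power2_eq_square)
      also have "4 / (n * t)\<^sup>2 \<le> 5 / (1 + (n * t)\<^sup>2)"
      proof -
        have "4 / y \<le> 5 / (1 + y)" if "y > 4" for y :: real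
          using that by (simp add: divide_simps)
        then show ?thesis using * by simp
      qed
      finally show ?thesis using 2[OF False] n by (simp add: mult_left_mono mult.commute)
    qed
  qed
qed

text \<open>Half of the maximum persists on an interval of length \<open>2 / n\<close>, so the
  kernel has mass at least 1 there.\<close>

lemma fejer_ge:
  assumes "n > 0" "\<bar>n * t\<bar> \<le> 1" shows "n / 2 \<le> fejer n t"
proof (cases "t = 0")
  case False
  have "n / 2 = 2 * ((n * t)\<^sup>2 / 4) / (n * t\<^sup>2)" using assms False by (simp add: power2_eq_square)
  also have "\<dots> \<le> 2 * (1 - cos (n * t)) / (n * t\<^sup>2)"
    using assms by (intro divide_right_mono mult_left_mono one_minus_cos_bounds) auto
  finally show ?thesis using False by (simp add: fejer_def)
qed (use assms in \<open>simp add: fejer_def\<close>)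

text \<open>As an integral depending on a parameter, the kernel is continuous without a separate
  look at the quotient near 0.\<close>

lemma continuous_on_fejer:
  assumes n: "n > 0" shows "continuous_on UNIV (fejer n)"
proof -
  have "continuous_on UNIV (\<lambda>t. integral (cbox (-n) n) (\<lambda>x. of_real (1 - \<bar>x\<bar> / n) * cis (x * t)))"
    by (rule integral_continuous_on_param) (auto intro!: continuous_intros simp: split_beta n[THEN less_imp_neq, symmetric])
  then have "continuous_on UNIV (\<lambda>t. Re (integral (cbox (-n) n) (\<lambda>x. of_real (1 - \<bar>x\<bar> / n) * cis (x * t))))"
    by (intro continuous_intros)
  then show ?thesis
    using integral_unique[OF fejer_has_integral[OF n]] by simp
qed

section \<open>Fejer means of orbits\<close>

context c0_semigroup
begin

lemma rescale_imaginary: "rescale (\<i> * of_real x) T t f = cscale (cis (- (x * t))) (T t f)"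
  by (simp add: rescale_def cis_conv_exp mult_ac)

text \<open>After exchanging the integrals, the inner one is a truncated Laplace integral on the
  imaginary axis, which the resolvent evaluates exactly. The term with \<open>T N f\<close> is the
  contribution of the cut, so the formula holds at finite \<open>N\<close>.\<close>

lemma fejer_mean_representation:
  assumes n: "n > 0" and N: "0 \<le> N" and iR: "\<And>x. \<i> * of_real x \<in> rho T"
  defines "W \<equiv> \<lambda>g x. (1 - \<bar>x\<bar> / n) *\<^sub>R Res T (\<i> * of_real x) g"
  shows "integral {0..N} (\<lambda>s. fejer n (t - s) *\<^sub>R T s f) =
    integral {-n..n} (\<lambda>x. cscale (cis (x * t)) (W f x)) -
    integral {-n..n} (\<lambda>x. cscale (cis (x * (t - N))) (W (T N f) x))"
proof -
  define \<Psi> where "\<Psi> s x = cscale (of_real (1 - \<bar>x\<bar> / n) * cis (x * (t - s))) (T s f)" for s x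
  have contW: "continuous_on {-n..n} (W g)" for g
    unfolding W_def using n iR by (intro continuous_intros continuous_Res) auto
  have int: "(\<lambda>x. cscale (cis (x * c)) (W g x)) integrable_on {-n..n}" for c g
    by (intro integrable_continuous_interval cscale.continuous_on contW continuous_intros)
  have "integral {0..N} (\<lambda>s. fejer n (t - s) *\<^sub>R T s f) = integral {0..N} (\<lambda>s. integral {-n..n} (\<Psi> s))"
  proof (rule integral_cong)
    fix s
    have "((\<lambda>x. \<Psi> s x) has_integral cscale (of_real (fejer n (t - s))) (T s f)) {-n..n}"
      using has_integral_linear[OF fejer_has_integral[OF n] cscale.bounded_linear_left]
      by (simp add: o_def \<Psi>_def)
    then show "fejer n (t - s) *\<^sub>R T s f = integral {-n..n} (\<Psi> s)" by (simp add: integral_unique)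
  qed
  also have "\<dots> = integral {-n..n} (\<lambda>x. integral {0..N} (\<lambda>s. \<Psi> s x))"
  proof -
    have "continuous_on (cbox (0, -n) (N, n)) (\<lambda>(s, x). \<Psi> s x)"
      unfolding \<Psi>_def split_beta using n
      by (intro cscale.continuous_on continuous_intros) (auto simp: cbox_Pair_eq)
    from integral_swap_continuous[OF this] show ?thesis by simp
  qed
  also have "\<dots> = integral {-n..n} (\<lambda>x. cscale (cis (x * t)) (W f x) - cscale (cis (x * (t - N))) (W (T N f) x))"
  proof (rule integral_cong)
    fix x
    have "integral {0..N} (\<lambda>s. \<Psi> s x) =
        integral {0..N} (\<lambda>s. cscale (of_real (1 - \<bar>x\<bar> / n) * cis (x * t)) (rescale (\<i> * of_real x) T s f))"
      by (rule integral_cong) (simp add: \<Psi>_def rescale_imaginary mult.assoc cis_mult right_diff_distrib)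
    also have "\<dots> = cscale (of_real (1 - \<bar>x\<bar> / n) * cis (x * t)) (lap (\<i> * of_real x) N f)"
      unfolding lap_def
      using integral_linear[OF c0_semigroup.integrable_T[OF c0_rescale, of 0] cscale.bounded_linear_right]
      by (simp add: o_def)
    also have "lap (\<i> * of_real x) N f = Res T (\<i> * of_real x) (f - cscale (cis (- (x * N))) (T N f))"
      using Res_lap[OF iR N, of x f] by (simp add: rescale_imaginary)
    also have "cscale (of_real (1 - \<bar>x\<bar> / n) * cis (x * t)) \<dots> =
        cscale (cis (x * t)) (W f x) - cscale (cis (x * (t - N))) (W (T N f) x)"
      by (simp add: W_def Res_diff Res_cscale iR cscale.diff_right mult.assoc cis_mult right_diff_distrib
          mult.left_commute[of _ "of_real _"] flip: cscale_of_real)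
         (simp add: algebra_simps cis_mult)
    finally show "integral {0..N} (\<lambda>s. \<Psi> s x) =
        cscale (cis (x * t)) (W f x) - cscale (cis (x * (t - N))) (W (T N f) x)" .
  qed
  also have "\<dots> = integral {-n..n} (\<lambda>x. cscale (cis (x * t)) (W f x)) -
      integral {-n..n} (\<lambda>x. cscale (cis (x * (t - N))) (W (T N f) x))"
    by (rule integral_diff[OF int int])
  finally show ?thesis .
qed

text \<open>Taking \<open>N = 2 * t\<close> makes the two phases \<open>t\<close> and
  \<open>- t\<close>, so the Riemann-Lebesgue estimate applies to both terms; boundedness of the
  semigroup controls \<open>T (2 * t) f\<close>.\<close>

lemma fejer_mean_decay:
  assumes n: "n > 0" and iR: "\<And>x. \<i> * of_real x \<in> rho T" and M: "\<And>t f. 0 \<le> t \<Longrightarrow> norm (T t f) \<le> M * norm f"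
  obtains D where "D \<ge> 0"
    "\<And>t f. pi / t \<le> 2 * n \<Longrightarrow> t > 0 \<Longrightarrow> norm (integral {0..2 * t} (\<lambda>s. fejer n (t - s) *\<^sub>R T s f)) \<le> D / t * norm f"
proof -
  define S where "S = (\<lambda>x. \<i> * complex_of_real x) ` {-n..n}"
  have "compact S" unfolding S_def
    by (intro compact_continuous_image continuous_intros compact_Icc)
  moreover have "S \<subseteq> rho T" using iR by (auto simp: S_def)
  ultimately obtain K where K: "K > 0" "\<And>z f. z \<in> S \<Longrightarrow> norm (Res T z f) \<le> K * norm f"
    by (rule Res_bounded_on_compact) blast
  define W where "W = (\<lambda>g x. (1 - \<bar>x\<bar> / n) *\<^sub>R Res T (\<i> * of_real x) g)"
  have w1: "\<bar>1 - \<bar>x\<bar> / n\<bar> \<le> 1" if "x \<in> {-n..n}" for x using that n by auto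
  have RK: "norm (Res T (\<i> * of_real x) g) \<le> K * norm g" if "x \<in> {-n..n}" for x g
    using that by (intro K(2)) (auto simp: S_def)
  have WK: "norm (W g x) \<le> K * norm g" if "x \<in> {-n..n}" for x g
    using mult_mono[OF w1[OF that] RK[OF that, of g]] by (simp add: W_def)
  \<comment> \<open>\<open>K / n\<close> is the slope of the triangle times the resolvent bound;
    \<open>2 * K * K\<close> comes from the resolvent identity.\<close>
  define C where "C = K / n + 2 * K * K"
  have WC: "norm (W g x - W g y) \<le> C * norm g * \<bar>x - y\<bar>" if x: "x \<in> {-n..n}" and y: "y \<in> {-n..n}" for x y g
  proof -
    have "W g x - W g y = ((\<bar>y\<bar> - \<bar>x\<bar>) / n) *\<^sub>R Res T (\<i> * of_real x) g
        + (1 - \<bar>y\<bar> / n) *\<^sub>R (Res T (\<i> * of_real x) g - Res T (\<i> * of_real y) g)"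
      by (simp add: W_def algebra_simps diff_divide_distrib)
    also have "\<dots> = ((\<bar>y\<bar> - \<bar>x\<bar>) / n) *\<^sub>R Res T (\<i> * of_real x) g
        + (1 - \<bar>y\<bar> / n) *\<^sub>R cscale (\<i> * of_real (y - x)) (Res T (\<i> * of_real x) (Res T (\<i> * of_real y) g))"
      by (simp add: resolvent_identity[OF iR iR] right_diff_distrib)
    also have "norm \<dots> \<le> norm (((\<bar>y\<bar> - \<bar>x\<bar>) / n) *\<^sub>R Res T (\<i> * of_real x) g)
        + norm ((1 - \<bar>y\<bar> / n) *\<^sub>R cscale (\<i> * of_real (y - x)) (Res T (\<i> * of_real x) (Res T (\<i> * of_real y) g)))"
      by (rule norm_triangle_ineq)
    also have "\<dots> \<le> (\<bar>x - y\<bar> / n) * (K * norm g) + 1 * (2 * \<bar>x - y\<bar> * (K * (K * norm g)))"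
      unfolding norm_scaleR
    proof (intro add_mono mult_mono RK x)
      show "\<bar>(\<bar>y\<bar> - \<bar>x\<bar>) / n\<bar> \<le> \<bar>x - y\<bar> / n" using n by (auto intro!: divide_right_mono)
      have "norm (cscale (\<i> * of_real (y - x)) (Res T (\<i> * of_real x) (Res T (\<i> * of_real y) g)))
          \<le> 2 * cmod (\<i> * of_real (y - x)) * norm (Res T (\<i> * of_real x) (Res T (\<i> * of_real y) g))"
        by (rule norm_cscale_le)
      also have "cmod (\<i> * of_real (y - x)) = \<bar>x - y\<bar>" by (simp add: norm_mult abs_minus_commute flip: of_real_diff)
      also have "2 * \<bar>x - y\<bar> * norm (Res T (\<i> * of_real x) (Res T (\<i> * of_real y) g)) \<le> 2 * \<bar>x - y\<bar> * (K * (K * norm g))"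
        using order_trans[OF RK[OF x] mult_left_mono[OF RK[OF y]]] K by (intro mult_left_mono) auto
      finally show "norm (cscale (\<i> * of_real (y - x)) (Res T (\<i> * of_real x) (Res T (\<i> * of_real y) g)))
          \<le> 2 * \<bar>x - y\<bar> * (K * (K * norm g))" .
    qed (use w1[OF y] n K in auto)
    also have "\<dots> = C * norm g * \<bar>x - y\<bar>" by (simp add: C_def algebra_simps)
    finally show ?thesis .
  qed
  have cont: "continuous_on {-n..n} (W g)" for g
    unfolding W_def using n iR by (intro continuous_intros continuous_Res) auto
  define D0 where "D0 = (2 * K + 2 * n * C) * pi"
  have C0: "C \<ge> 0" using K n by (simp add: C_def)
  have D0: "D0 \<ge> 0" using K n C0 by (simp add: D0_def)
  have rl: "norm (integral {-n..n} (\<lambda>x. cscale (cis (x * c)) (W g x))) \<le> D0 / \<bar>c\<bar> * norm g"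
    if "c \<noteq> 0" "pi / \<bar>c\<bar> \<le> 2 * n" for c g
    using riemann_lebesgue_lipschitz[of "-n" n "W g" "K * norm g" "C * norm g" c, OF WK WC cont that(1)] that
    by (simp add: D0_def algebra_simps add_divide_distrib)
  have "norm (integral {0..2 * t} (\<lambda>s. fejer n (t - s) *\<^sub>R T s f)) \<le> (D0 * (1 + \<bar>M\<bar>)) / t * norm f"
    if t: "pi / t \<le> 2 * n" "t > 0" for t f
  proof -
    have "norm (integral {0..2 * t} (\<lambda>s. fejer n (t - s) *\<^sub>R T s f)) =
      norm (integral {-n..n} (\<lambda>x. cscale (cis (x * t)) (W f x)) -
            integral {-n..n} (\<lambda>x. cscale (cis (x * (- t))) (W (T (2 * t) f) x)))"
      using fejer_mean_representation[OF n _ iR, of "2 * t" t f] t by (simp add: W_def)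
    also have "\<dots> \<le> D0 / \<bar>t\<bar> * norm f + D0 / \<bar>- t\<bar> * norm (T (2 * t) f)"
      using t by (intro order_trans[OF norm_triangle_ineq4] add_mono rl) auto
    also have "\<dots> \<le> D0 / t * norm f + D0 / t * (\<bar>M\<bar> * norm f)"
    proof -
      have "norm (T (2 * t) f) \<le> M * norm f" using t by (intro M) auto
      also have "\<dots> \<le> \<bar>M\<bar> * norm f" by (intro mult_right_mono) auto
      finally show ?thesis using t D0 by (auto intro!: mult_left_mono divide_right_mono)
    qed
    finally show ?thesis using t by (simp add: field_simps)
  qed
  then show thesis using D0 by (intro that[of "D0 * (1 + \<bar>M\<bar>)"]) auto
qed

text \<open>The kernel is concentrated near \<open>s = t\<close>, where the orbit varies little,
  uniformly in \<open>t\<close>. Its mass on \<open>{0..2 * t}\<close> is at least 1, so the mean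
  controls \<open>T t f\<close> up to \<open>e\<close>. Here \<open>n\<close> may depend on
  \<open>f\<close> but not on \<open>t\<close>.\<close>

lemma fejer_mean_approximation:
  assumes M: "\<And>t f. 0 \<le> t \<Longrightarrow> norm (T t f) \<le> M * norm f" and e: "e > 0"
  obtains n where "n > 0" "\<And>t. t \<ge> 1 / n \<Longrightarrow>
    norm (T t f) \<le> e + norm (integral {0..2 * t} (\<lambda>s. fejer n (t - s) *\<^sub>R T s f))"
proof -
  define m where "m = \<bar>M\<bar> + 1"
  have m: "m > 0" "\<And>t f. 0 \<le> t \<Longrightarrow> norm (T t f) \<le> m * norm f"
  proof -
    show "norm (T t f) \<le> m * norm f" if "0 \<le> t" for t f
      by (rule order_trans[OF M[OF that]]) (auto simp: m_def intro!: mult_right_mono)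
  qed (simp add: m_def)
  \<comment> \<open>The near part contributes \<open>\<eta>\<close> times the mass
    \<open>5 * pi\<close> of the majorant, that is \<open>e / 2\<close>.\<close>
  define \<eta> where "\<eta> = e / (10 * pi)"
  have \<eta>: "\<eta> > 0" using e by (simp add: \<eta>_def)
  have "eventually (\<lambda>h. m * norm (T h f - f) < \<eta>) (at_right 0)"
    by (rule order_tendstoD(2)[OF _ \<eta>])
       (auto intro!: tendsto_eq_intros tendsto_at_0)
  then obtain \<delta> where \<delta>: "\<delta> > 0" "\<And>h. 0 < h \<Longrightarrow> h < \<delta> \<Longrightarrow> m * norm (T h f - f) < \<eta>"
    by (auto simp: eventually_at_right_field)
  \<comment> \<open>At distance \<open>x\<close> of at least \<open>\<delta>\<close>,
    \<open>1 / x\<^sup>2\<close> is at most \<open>c / (1 + x\<^sup>2)\<close>, which again has an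
    arctangent as antiderivative.\<close>
  define c where "c = (1 + \<delta>\<^sup>2) / \<delta>\<^sup>2"
  have c: "c > 0" using \<delta> by (simp add: c_def add_pos_nonneg)
  define B where "B = 8 * m * norm f * c"
  have B: "B \<ge> 0" using m c by (simp add: B_def)
  \<comment> \<open>The far part contributes at most \<open>pi * B / n\<close>, made at most
    \<open>e / 2\<close>; the added 1 keeps \<open>n\<close> positive when
    \<open>B = 0\<close>.\<close>
  define n where "n = 2 * pi * B / e + 1"
  have n: "n > 0" using B e by (simp add: n_def add_nonneg_pos)
  have Bn: "pi * B / n \<le> e / 2" using B e n by (simp add: n_def field_simps add_nonneg_pos)
  have "norm (T t f) \<le> e + norm (integral {0..2 * t} (\<lambda>s. fejer n (t - s) *\<^sub>R T s f))" if t: "t \<ge> 1 / n" for t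
  proof -
    have t0: "t > 0" using t n by (meson less_le_trans zero_less_divide_1_iff)
    have cf: "continuous_on A (\<lambda>s. fejer n (t - s))" for A
      by (rule continuous_on_compose2[OF continuous_on_fejer[OF n]]) (auto intro!: continuous_intros)
    have dT: "norm (T t f - T s f) \<le> \<eta>" if "s \<ge> 0" "\<bar>t - s\<bar> < \<delta>" for s
    proof (cases "s = t")
      case False
      have "norm (T t f - T s f) \<le> m * norm (T \<bar>t - s\<bar> f - f)"
        using that t0 by (intro norm_T_diff_le[of "max s t"] m) auto
      also have "\<dots> < \<eta>" using False that by (intro \<delta>) auto
      finally show ?thesis by simp
    qed (use \<eta> in simp)
    define q where "q s = \<eta> * (5 * n / (1 + (n * (t - s))\<^sup>2)) + B / n / (1 + (t - s)\<^sup>2)" for s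
    have ptw: "norm (fejer n (t - s) *\<^sub>R (T t f - T s f)) \<le> q s" if s: "s \<in> {0..2 * t}" for s
    proof (cases "\<bar>t - s\<bar> < \<delta>")
      case True
      have "norm (fejer n (t - s) *\<^sub>R (T t f - T s f)) = fejer n (t - s) * norm (T t f - T s f)"
        using fejer_nonneg[OF n] by simp
      also have "\<dots> \<le> (5 * n / (1 + (n * (t - s))\<^sup>2)) * \<eta>"
        using s True n \<eta> by (intro mult_mono fejer_le dT) auto
      also have "\<dots> \<le> q s" using B n by (simp add: q_def mult.commute[of \<eta>])
      finally show ?thesis .
    next
      case False
      then have ts: "t - s \<noteq> 0" using \<delta> by auto
      have "norm (T t f - T s f) \<le> 2 * (m * norm f)"
        using norm_triangle_ineq4[of "T t f" "T s f"] m(2)[of t f] m(2)[of s f] s t0 by auto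
      then have "fejer n (t - s) * norm (T t f - T s f) \<le> (4 / (n * (t - s)\<^sup>2)) * (2 * (m * norm f))"
        using fejer_nonneg[OF n] n by (intro mult_mono fejer_le(2)[OF n ts]) auto
      then have "norm (fejer n (t - s) *\<^sub>R (T t f - T s f)) \<le> (4 / (n * (t - s)\<^sup>2)) * (2 * (m * norm f))"
        using fejer_nonneg[OF n] by simp
      also have "\<dots> = (8 * m * norm f / n) * (1 / (t - s)\<^sup>2)" by simp
      also have "1 / (t - s)\<^sup>2 \<le> c / (1 + (t - s)\<^sup>2)"
      proof -
        have "\<delta>\<^sup>2 \<le> (t - s)\<^sup>2" using False \<delta> by (simp add: abs_le_square_iff[symmetric])
        then show ?thesis using \<delta> ts unfolding c_def
          by (simp add: divide_simps add_pos_nonneg) (auto simp: algebra_simps add_pos_nonneg)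
      qed
      then have "(8 * m * norm f / n) * (1 / (t - s)\<^sup>2) \<le> (8 * m * norm f / n) * (c / (1 + (t - s)\<^sup>2))"
        using m n by (intro mult_left_mono) auto
      also have "\<dots> = B / n / (1 + (t - s)\<^sup>2)" by (simp add: B_def)
      also have "\<dots> \<le> q s" using \<eta> n by (simp add: q_def add_nonneg_nonneg)
      finally show ?thesis .
    qed
    define Q where "Q s = - 5 * \<eta> * arctan (n * (t - s)) - B / n * arctan (t - s)" for s
    have Q: "(q has_integral Q (2 * t) - Q 0) {0..2 * t}"
    proof (rule fundamental_theorem_of_calculus)
      show "(Q has_vector_derivative q s) (at s within {0..2 * t})" for s
        unfolding Q_def q_def has_real_derivative_iff_has_vector_derivative[symmetric]
        by (auto intro!: derivative_eq_intros simp: divide_inverse)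
    qed (use t0 in simp)
    have "Q (2 * t) - Q 0 = 10 * \<eta> * arctan (n * t) + 2 * (B / n) * arctan t"
      by (simp add: Q_def arctan_minus)
    also have "\<dots> \<le> 10 * \<eta> * (pi / 2) + 2 * (B / n) * (pi / 2)"
      using \<eta> B n arctan_ubound[of "n * t"] arctan_ubound[of t] by (intro add_mono mult_left_mono) auto
    also have "\<dots> \<le> e" using Bn by (simp add: \<eta>_def field_simps)
    finally have Qe: "Q (2 * t) - Q 0 \<le> e" .
    have contT: "continuous_on {0..2 * t} (\<lambda>s. T s f)" by (intro continuous_intros) auto
    have "norm (integral {0..2 * t} (\<lambda>s. fejer n (t - s) *\<^sub>R (T t f - T s f))) \<le> integral {0..2 * t} q"
      by (intro integral_norm_bound_integral has_integral_integrable[OF Q] ptw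
          integrable_continuous_interval continuous_on_scaleR continuous_on_diff continuous_on_const cf contT)
    also have "\<dots> \<le> e" using Q Qe by (simp add: integral_unique)
    also have "integral {0..2 * t} (\<lambda>s. fejer n (t - s) *\<^sub>R (T t f - T s f)) =
       integral {0..2 * t} (\<lambda>s. fejer n (t - s)) *\<^sub>R T t f - integral {0..2 * t} (\<lambda>s. fejer n (t - s) *\<^sub>R T s f)"
      unfolding scaleR_diff_right
      by (subst integral_diff)
         (auto intro!: integrable_continuous_interval continuous_on_scaleR cf contT continuous_on_const
           simp: integral_linear[OF integrable_continuous_interval[OF cf] bounded_linear_scaleR_left, unfolded o_def])
    finally have le: "norm (integral {0..2 * t} (\<lambda>s. fejer n (t - s)) *\<^sub>R T t f
        - integral {0..2 * t} (\<lambda>s. fejer n (t - s) *\<^sub>R T s f)) \<le> e" .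
    \<comment> \<open>The interval of length \<open>2 / n\<close> around \<open>t\<close> lies in
      \<open>{0..2 * t}\<close> because \<open>t \<ge> 1 / n\<close>.\<close>
    have "1 = integral {t - 1/n..t + 1/n} (\<lambda>s. n / 2)" using n by simp
    also have "\<dots> \<le> integral {t - 1/n..t + 1/n} (\<lambda>s. fejer n (t - s))"
    proof (rule integral_le)
      fix s assume "s \<in> {t - 1/n..t + 1/n}"
      then have "\<bar>n * (t - s)\<bar> \<le> 1" using n by (auto simp: abs_mult abs_le_iff field_simps)
      then show "n / 2 \<le> fejer n (t - s)" by (rule fejer_ge[OF n])
    qed (auto intro!: integrable_continuous_interval cf continuous_on_const)
    also have "\<dots> \<le> integral {0..2 * t} (\<lambda>s. fejer n (t - s))"
      using t fejer_nonneg[OF n] by (intro integral_subset_le integrable_continuous_interval cf) auto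
    finally have "1 * norm (T t f) \<le> integral {0..2 * t} (\<lambda>s. fejer n (t - s)) * norm (T t f)"
      by (intro mult_right_mono) auto
    also have "\<dots> \<le> norm (integral {0..2 * t} (\<lambda>s. fejer n (t - s)) *\<^sub>R T t f)"
      by (simp add: mult_right_mono)
    finally show ?thesis
      using le norm_triangle_sub[of "integral {0..2 * t} (\<lambda>s. fejer n (t - s)) *\<^sub>R T t f"
          "integral {0..2 * t} (\<lambda>s. fejer n (t - s) *\<^sub>R T s f)"] by simp
  qed
  then show thesis using n that by blast
qed

text \<open>First \<open>n\<close> is fixed by the approximation, at the cost of
  \<open>e / 2\<close>; for this \<open>n\<close> the mean decays like \<open>1 / t\<close>.\<close>

theorem bounded_imp_strongly_stable:
  assumes M: "\<And>t f. 0 \<le> t \<Longrightarrow> norm (T t f) \<le> M * norm f" and iR: "\<And>x. \<i> * of_real x \<in> rho T"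
  shows "((\<lambda>t. T t f) \<longlongrightarrow> 0) at_top"
proof (rule tendstoI)
  fix e :: real assume e: "e > 0"
  obtain n where n: "n > 0" "\<And>t. t \<ge> 1 / n \<Longrightarrow>
      norm (T t f) \<le> e / 2 + norm (integral {0..2 * t} (\<lambda>s. fejer n (t - s) *\<^sub>R T s f))"
    by (rule fejer_mean_approximation[OF M, of "e/2" f]) (use e in auto)
  obtain D where D: "D \<ge> 0" "\<And>t f. pi / t \<le> 2 * n \<Longrightarrow> t > 0 \<Longrightarrow>
      norm (integral {0..2 * t} (\<lambda>s. fejer n (t - s) *\<^sub>R T s f)) \<le> D / t * norm f"
    by (rule fejer_mean_decay[OF n(1) iR M]) auto
  have "((\<lambda>t. D * norm f / t) \<longlongrightarrow> 0) at_top"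
    by (rule tendsto_divide_0[OF tendsto_const]) (simp add: filterlim_at_top_imp_at_infinity filterlim_ident)
  then have "eventually (\<lambda>t. D * norm f / t < e / 2) at_top" using e by (intro order_tendstoD) auto
  then show "eventually (\<lambda>t. dist (T t f) 0 < e) at_top"
  proof (rule eventually_rev_mp, intro eventually_mono[OF eventually_gt_at_top[of "pi / n"]] impI)
    fix t assume t: "t > pi / n" "D * norm f / t < e / 2"
    have "pi / n > 0" using n by simp
    with t have t0: "t > 0" by linarith
    have "1 / n \<le> pi / n" using n pi_ge_two by (intro divide_right_mono) auto
    with t have "t \<ge> 1 / n" by linarith
    have "pi / t \<le> n" using t(1) n t0 by (simp add: pos_divide_le_eq pos_divide_less_eq mult.commute)
    then have "pi / t \<le> 2 * n" using n by simp
    from n(2)[OF \<open>t \<ge> 1 / n\<close>] D(2)[OF this t0, of f]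
    have "norm (T t f) \<le> e / 2 + D / t * norm f" by linarith
    also have "D / t * norm f = D * norm f / t" by simp
    finally have "norm (T t f) < e" using t(2) by linarith
    then show "dist (T t f) 0 < e" by simp
  qed
qed

end

subsection \<open>Poles of the resolvent\<close>

text \<open>Only the leading Laurent coefficient \<open>B\<close>, of order \<open>p\<close>, is
  recorded. The error bound is uniform in \<open>f\<close> because it is later used to bound
  resolvents near the pole on the kernel of \<open>B\<close>.\<close>

definition pole_at :: "(real \<Rightarrow> 'r::banach cplx \<Rightarrow> 'r cplx) \<Rightarrow> complex \<Rightarrow> nat \<Rightarrow> ('r cplx \<Rightarrow> 'r cplx) \<Rightarrow> bool" where
  "pole_at T \<mu> p B \<longleftrightarrow> p \<ge> 1 \<and> bounded_linear B \<and> (\<exists>f. B f \<noteq> 0) \<and>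
     (\<exists>C r. r > 0 \<and> (\<forall>z. 0 < cmod (z - \<mu>) \<and> cmod (z - \<mu>) < r \<longrightarrow> z \<in> rho T \<and>
        (\<forall>f. norm (cscale ((z - \<mu>) ^ p) (Res T z f) - B f) \<le> C * cmod (z - \<mu>) * norm f)))"

lemma pole_at_rescale:
  assumes "c0_semigroup T"
  shows "pole_at (rescale w T) \<mu> p B \<longleftrightarrow> pole_at T (\<mu> + w) p B"
proof -
  have shift: "(\<forall>z. Q (z + w)) \<longleftrightarrow> (\<forall>z. Q z)" for Q :: "complex \<Rightarrow> bool"
  proof
    assume *: "\<forall>z. Q (z + w)"
    show "\<forall>z. Q z" using *[rule_format, of "z - w" for z] by simp
  qed simp
  have "(\<forall>z. 0 < cmod (z - \<mu>) \<and> cmod (z - \<mu>) < r \<longrightarrow> z + w \<in> rho T \<and>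
        (\<forall>f. norm (cscale ((z - \<mu>) ^ p) (Res T (z + w) f) - B f) \<le> C * cmod (z - \<mu>) * norm f)) \<longleftrightarrow>
      (\<forall>z. 0 < cmod (z - (\<mu> + w)) \<and> cmod (z - (\<mu> + w)) < r \<longrightarrow> z \<in> rho T \<and>
        (\<forall>f. norm (cscale ((z - (\<mu> + w)) ^ p) (Res T z f) - B f) \<le> C * cmod (z - (\<mu> + w)) * norm f))" for r C
    by (subst (2) shift[symmetric]) (simp only: add_diff_cancel_right)
  then show ?thesis
    unfolding pole_at_def rho_rescale[OF assms] Res_rescale[OF assms] by (simp only:)
qed

context c0_semigroup
begin

text \<open>Rescaling by \<open>\<mu>\<close> turns eigenvectors into fixed vectors.\<close>

lemma gen_rel_eigen_iff: "gen_rel T f (cscale \<mu> f) \<longleftrightarrow> (\<forall>t\<ge>0. T t f = cscale (exp (\<mu> * of_real t)) f)"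
proof -
  have "gen_rel T f (cscale \<mu> f) \<longleftrightarrow> gen_rel (rescale \<mu> T) f 0"
    by (simp add: gen_rel_rescale[OF c0_semigroup_axioms])
  also have "\<dots> \<longleftrightarrow> (\<forall>t\<ge>0. rescale \<mu> T t f = f)" by (rule c0_semigroup.gen_rel_0_iff[OF c0_rescale])
  also have "\<dots> \<longleftrightarrow> (\<forall>t\<ge>0. T t f = cscale (exp (\<mu> * of_real t)) f)"
  proof -
    have "cscale (exp (- a)) x = f \<longleftrightarrow> x = cscale (exp a) f" for a x
      by (auto simp: mult_exp_exp)
    then have "rescale \<mu> T t f = f \<longleftrightarrow> T t f = cscale (exp (\<mu> * of_real t)) f" for t
      by (simp add: rescale_def)
    then show ?thesis by simp
  qed
  finally show ?thesis .
qed

lemma pole_nontrivial: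
  assumes "pole_at T \<mu> p B" obtains f where "B f \<noteq> 0"
  using assms by (auto simp: pole_at_def)

lemma pole_bounded_linear: "pole_at T \<mu> p B \<Longrightarrow> bounded_linear B"
  by (simp add: pole_at_def)

lemma pole_eventually:
  assumes "pole_at T \<mu> p B" shows "eventually (\<lambda>z. z \<in> rho T) (at \<mu>)"
proof -
  obtain r where r: "r > 0" "\<forall>z. 0 < cmod (z - \<mu>) \<and> cmod (z - \<mu>) < r \<longrightarrow> z \<in> rho T"
    using assms unfolding pole_at_def by blast
  then show ?thesis unfolding eventually_at dist_norm by (intro exI[of _ r]) simp
qed

lemma pole_tendsto:
  assumes "pole_at T \<mu> p B" shows "((\<lambda>z. cscale ((z - \<mu>) ^ p) (Res T z f)) \<longlongrightarrow> B f) (at \<mu>)"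
proof -
  obtain C r where r: "r > 0" "\<And>z. 0 < cmod (z - \<mu>) \<Longrightarrow> cmod (z - \<mu>) < r \<Longrightarrow>
      norm (cscale ((z - \<mu>) ^ p) (Res T z f) - B f) \<le> C * cmod (z - \<mu>) * norm f"
    using assms unfolding pole_at_def by blast
  have "((\<lambda>z. C * cmod (z - \<mu>) * norm f) \<longlongrightarrow> C * cmod (\<mu> - \<mu>) * norm f) (at \<mu>)"
    by (intro tendsto_intros)
  then have "((\<lambda>z. C * cmod (z - \<mu>) * norm f) \<longlongrightarrow> 0) (at \<mu>)" by simp
  moreover have "eventually (\<lambda>z. norm (cscale ((z - \<mu>) ^ p) (Res T z f) - B f) \<le> C * cmod (z - \<mu>) * norm f) (at \<mu>)"
    unfolding eventually_at dist_norm using r by (intro exI[of _ r]) simp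
  ultimately have "((\<lambda>z. cscale ((z - \<mu>) ^ p) (Res T z f) - B f) \<longlongrightarrow> 0) (at \<mu>)"
    by (rule Lim_null_comparison[rotated])
  then show ?thesis by (rule LIM_zero_cancel)
qed

lemma pole_map:
  assumes B: "pole_at T \<mu> p B" and P: "bounded_linear P" "\<And>t f. 0 \<le> t \<Longrightarrow> P (T t f) = T t (P f)"
    "\<And>c f. P (cscale c f) = cscale c (P f)"
  shows "P (B f) = B (P f)"
proof -
  have "((\<lambda>z. P (cscale ((z - \<mu>) ^ p) (Res T z f))) \<longlongrightarrow> P (B f)) (at \<mu>)"
    by (rule bounded_linear.tendsto[OF P(1) pole_tendsto[OF B]])
  moreover have "eventually (\<lambda>z. P (cscale ((z - \<mu>) ^ p) (Res T z f)) = cscale ((z - \<mu>) ^ p) (Res T z (P f))) (at \<mu>)"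
    using pole_eventually[OF B] by (rule eventually_mono) (simp add: P Res_map[OF _ P])
  ultimately have "((\<lambda>z. cscale ((z - \<mu>) ^ p) (Res T z (P f))) \<longlongrightarrow> P (B f)) (at \<mu>)"
    by (rule Lim_transform_eventually)
  from tendsto_unique[OF trivial_limit_at this pole_tendsto[OF B]] show ?thesis .
qed

lemma pole_T: "pole_at T \<mu> p B \<Longrightarrow> 0 \<le> t \<Longrightarrow> T t (B f) = B (T t f)"
  by (rule pole_map) (auto intro: lin T_commute T_cscale)

lemma pole_cscale: "pole_at T \<mu> p B \<Longrightarrow> B (cscale c f) = cscale c (B f)"
  by (rule pole_map[symmetric]) (auto simp: cscale.bounded_linear_right T_cscale mult.commute)

text \<open>Multiplied by \<open>(z - \<mu>) ^ p\<close>, the resolvent equation loses its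
  inhomogeneity in the limit, since \<open>p \<ge> 1\<close>; closedness of the generator leaves the
  eigenvalue equation.\<close>

lemma gen_rel_pole:
  assumes B: "pole_at T \<mu> p B" shows "gen_rel T (B f) (cscale \<mu> (B f))"
proof (rule gen_rel_closed[OF pole_tendsto[OF B]])
  have p: "p \<ge> 1" using B by (simp add: pole_at_def)
  have "((\<lambda>z. cscale z (cscale ((z - \<mu>) ^ p) (Res T z f)) - cscale ((z - \<mu>) ^ p) f) \<longlongrightarrow>
      cscale \<mu> (B f) - cscale ((\<mu> - \<mu>) ^ p) f) (at \<mu>)"
    by (intro tendsto_diff cscale.tendsto tendsto_intros pole_tendsto[OF B])
  then show "((\<lambda>z. cscale z (cscale ((z - \<mu>) ^ p) (Res T z f)) - cscale ((z - \<mu>) ^ p) f) \<longlongrightarrow>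
      cscale \<mu> (B f)) (at \<mu>)"
    using p by (simp add: power_0_left cscale.zero_left)
  show "eventually (\<lambda>z. gen_rel T (cscale ((z - \<mu>) ^ p) (Res T z f))
      (cscale z (cscale ((z - \<mu>) ^ p) (Res T z f)) - cscale ((z - \<mu>) ^ p) f)) (at \<mu>)"
    using pole_eventually[OF B]
  proof (rule eventually_mono)
    fix z assume "z \<in> rho T"
    from gen_rel_cscale[OF gen_rel_Res[OF this, of f], of "(z - \<mu>) ^ p"]
    show "gen_rel T (cscale ((z - \<mu>) ^ p) (Res T z f))
      (cscale z (cscale ((z - \<mu>) ^ p) (Res T z f)) - cscale ((z - \<mu>) ^ p) f)"
      by (simp add: cscale.diff_right mult.commute)
  qed
qed (rule trivial_limit_at)

lemma T_pole: "pole_at T \<mu> p B \<Longrightarrow> 0 \<le> t \<Longrightarrow> T t (B f) = cscale (exp (\<mu> * of_real t)) (B f)"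
  using gen_rel_pole gen_rel_eigen_iff by blast

text \<open>For a bounded semigroup the resolvent at real \<open>x > 0\<close> is bounded by
  \<open>2 * M / x\<close>, so \<open>x ^ p\<close> times it tends to 0 if \<open>p \<ge> 2\<close>,
  against the nonzero leading coefficient.\<close>

lemma pole_order_1:
  assumes B: "pole_at T 0 p B" and M: "\<And>t f. 0 \<le> t \<Longrightarrow> norm (T t f) \<le> M * norm f"
  shows "p = 1"
proof (rule ccontr)
  assume "p \<noteq> 1"
  then have p: "p \<ge> 2" using B by (simp add: pole_at_def)
  have "B f = 0" for f
  proof -
    have "((\<lambda>x::real. cscale ((of_real x - 0) ^ p) (Res T (of_real x) f)) \<longlongrightarrow> B f) (at_right 0)"
      by (rule filterlim_compose[OF pole_tendsto[OF B] filterlim_of_real_at_right])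
    moreover have "((\<lambda>x::real. cscale ((of_real x - 0) ^ p) (Res T (of_real x) f)) \<longlongrightarrow> 0) (at_right 0)"
    proof (rule Lim_null_comparison)
      show "((\<lambda>x::real. x ^ (p - 1) * (2 * M * norm f)) \<longlongrightarrow> 0) (at_right 0)"
        using p by (intro tendsto_mult_left_zero tendsto_eq_intros) (auto simp: power_0_left)
      show "eventually (\<lambda>x::real. norm (cscale ((of_real x - 0) ^ p) (Res T (of_real x) f)) \<le> x ^ (p - 1) * (2 * M * norm f)) (at_right 0)"
      proof (rule eventually_mono[OF eventually_at_right_less])
        fix x :: real assume x: "0 < x"
        have "norm (Res T (of_real x) f) \<le> 2 * M / (Re (of_real x) - 0) * norm f"
          using M x by (intro laplace_growth(3)[where w = 0]) auto
        then have "x ^ p * norm (Res T (of_real x) f) \<le> x ^ p * (2 * M / x * norm f)"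
          using x by (intro mult_left_mono) auto
        also have "\<dots> = x ^ (p - 1) * (2 * M * norm f)"
          using x p by (simp add: power_diff)
        finally show "norm (cscale ((of_real x - 0) ^ p) (Res T (of_real x) f)) \<le> x ^ (p - 1) * (2 * M * norm f)"
          using x by (simp flip: of_real_power)
      qed
    qed
    ultimately show ?thesis using tendsto_unique[OF trivial_limit_at_right_real] by blast
  qed
  then show False using pole_nontrivial[OF B] by metis
qed

lemma simple_pole_Res:
  assumes B: "pole_at T 0 p B" and z: "z \<in> rho T" "z \<noteq> 0"
  shows "Res T z (B f) = cscale (1 / z) (B f)"
proof -
  have "gen_rel T (B f) 0" using gen_rel_pole[OF B, of f] by (simp add: cscale.zero_left)
  from Res_gen_rel[OF z(1) this] have "cscale z (Res T z (B f)) = B f" using z by (simp add: Res_cscale)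
  then show ?thesis using z by (metis cscale_cscale cscale_one divide_inverse left_inverse mult_1)
qed

lemma simple_pole_projection:
  assumes B: "pole_at T 0 1 B"
  shows "B (B f) = B f" "0 \<le> t \<Longrightarrow> T t (B f) = B f" "0 \<le> t \<Longrightarrow> B (T t f) = B f"
proof -
  show *: "0 \<le> t \<Longrightarrow> T t (B f) = B f" using T_pole[OF B] by simp
  show "0 \<le> t \<Longrightarrow> B (T t f) = B f" using * pole_T[OF B] by simp
  have "eventually (\<lambda>z. cscale ((z - 0) ^ 1) (Res T z (B f)) = B f) (at 0)"
    using pole_eventually[OF B] eventually_neq_at_within
  proof (rule eventually_elim2)
    fix z assume "z \<in> rho T" "z \<noteq> 0"
    then show "cscale ((z - 0) ^ 1) (Res T z (B f)) = B f" by (simp add: simple_pole_Res[OF B])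
  qed
  then have "((\<lambda>z. cscale ((z - 0) ^ 1) (Res T z (B f))) \<longlongrightarrow> B f) (at 0)"
    by (rule tendsto_eventually)
  from tendsto_unique[OF trivial_limit_at pole_tendsto[OF B] this] show "B (B f) = B f" .
qed

text \<open>Adding \<open>(e\<^sup>-\<^sup>t - 1) P\<close>, where \<open>P\<close> is the residue, moves the eigenvalue \<open>0\<close> to \<open>-1\<close>, so that the
  stability theorem applies.\<close>

theorem dominant_simple_pole_converges:
  assumes B: "pole_at T 0 p P" and M: "\<And>t f. 0 \<le> t \<Longrightarrow> norm (T t f) \<le> M * norm f"
    and iR: "\<And>x. x \<noteq> 0 \<Longrightarrow> \<i> * of_real x \<in> rho T"
  shows "((\<lambda>t. T t f) \<longlongrightarrow> P f) at_top"
proof -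
  have P: "pole_at T 0 1 P" using B pole_order_1[OF B M] by simp
  note Pl = bounded_linear.linear[OF pole_bounded_linear[OF P]]
  define S where "S t f = T t f + (exp (- t) - 1) *\<^sub>R P f" for t f
  interpret S: c0_semigroup S
  proof (rule c0_semigroup.intro)
    show "bounded_linear (S t)" if "0 \<le> t" for t
      unfolding S_def
      using bounded_linear_add[OF lin[OF that]
          bounded_linear_compose[OF bounded_linear_scaleR_right pole_bounded_linear[OF P]]] .
    show "S t (cscale c f) = cscale c (S t f)" if "0 \<le> t" for t c f
      using that by (simp add: S_def T_cscale pole_cscale[OF P] cscale.add_right)
    show "S 0 f = f" for f by (simp add: S_def)
    show "S (s + t) f = S s (S t f)" if "0 \<le> s" "0 \<le> t" for s t f
    proof -
      define a where "a = exp (- t) - 1"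
      have 1: "T s (T t f + a *\<^sub>R P f) = T s (T t f) + a *\<^sub>R P f"
        using that by (simp add: T_add T_scaleR simple_pole_projection[OF P])
      have 2: "P (T t f + a *\<^sub>R P f) = P f + a *\<^sub>R P f"
        using that by (simp add: linear_add[OF Pl] linear_cmul[OF Pl] simple_pole_projection[OF P])
      \<comment> \<open>Multiplicativity of the exponential, written for the corrections
        \<open>exp (- t) - 1\<close>; it matches the cross terms on the range of
        \<open>P\<close>.\<close>
      have ex: "exp (- (s + t)) - 1 = a + (exp (- s) - 1) * (1 + a)"
        by (simp add: a_def algebra_simps flip: exp_add)
      have "(exp (- (s + t)) - 1) *\<^sub>R P f = a *\<^sub>R P f + (exp (- s) - 1) *\<^sub>R (P f + a *\<^sub>R P f)"
        unfolding ex by (simp only: scaleR_add_left scaleR_add_right scaleR_scaleR[symmetric] scaleR_one)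
      then have "S (s + t) f = T s (T t f) + a *\<^sub>R P f + (exp (- s) - 1) *\<^sub>R (P f + a *\<^sub>R P f)"
        using that by (simp only: S_def T_plus add.assoc)
      also have "\<dots> = S s (S t f)" by (simp only: S_def 1 2 flip: a_def)
      finally show ?thesis .
    qed
    have "((\<lambda>t. S t f) \<longlongrightarrow> f + (exp (- 0) - 1) *\<^sub>R P f) (at_right 0)" for f
      unfolding S_def by (intro tendsto_intros tendsto_at_0)
    then show "((\<lambda>t. S t f) \<longlongrightarrow> f) (at_right 0)" for f by simp
  qed
  \<comment> \<open>The generator of \<open>S\<close> is \<open>A - P\<close>, since the derivative
    of \<open>exp (- t) - 1\<close> at 0 is -1.\<close>
  have gen_rel_S: "gen_rel S f g \<longleftrightarrow> gen_rel T f (g + P f)" for f g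
  proof -
    have "((\<lambda>h. ((exp (- 1 * of_real h) - 1) / of_real h)) \<longlongrightarrow> (- 1 :: complex)) (at_right (0::real))"
      by (rule exp_minus_one_div_tendsto)
    then have "((\<lambda>h. Re ((exp (- 1 * of_real h) - 1) / of_real h)) \<longlongrightarrow> Re (- 1 :: complex)) (at_right (0::real))"
      by (rule tendsto_Re)
    moreover have "Re ((exp (- 1 * of_real h) - 1) / of_real h) = inverse h * (exp (- h) - 1)" for h :: real
      by (simp add: divide_inverse exp_of_real flip: of_real_minus of_real_inverse)
    ultimately have e: "((\<lambda>h. (inverse h * (exp (- h) - 1)) *\<^sub>R P f) \<longlongrightarrow> (- 1) *\<^sub>R P f) (at_right (0::real))"
      by (intro tendsto_scaleR tendsto_const) simp
    show ?thesis
    proof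
      assume "gen_rel S f g"
      from tendsto_diff[OF this[unfolded gen_rel_def] e] show "gen_rel T f (g + P f)"
        by (simp add: gen_rel_def S_def scaleR_add_right scaleR_diff_right algebra_simps)
    next
      assume "gen_rel T f (g + P f)"
      from tendsto_add[OF this[unfolded gen_rel_def] e] show "gen_rel S f g"
        by (simp add: gen_rel_def S_def scaleR_add_right scaleR_diff_right algebra_simps)
    qed
  qed
  have P_gen_rel: "P g = 0" if "gen_rel T f g" for f g
  proof -
    have "((\<lambda>h. P (inverse h *\<^sub>R (T h f - f))) \<longlongrightarrow> P g) (at_right 0)"
      using that unfolding gen_rel_def by (rule bounded_linear.tendsto[OF pole_bounded_linear[OF P]])
    moreover have "eventually (\<lambda>h. P (inverse h *\<^sub>R (T h f - f)) = 0) (at_right 0)"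
      by (rule eventually_mono[OF eventually_at_right_less])
         (simp add: linear_cmul[OF Pl] linear_diff[OF Pl] simple_pole_projection[OF P])
    ultimately have "((\<lambda>h. 0) \<longlongrightarrow> P g) (at_right (0::real))" by (rule Lim_transform_eventually)
    then show ?thesis by (simp add: tendsto_const_iff)
  qed
  \<comment> \<open>\<open>A - P\<close> acts as \<open>A\<close> on the kernel of \<open>P\<close>,
    and as -1 on the range of \<open>P\<close>, where \<open>A\<close> is 0; \<open>Q z\<close> is
    the resolvent assembled from both parts.\<close>
  define Q where "Q z f = Res T z (f - P f) + cscale (1 / (z + 1)) (P f)" for z f
  have Q: "res_op S z (Q z)" if z: "z \<in> rho T" "z \<noteq> 0" "z \<noteq> - 1" for z
    unfolding res_op_def
  proof (intro conjI allI impI)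
    show "bounded_linear (Q z)"
      unfolding Q_def
      by (intro bounded_linear_add bounded_linear_compose[OF Res_bounded_linear[OF z(1)]] bounded_linear_sub
          bounded_linear_ident pole_bounded_linear[OF P] bounded_linear_compose[OF cscale.bounded_linear_right])
    have z1: "z + 1 \<noteq> 0" using z(3) by (metis add.inverse_unique add.commute)
    have PQ: "P (Q z f) = cscale (1 / (z + 1)) (P f)" for f
      using Res_map[OF z(1) pole_bounded_linear[OF P], of "f - P f"] pole_T[OF P] z
      by (simp add: Q_def linear_add[OF Pl] linear_diff[OF Pl] pole_cscale[OF P] simple_pole_projection[OF P] Res_zero)
    fix f
    have "gen_rel T (Q z f) (cscale z (Res T z (f - P f)) - (f - P f) + cscale (1 / (z + 1)) 0)"
      unfolding Q_def
      by (intro gen_rel_add gen_rel_Res z gen_rel_cscale) (use gen_rel_pole[OF P, of f] in \<open>simp add: cscale.zero_left\<close>)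
    moreover have "cscale z (Res T z (f - P f)) - (f - P f) + cscale (1 / (z + 1)) 0 =
        cscale z (Q z f) - f + P (Q z f)"
    proof -
      have "cscale (z / (z + 1)) (P f) + cscale (1 / (z + 1)) (P f) = P f"
        using z1 by (simp flip: cscale.add_left add_divide_distrib)
      then show ?thesis
        unfolding PQ by (simp add: Q_def cscale.add_right cscale.zero_right)
    qed
    ultimately show "gen_rel S (Q z f) (cscale z (Q z f) - f)" by (simp add: gen_rel_S)
    fix g assume "gen_rel S f g"
    then have T: "gen_rel T f (g + P f)" by (simp add: gen_rel_S)
    have Pg: "P g = - P f"
      using P_gen_rel[OF T] by (simp add: linear_add[OF Pl] simple_pole_projection[OF P] eq_neg_iff_add_eq_0)
    have "Q z (cscale z f - g) = Res T z (cscale z f - (g + P f)) - cscale z (Res T z (P f))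
        + cscale (1 / (z + 1)) (cscale z (P f) + P f)"
      by (simp add: Q_def linear_diff[OF Pl] pole_cscale[OF P] Pg Res_diff Res_add z Res_cscale algebra_simps)
    also have "cscale (1 / (z + 1)) (cscale z (P f) + P f) = P f"
    proof -
      have "cscale z (P f) + P f = cscale (z + 1) (P f)" by (simp add: cscale.add_left)
      then show ?thesis using z1 by simp
    qed
    also have "Res T z (cscale z f - (g + P f)) - cscale z (Res T z (P f)) + P f = f"
      using Res_gen_rel[OF z(1) T] z by (simp add: simple_pole_Res[OF P])
    finally show "Q z (cscale z f - g) = f" .
  qed
  have rho_S: "\<i> * of_real x \<in> rho S" if "x \<noteq> 0" for x
    using Q[OF iR[OF that]] that by (auto simp: rho_def complex_eq_iff)
  \<comment> \<open>On the kernel of \<open>P\<close> the pole estimate bounds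
    \<open>Res T x\<close> uniformly as \<open>x\<close> tends to 0, since the singular term
    vanishes there. So \<open>Q x\<close> is bounded by \<open>L\<close>, and a small enough
    \<open>x\<close> has 0 within the radius that this bound allows.\<close>
  have "0 \<in> rho S"
  proof -
    obtain C r where r: "r > 0" "\<And>z f. 0 < cmod (z - 0) \<Longrightarrow> cmod (z - 0) < r \<Longrightarrow> z \<in> rho T"
      "\<And>z f. 0 < cmod (z - 0) \<Longrightarrow> cmod (z - 0) < r \<Longrightarrow>
      norm (cscale ((z - 0) ^ 1) (Res T z f) - P f) \<le> C * cmod (z - 0) * norm f"
      using P unfolding pole_at_def by blast
    obtain K where K: "K > 0" "\<And>f. norm (P f) \<le> norm f * K"
      using bounded_linear.pos_bounded[OF pole_bounded_linear[OF P]] by blast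
    define L where "L = 2 * \<bar>C\<bar> * (1 + K) + 4 * K + 1"
    have L: "L > 0" using K by (simp add: L_def add_nonneg_pos)
    define x where "x = Min {r / 2, 1 / 2, 1 / (4 * L)}"
    have x: "x > 0" "x \<le> r / 2" "x \<le> 1 / 2" "x \<le> 1 / (4 * L)"
      using r L by (auto simp: x_def)
    have zx: "of_real x \<in> rho T" "complex_of_real x \<noteq> 0" "complex_of_real x \<noteq> - 1"
      using r(2)[of "of_real x"] x r by (auto simp: complex_eq_iff)
    have Qx: "Res S (of_real x) = Q (of_real x)" by (rule S.Res_eqI[OF Q[OF zx]])
    have rS: "of_real x \<in> rho S" using Q[OF zx] by (auto simp: rho_def)
    have "norm (Q (of_real x) f) \<le> L * norm f" for f
    proof -
      define g where "g = f - P f"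
      have Pg: "P g = 0" by (simp add: g_def linear_diff[OF Pl] simple_pole_projection[OF P])
      have "x * norm (Res T (of_real x) g) \<le> C * x * norm g"
        using r(3)[of "of_real x" g] x r by (simp add: Pg)
      then have "norm (Res T (of_real x) g) \<le> C * norm g" using x by (simp add: mult.assoc mult.left_commute[of C])
      also have "\<dots> \<le> \<bar>C\<bar> * (norm f + norm f * K)"
        using norm_triangle_ineq4[of f "P f"] K(2)[of f] by (intro mult_mono) (auto simp: g_def)
      finally have 1: "norm (Res T (of_real x) g) \<le> \<bar>C\<bar> * (norm f + norm f * K)" .
      have "norm (cscale (1 / (of_real x + 1)) (P f)) \<le> 2 * cmod (1 / (of_real x + 1)) * norm (P f)"
        by (rule norm_cscale_le)
      also have "cmod (1 / (of_real x + 1)) \<le> 1"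
      proof -
        have "cmod (of_real x + 1) = x + 1" using x by (metis abs_of_nonneg add_nonneg_nonneg less_imp_le norm_of_real of_real_1 of_real_add zero_le_one)
        then show ?thesis using x by (simp add: norm_divide)
      qed
      then have "2 * cmod (1 / (of_real x + 1)) * norm (P f) \<le> 2 * 1 * (norm f * K)"
        by (intro mult_mono K) auto
      finally have 2: "norm (cscale (1 / (of_real x + 1)) (P f)) \<le> 2 * 1 * (norm f * K)" .
      have "norm (Q (of_real x) f) \<le> \<bar>C\<bar> * (norm f + norm f * K) + 2 * 1 * (norm f * K)"
        unfolding Q_def g_def[symmetric] using norm_triangle_mono[OF 1 2] .
      also have "\<dots> = (\<bar>C\<bar> * (1 + K) + 2 * K) * norm f" by (simp add: algebra_simps)
      also have "\<dots> \<le> L * norm f"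
        using K by (intro mult_right_mono) (auto simp: L_def)
      finally show ?thesis .
    qed
    then show ?thesis
      using x L by (intro S.rho_neighbour(1)[OF rS, of L]) (auto simp: Qx field_simps)
  qed
  with rho_S have iR_S: "\<i> * of_real x \<in> rho S" for x by (cases "x = 0") auto
  obtain K where K: "K > 0" "\<And>f. norm (P f) \<le> norm f * K"
    using bounded_linear.pos_bounded[OF pole_bounded_linear[OF P]] by blast
  have "norm (S t f) \<le> (M + K) * norm f" if t: "0 \<le> t" for t f
  proof -
    have "norm ((exp (- t) - 1) *\<^sub>R P f) \<le> 1 * (norm f * K)"
      unfolding norm_scaleR using t K by (intro mult_mono) auto
    from norm_triangle_mono[OF M[OF t] this] show ?thesis by (simp add: S_def algebra_simps)
  qed
  from S.bounded_imp_strongly_stable[OF this iR_S]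
  have "((\<lambda>t. S t f - exp (- t) *\<^sub>R P f + P f) \<longlongrightarrow> 0 - 0 *\<^sub>R P f + P f) at_top"
    by (intro tendsto_intros filterlim_compose[OF exp_at_bot filterlim_uminus_at_bot_at_top])
  then show ?thesis by (simp add: S_def algebra_simps)
qed

section \<open>The Riesz projection at a simple pole\<close>

lemma Res_has_vector_derivative:
  assumes g: "(g has_vector_derivative g') (at x within S)" and x: "g x \<in> rho T"
  shows "((\<lambda>x. Res T (g x) f) has_vector_derivative cscale (- g') (Res T (g x) (Res T (g x) f))) (at x within S)"
proof -
  define y where "y = Res T (g x) f"
  have "((\<lambda>z. Res T z f) has_derivative (\<lambda>h. cscale (- h) (Res T (g x) y))) (at (g x))"
    unfolding has_derivative_iff_norm
  proof
    show "bounded_linear (\<lambda>h. cscale (- h) (Res T (g x) y))"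
      by (intro bounded_linear_compose[OF cscale.bounded_linear_left] bounded_linear_minus bounded_linear_ident)
    have "continuous_on (rho T) (\<lambda>z. Res T z y)" by (intro continuous_Res continuous_intros)
    then have "isCont (\<lambda>z. Res T z y) (g x)" using x open_rho continuous_on_eq_continuous_at by blast
    then have "((\<lambda>z. Res T z y) \<longlongrightarrow> Res T (g x) y) (at (g x))" by (simp add: isCont_def)
    then have lim: "((\<lambda>z. 2 * norm (Res T z y - Res T (g x) y)) \<longlongrightarrow> 0) (at (g x))"
      by (intro tendsto_mult_right_zero tendsto_norm_zero LIM_zero)
    have "eventually (\<lambda>z. z \<in> rho T) (at (g x))"
      using x open_rho by (intro eventually_at_in_open') auto
    then have "eventually (\<lambda>z. norm (norm (Res T z f - Res T (g x) f - cscale (- (z - g x)) (Res T (g x) y)) / norm (z - g x))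
        \<le> 2 * norm (Res T z y - Res T (g x) y)) (at (g x))"
    proof (rule eventually_elim2[OF _ eventually_neq_at_within])
      fix z assume z: "z \<in> rho T" "z \<noteq> g x"
      have "Res T z f - Res T (g x) f - cscale (- (z - g x)) (Res T (g x) y)
          = cscale (g x - z) (Res T z y - Res T (g x) y)"
        using resolvent_identity[OF z(1) x, of f] by (simp add: y_def cscale.diff_right)
      then have "norm (Res T z f - Res T (g x) f - cscale (- (z - g x)) (Res T (g x) y))
          \<le> 2 * cmod (g x - z) * norm (Res T z y - Res T (g x) y)"
        using norm_cscale_le by metis
      then show "norm (norm (Res T z f - Res T (g x) f - cscale (- (z - g x)) (Res T (g x) y)) / norm (z - g x))
        \<le> 2 * norm (Res T z y - Res T (g x) y)"
        using z by (simp add: divide_le_eq norm_minus_commute[of "g x"] mult_ac)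
    qed
    then show "((\<lambda>z. norm (Res T z f - Res T (g x) f - cscale (- (z - g x)) (Res T (g x) y)) / norm (z - g x))
        \<longlongrightarrow> 0) (at (g x))"
      by (rule Lim_null_comparison[OF _ lim])
  qed
  then have "((\<lambda>z. Res T z f) has_derivative (\<lambda>h. cscale (- h) (Res T (g x) y))) (at (g x) within g ` S)"
    by (rule has_derivative_at_withinI)
  from diff_chain_within[OF g[unfolded has_vector_derivative_def] this]
  show ?thesis
    unfolding has_vector_derivative_def y_def
    by (simp add: o_def cscale.scaleR_left flip: scaleR_minus_right)
qed

text \<open>The integral does not depend on the radius, because its radial derivative integrates the
  angular derivative of a periodic function; as the radius shrinks, the simple pole leaves the
  residue. This reaches every circle whose closed disc has no spectrum besides
  \<open>\<mu>\<close>.\<close>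

lemma circle_integral_simple_pole:
  assumes P: "pole_at T \<mu> 1 P" and r0: "r0 > 0" and rho: "\<And>z. z \<noteq> \<mu> \<Longrightarrow> cmod (z - \<mu>) \<le> r0 \<Longrightarrow> z \<in> rho T"
  shows "integral {0..2*pi} (\<lambda>\<theta>. cscale (\<i> * of_real r0 * exp (\<i> * of_real \<theta>))
      (Res T (\<mu> + of_real r0 * exp (\<i> * of_real \<theta>)) f)) = cscale (2 * of_real pi * \<i>) (P f)"
proof -
  define e where "e \<theta> = exp (\<i> * of_real \<theta>)" for \<theta> :: real
  have e_norm: "cmod (e \<theta>) = 1" for \<theta> by (simp add: e_def)
  have e0: "e \<theta> \<noteq> 0" for \<theta> by (simp add: e_def)
  have e_deriv: "(e has_vector_derivative \<i> * e \<theta>) (at \<theta> within S)" for \<theta> S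
  proof -
    have "((\<lambda>z. exp (\<i> * z)) has_field_derivative \<i> * e \<theta>) (at (of_real \<theta>))"
      unfolding e_def by (auto intro!: derivative_eq_intros)
    from has_vector_derivative_real_field[OF this] show ?thesis by (simp add: e_def[abs_def])
  qed
  have e_cont: "continuous_on A e" for A
    unfolding e_def by (intro continuous_intros)
  have in_rho: "\<mu> + of_real r * e \<theta> \<in> rho T" if "0 < r" "r \<le> r0" for r \<theta>
    using that e0 by (intro rho) (auto simp: norm_mult e_norm)
  define h where "h r \<theta> = cscale (\<i> * of_real r * e \<theta>) (Res T (\<mu> + of_real r * e \<theta>) f)" for r \<theta>
  define h' where "h' r \<theta> = cscale (\<i> * e \<theta>) (Res T (\<mu> + of_real r * e \<theta>) f)
      + cscale (- (\<i> * of_real r * e \<theta> * e \<theta>)) (Res T (\<mu> + of_real r * e \<theta>) (Res T (\<mu> + of_real r * e \<theta>) f))" for r \<theta>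
  define J where "J r = integral (cbox 0 (2 * pi)) (h r)" for r
  have h_cont: "continuous_on A (h r)" if "0 < r" "r \<le> r0" for r A
    unfolding h_def by (intro cscale.continuous_on continuous_intros continuous_Res e_cont in_rho that)
  have J': "(J has_vector_derivative 0) (at r within {0<..r0})" if r: "r \<in> {0<..r0}" for r
  proof -
    have "(J has_vector_derivative integral (cbox 0 (2 * pi)) (h' r)) (at r within {0<..r0})"
      unfolding J_def
    proof (rule leibniz_rule_vector_derivative)
      fix r \<theta> assume r: "r \<in> {0<..r0}"
      have 1: "((\<lambda>r. \<mu> + of_real r * e \<theta>) has_vector_derivative e \<theta>) (at r within {0<..r0})"
        by (auto intro!: derivative_eq_intros simp: has_vector_derivative_def scaleR_conv_of_real)
      have 2: "((\<lambda>r. \<i> * of_real r * e \<theta>) has_vector_derivative \<i> * e \<theta>) (at r within {0<..r0})"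
        by (auto intro!: derivative_eq_intros simp: has_vector_derivative_def scaleR_conv_of_real)
      have "((\<lambda>r. h r \<theta>) has_vector_derivative
          cscale (\<i> * of_real r * e \<theta>) (cscale (- e \<theta>) (Res T (\<mu> + of_real r * e \<theta>) (Res T (\<mu> + of_real r * e \<theta>) f)))
          + cscale (\<i> * e \<theta>) (Res T (\<mu> + of_real r * e \<theta>) f)) (at r within {0<..r0})"
        unfolding h_def
        using r by (intro cscale.has_vector_derivative 2 Res_has_vector_derivative 1 in_rho) auto
      then show "((\<lambda>r. h r \<theta>) has_vector_derivative h' r \<theta>) (at r within {0<..r0})"
        by (simp add: h'_def add.commute)
    next
      fix r assume "r \<in> {0<..r0}"
      then show "h r integrable_on cbox 0 (2 * pi)" using h_cont by (intro integrable_continuous) auto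
    next
      show "continuous_on ({0<..r0} \<times> cbox 0 (2 * pi)) (\<lambda>(r, \<theta>). h' r \<theta>)"
        unfolding h'_def split_beta
        by (intro continuous_on_add cscale.continuous_on continuous_intros continuous_Res in_rho
            continuous_on_compose2[OF e_cont[of UNIV]]) auto
    qed (use r in auto)
    also have "integral (cbox 0 (2 * pi)) (h' r) = 0"
    proof -
      \<comment> \<open>\<open>h' r\<close> is the angular derivative of \<open>g\<close>, and
        \<open>g\<close> has period 2 pi.\<close>
      define g where "g \<theta> = cscale (e \<theta>) (Res T (\<mu> + of_real r * e \<theta>) f)" for \<theta>
      have "(h' r has_integral g (2 * pi) - g 0) {0..2 * pi}"
      proof (rule fundamental_theorem_of_calculus)
        fix \<theta>
        have 1: "((\<lambda>\<theta>. \<mu> + of_real r * e \<theta>) has_vector_derivative of_real r * (\<i> * e \<theta>)) (at \<theta> within {0..2*pi})"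
          using has_vector_derivative_add[OF has_vector_derivative_const[of \<mu>]
              has_vector_derivative_mult_right[OF e_deriv, of "of_real r"]] by simp
        have "(g has_vector_derivative
          cscale (e \<theta>) (cscale (- (of_real r * (\<i> * e \<theta>))) (Res T (\<mu> + of_real r * e \<theta>) (Res T (\<mu> + of_real r * e \<theta>) f)))
          + cscale (\<i> * e \<theta>) (Res T (\<mu> + of_real r * e \<theta>) f)) (at \<theta> within {0..2*pi})"
          unfolding g_def
          using r by (intro cscale.has_vector_derivative e_deriv Res_has_vector_derivative 1 in_rho) auto
        then show "(g has_vector_derivative h' r \<theta>) (at \<theta> within {0..2*pi})"
          by (simp add: h'_def add.commute mult_ac)
      qed simp
      moreover have "e (2 * pi) = e 0" by (simp add: e_def exp_two_pi_i' mult.commute)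
      ultimately show ?thesis by (simp add: g_def integral_unique)
    qed
    finally show ?thesis .
  qed
  have "\<exists>c. \<forall>r\<in>{0<..r0}. J r = c"
  proof (rule has_derivative_zero_constant)
    show "(J has_derivative (\<lambda>h. 0)) (at r within {0<..r0})" if "r \<in> {0<..r0}" for r
      using J'[OF that] by (simp add: has_vector_derivative_def)
  qed simp
  then obtain c where c: "\<And>r. r \<in> {0<..r0} \<Longrightarrow> J r = c" by blast
  obtain C r1 where r1: "r1 > 0" "\<And>z f. 0 < cmod (z - \<mu>) \<Longrightarrow> cmod (z - \<mu>) < r1 \<Longrightarrow>
      norm (cscale ((z - \<mu>) ^ 1) (Res T z f) - P f) \<le> C * cmod (z - \<mu>) * norm f"
    using P unfolding pole_at_def by blast
  have "(J \<longlongrightarrow> cscale (2 * of_real pi * \<i>) (P f)) (at_right 0)"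
  proof (rule LIM_zero_cancel, rule Lim_null_comparison)
    show "((\<lambda>r. 2 * (C * r * norm f) * (2 * pi - 0)) \<longlongrightarrow> 0) (at_right (0::real))"
      by (auto intro!: tendsto_eq_intros)
    have "eventually (\<lambda>r. r < min r0 r1) (at_right 0)" using r0 r1
      by (intro order_tendstoD(2)[OF tendsto_ident_at]) auto
    then show "eventually (\<lambda>r. norm (J r - cscale (2 * of_real pi * \<i>) (P f)) \<le> 2 * (C * r * norm f) * (2 * pi - 0)) (at_right 0)"
    proof (rule eventually_elim2[OF _ eventually_at_right_less])
      fix r assume r: "r < min r0 r1" "0 < r"
      have "((\<lambda>\<theta>. cscale \<i> (P f)) has_integral (2 * pi) *\<^sub>R cscale \<i> (P f)) {0..2*pi}"
        using has_integral_const_real[of "cscale \<i> (P f)" 0 "2 * pi"] by simp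
      moreover have "(h r has_integral J r) {0..2*pi}"
        unfolding J_def box_real using r
        by (intro integrable_integral integrable_continuous_interval h_cont) auto
      ultimately have "((\<lambda>\<theta>. h r \<theta> - cscale \<i> (P f)) has_integral J r - (2 * pi) *\<^sub>R cscale \<i> (P f)) {0..2*pi}"
        by (intro has_integral_diff)
      also have "(2 * pi) *\<^sub>R cscale \<i> (P f) = cscale (2 * of_real pi * \<i>) (P f)"
        by (simp flip: cscale_of_real)
      finally have I: "integral {0..2*pi} (\<lambda>\<theta>. h r \<theta> - cscale \<i> (P f)) = J r - cscale (2 * of_real pi * \<i>) (P f)"
        by (rule integral_unique)
      have "norm (h r \<theta> - cscale \<i> (P f)) \<le> 2 * (C * r * norm f)" for \<theta>
      proof -
        have "h r \<theta> - cscale \<i> (P f) = cscale \<i> (cscale (of_real r * e \<theta>) (Res T (\<mu> + of_real r * e \<theta>) f) - P f)"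
          by (simp add: h_def cscale.diff_right mult.assoc)
        also have "norm \<dots> \<le> 2 * cmod \<i> * norm (cscale (of_real r * e \<theta>) (Res T (\<mu> + of_real r * e \<theta>) f) - P f)"
          by (rule norm_cscale_le)
        also have "\<dots> \<le> 2 * cmod \<i> * (C * r * norm f)"
          using r1(2)[of "\<mu> + of_real r * e \<theta>" f] r e0 by (intro mult_left_mono) (auto simp: norm_mult e_norm)
        finally show ?thesis by simp
      qed
      then show "norm (J r - cscale (2 * of_real pi * \<i>) (P f)) \<le> 2 * (C * r * norm f) * (2 * pi - 0)"
        unfolding I[symmetric] using r h_cont[of r]
        by (intro integral_bound continuous_on_diff continuous_on_const) auto
    qed
  qed
  moreover have "eventually (\<lambda>r. J r = c) (at_right 0)"
  proof -
    have "eventually (\<lambda>r. r < r0) (at_right 0)" using r0 by (intro order_tendstoD(2)[OF tendsto_ident_at]) auto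
    then show ?thesis by (rule eventually_elim2[OF _ eventually_at_right_less]) (auto intro: c)
  qed
  ultimately have "((\<lambda>r. c) \<longlongrightarrow> cscale (2 * of_real pi * \<i>) (P f)) (at_right (0::real))"
    by (rule Lim_transform_eventually)
  then have "c = cscale (2 * of_real pi * \<i>) (P f)" by (simp add: tendsto_const_iff)
  then show ?thesis using c[of r0] r0 by (simp add: J_def h_def[abs_def] e_def)
qed

end

subsection \<open>Eventually positive semigroups\<close>

text \<open>Riemann sums have nonnegative weights and stay in the cone; the integral is a limit of
  them.\<close>

lemma has_integral_mem_cone:
  fixes f :: "real \<Rightarrow> 'a::real_normed_vector"
  assumes C: "closed C" "0 \<in> C" "\<And>x y. x \<in> C \<Longrightarrow> y \<in> C \<Longrightarrow> x + y \<in> C" "\<And>c x. 0 \<le> c \<Longrightarrow> x \<in> C \<Longrightarrow> c *\<^sub>R x \<in> C"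
    and f: "(f has_integral y) {a..b}" "\<And>x. x \<in> {a..b} \<Longrightarrow> f x \<in> C"
  shows "y \<in> C"
proof -
  have "\<exists>z\<in>C. dist z y < e" if e: "e > 0" for e
  proof -
    from f(1)[unfolded has_integral_real, rule_format, OF e] obtain \<gamma> where \<gamma>: "gauge \<gamma>"
      "\<forall>\<D>. \<D> tagged_division_of {a..b} \<and> \<gamma> fine \<D> \<longrightarrow>
        norm (sum (\<lambda>(x, k). measure lborel k *\<^sub>R f x) \<D> - y) < e" by (elim exE conjE)
    obtain \<D> where \<D>: "\<D> tagged_division_of {a..b}" "\<gamma> fine \<D>"
      by (rule fine_division_exists_real[OF \<gamma>(1)])
    have mem: "measure lborel (snd p) *\<^sub>R f (fst p) \<in> C" if "p \<in> \<D>" for p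
      using tagged_division_ofD(2,3)[OF \<D>(1), of "fst p" "snd p"] that
      by (intro C(4) f(2)) auto
    have "(\<Sum>p\<in>A. measure lborel (snd p) *\<^sub>R f (fst p)) \<in> C" if "finite A" "A \<subseteq> \<D>" for A
      using that by (induction A rule: finite_induct) (auto intro!: C mem)
    from this[OF tagged_division_ofD(1)[OF \<D>(1)] subset_refl]
    show ?thesis using \<gamma>(2)[rule_format, of \<D>] \<D> by (auto simp: dist_norm case_prod_beta)
  qed
  then have "y \<in> closure C" unfolding closure_approachable by blast
  then show ?thesis using C(1) by simp
qed

lemma cpos_iff: "f \<in> cpos \<longleftrightarrow> 0 \<le> fst f \<and> snd f = 0"
  by (cases f) (auto simp: cpos_def)

lemma cpos_Pair [simp]: "(x, y) \<in> cpos \<longleftrightarrow> 0 \<le> x \<and> y = 0"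
  by (simp add: cpos_iff)

lemma cpos_0 [simp]: "(0 :: 'r::{ordered_real_vector,lattice} cplx) \<in> cpos"
  by (simp add: cpos_iff)

lemma cpos_add: "f \<in> cpos \<Longrightarrow> g \<in> cpos \<Longrightarrow> f + g \<in> (cpos :: 'r::ordered_real_vector cplx set)"
  by (simp add: cpos_iff)

lemma cpos_scaleR: "0 \<le> c \<Longrightarrow> f \<in> cpos \<Longrightarrow> c *\<^sub>R f \<in> (cpos :: 'r::ordered_real_vector cplx set)"
  by (simp add: cpos_iff scaleR_nonneg_nonneg)

lemma cpos_antisym: "f \<in> cpos \<Longrightarrow> - f \<in> cpos \<Longrightarrow> f = (0 :: 'r::ordered_real_vector cplx)"
  by (auto simp: cpos_iff prod_eq_iff)

text \<open>Real vectors are differences of positive ones,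
  \<open>x = lat_abs x - (lat_abs x - x)\<close>, and real vectors generate the rest with the help
  of \<open>\<i>\<close>. Convergence and boundedness of single orbits thus need proof on
  \<open>cpos\<close> only.\<close>

lemma cplx_induct_cpos:
  fixes f :: "'r::{ordered_real_vector,lattice} cplx"
  assumes pos: "\<And>f. f \<in> cpos \<Longrightarrow> P f" and diff: "\<And>f g. P f \<Longrightarrow> P g \<Longrightarrow> P (f - g)"
    and i: "\<And>f. P f \<Longrightarrow> P (cscale \<i> f)"
  shows "P f"
proof -
  have real: "P (x, 0)" for x
  proof -
    have "P ((lat_abs x, 0) - (lat_abs x - x, 0))"
      by (intro diff pos) (simp_all add: lat_abs_nonneg le_lat_abs)
    then show ?thesis by simp
  qed
  have "P ((fst f, 0) - cscale \<i> (- snd f, 0))" by (intro diff i real)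
  then show ?thesis by (simp add: cscale_def)
qed

lemma (in banach_lattice) closed_cpos: "closed (cpos :: 'r cplx set)"
proof -
  have "cpos = fst -` {x :: 'r. 0 \<le> x} \<inter> {f :: 'r cplx. snd f = 0}" by (auto simp: cpos_iff)
  moreover have "closed (fst -` {x :: 'r. 0 \<le> x} \<inter> {f :: 'r cplx. snd f = 0})"
    by (intro closed_Int closed_vimage closed_nonneg closed_Collect_eq continuous_intros)
  ultimately show ?thesis by (simp only:)
qed

section \<open>Vectors with positive orbits\<close>

locale lattice_semigroup = banach_lattice R + c0_semigroup T
  for R :: "'r::{banach,ordered_real_vector,lattice} itself" and T :: "real \<Rightarrow> 'r cplx \<Rightarrow> 'r cplx"
begin

text \<open>Unlike \<open>cpos\<close> in general, this set is mapped into itself by every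
  \<open>T t\<close>, so Laplace integrals of its elements are positive with no waiting
  time.\<close>

definition orbit_cone :: "'r cplx set" where
  "orbit_cone = {f. \<forall>t\<ge>0. T t f \<in> cpos}"

lemma orbit_cone_cpos: "f \<in> orbit_cone \<Longrightarrow> f \<in> cpos"
  unfolding orbit_cone_def by (metis (mono_tags, lifting) T_at_0 mem_Collect_eq order_refl)

lemma orbit_cone_add: "f \<in> orbit_cone \<Longrightarrow> g \<in> orbit_cone \<Longrightarrow> f + g \<in> orbit_cone"
  by (simp add: orbit_cone_def T_add cpos_add)

lemma orbit_cone_scaleR: "0 \<le> c \<Longrightarrow> f \<in> orbit_cone \<Longrightarrow> c *\<^sub>R f \<in> orbit_cone"
  by (simp add: orbit_cone_def T_scaleR cpos_scaleR)

lemma orbit_cone_0: "0 \<in> orbit_cone"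
  by (simp add: orbit_cone_def T_zero)

lemma orbit_cone_T: "f \<in> orbit_cone \<Longrightarrow> 0 \<le> t \<Longrightarrow> T t f \<in> orbit_cone"
  by (auto simp: orbit_cone_def simp flip: T_plus)

lemma closed_orbit_cone: "closed orbit_cone"
proof -
  have "orbit_cone = (\<Inter>t\<in>{0..}. T t -` cpos)" by (auto simp: orbit_cone_def)
  moreover have "closed (T t -` cpos)" if "t \<in> {0..}" for t
    using that by (intro closed_vimage closed_cpos linear_continuous_on lin) auto
  ultimately show ?thesis by auto
qed

lemma rescale_of_real: "rescale (of_real x) T t f = exp (- (x * t)) *\<^sub>R T t f"
  by (simp add: rescale_def exp_of_real flip: of_real_mult of_real_minus)

lemma lap_cpos:
  assumes "f \<in> orbit_cone" "0 \<le> N" "N \<le> N'"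
  shows "integral {N..N'} (\<lambda>t. rescale (of_real x) T t f) \<in> cpos"
proof (rule has_integral_mem_cone[OF closed_cpos cpos_0 cpos_add cpos_scaleR])
  show "((\<lambda>t. rescale (of_real x) T t f) has_integral integral {N..N'} (\<lambda>t. rescale (of_real x) T t f)) {N..N'}"
    using assms by (intro integrable_integral c0_semigroup.integrable_T[OF c0_rescale])
  show "rescale (of_real x) T t f \<in> cpos" if "t \<in> {N..N'}" for t
    using that assms by (auto simp: rescale_of_real orbit_cone_def intro!: cpos_scaleR)
qed

lemma T_lap:
  assumes t: "0 \<le> t" shows "T t (lap z N f) = lap z N (T t f)"
proof (rule c0_semigroup.L_map[OF c0_rescale, unfolded L_rescale, OF lin[OF t]])
  show "T t (rescale z T s g) = rescale z T s (T t g)" if "0 \<le> s" for s g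
    using t that by (simp add: rescale_def T_cscale T_commute)
qed

lemma lap_orbit_cone:
  assumes "f \<in> orbit_cone" "0 \<le> N" shows "lap (of_real x) N f \<in> orbit_cone"
  unfolding orbit_cone_def
proof (intro CollectI allI impI)
  fix t :: real assume t: "0 \<le> t"
  show "T t (lap (of_real x) N f) \<in> cpos"
    unfolding T_lap[OF t] unfolding lap_def using t assms by (intro lap_cpos orbit_cone_T) auto
qed

definition Res_positive :: "real \<Rightarrow> bool" where
  "Res_positive x \<longleftrightarrow> of_real x \<in> rho T \<and> (\<forall>f\<in>orbit_cone. Res T (of_real x) f \<in> orbit_cone)"

lemma Res_positive_large: obtains w where "\<And>x. x > w \<Longrightarrow> Res_positive x"
proof -
  obtain M w where M: "M \<ge> 1" "w \<ge> 0" "\<And>t f. 0 \<le> t \<Longrightarrow> norm (T t f) \<le> M * exp (w * t) * norm f"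
    using exponential_growth by metis
  have "Res_positive x" if x: "x > w" for x
    unfolding Res_positive_def
  proof (intro conjI ballI)
    show "of_real x \<in> rho T" using x by (intro laplace_growth(1)[OF M(3)]) auto
    fix f assume f: "f \<in> orbit_cone"
    have "((\<lambda>N. lap (of_real x) N f) \<longlongrightarrow> Res T (of_real x) f) at_top"
      using x by (intro laplace_growth(2)[OF M(3)]) auto
    moreover have "eventually (\<lambda>N. lap (of_real x) N f \<in> orbit_cone) at_top"
      by (rule eventually_mono[OF eventually_ge_at_top[of 0]]) (rule lap_orbit_cone[OF f])
    ultimately show "Res T (of_real x) f \<in> orbit_cone"
      by (intro Lim_in_closed_set[OF closed_orbit_cone _ trivial_limit_at_top_linorder])
  qed
  then show thesis by (rule that)
qed

text \<open>For \<open>x \<le> y\<close> the fixed point map has the nonnegative factor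
  \<open>y - x\<close>, so it maps the closed cone into itself; its unique fixed point lies there
  and equals the resolvent at \<open>x\<close>.\<close>

lemma Res_positive_step:
  assumes y: "Res_positive y" and K: "\<And>f. norm (Res T (of_real y) f) \<le> K * norm f"
    and xy: "x \<le> y" "4 * K * (y - x) \<le> 1"
  shows "Res_positive x"
  unfolding Res_positive_def
proof (intro conjI ballI)
  have yr: "of_real y \<in> rho T" using y by (simp add: Res_positive_def)
  have cm: "cmod (of_real x - of_real y) = y - x" using xy by (simp flip: of_real_diff)
  show xr: "of_real x \<in> rho T"
    by (rule rho_neighbour(1)[OF yr K]) (use xy cm in simp)
  fix f assume f: "f \<in> orbit_cone"
  define F where "F h = Res T (of_real y) (f + (y - x) *\<^sub>R h)" for h
  have lip: "dist (F g) (F h) \<le> (1/2) * dist g h" for g h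
  proof -
    have "dist (F g) (F h) = norm (Res T (of_real y) ((y - x) *\<^sub>R (g - h)))"
      unfolding dist_norm F_def Res_diff[OF yr, symmetric] by (simp add: algebra_simps)
    also have "\<dots> \<le> K * norm ((y - x) *\<^sub>R (g - h))" by (rule K)
    also have "\<dots> = (K * (y - x)) * dist g h" using xy by (simp add: dist_norm)
    also have "\<dots> \<le> (1/2) * dist g h" using xy by (intro mult_right_mono) auto
    finally show ?thesis .
  qed
  have "\<exists>!h\<in>orbit_cone. F h = h"
  proof (rule Banach_fix[of _ "1/2"])
    show "complete orbit_cone" by (simp add: complete_eq_closed closed_orbit_cone)
    show "orbit_cone \<noteq> {}" using orbit_cone_0 by blast
    show "F ` orbit_cone \<subseteq> orbit_cone"
    proof (rule image_subsetI)
      fix h assume "h \<in> orbit_cone"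
      then have "f + (y - x) *\<^sub>R h \<in> orbit_cone"
        using f xy by (intro orbit_cone_add orbit_cone_scaleR) auto
      then show "F h \<in> orbit_cone" using y unfolding F_def Res_positive_def by blast
    qed
  qed (use lip in auto)
  then obtain h where h: "h \<in> orbit_cone" "F h = h" by blast
  have "F (Res T (of_real x) f) = Res T (of_real x) f"
    using Res_neighbour_fix[OF yr xr, of f] by (simp add: F_def flip: of_real_diff)
  with lip[of h "Res T (of_real x) f"] h have "dist h (Res T (of_real x) f) \<le> (1/2) * dist h (Res T (of_real x) f)"
    by simp
  then have "dist h (Res T (of_real x) f) \<le> 0" by linarith
  then have "h = Res T (of_real x) f" by simp
  with h show "Res T (of_real x) f \<in> orbit_cone" by simp
qed

text \<open>On a compact segment the resolvents have a common bound \<open>K\<close>, so steps of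
  the fixed length \<open>1 / (4 * K)\<close> descend from a point far to the right to
  \<open>x\<close> in finitely many rounds.\<close>

lemma Res_positive_above:
  assumes rho: "\<And>x. x > a \<Longrightarrow> complex_of_real x \<in> rho T" and x: "x > a"
  shows "Res_positive x"
proof -
  obtain w where w: "\<And>x. x > w \<Longrightarrow> Res_positive x" by (rule Res_positive_large) blast
  define b where "b = max x (w + 1)"
  have "compact (complex_of_real ` {x..b})" by (intro compact_continuous_image continuous_intros compact_Icc)
  moreover have "complex_of_real ` {x..b} \<subseteq> rho T" using rho x by auto
  ultimately obtain K where K: "K > 0" "\<And>z f. z \<in> complex_of_real ` {x..b} \<Longrightarrow> norm (Res T z f) \<le> K * norm f"
    by (rule Res_bounded_on_compact) blast
  have "Res_positive y" if "y \<in> {x..b}" "b - y \<le> real k / (4 * K)" for k y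
    using that
  proof (induction k arbitrary: y)
    case 0
    then have "y = b" by auto
    then show ?case using w[of b] by (simp add: b_def)
  next
    case (Suc k)
    define d where "d = 1 / (4 * K)"
    have d: "d > 0" using K(1) by (simp add: d_def)
    \<comment> \<open>The point one step to the right of \<open>y\<close>, capped at
      \<open>b\<close>, where the descent starts.\<close>
    define y' where "y' = min b (y + d)"
    have y': "y' \<in> {x..b}" "y \<le> y'" "y' - y \<le> 1 / (4 * K)"
      using Suc.prems(1) d by (auto simp: y'_def min_def simp flip: d_def)
    have "b - y' \<le> real k / (4 * K)"
    proof (cases "b \<le> y + d")
      case True
      then show ?thesis using K(1) by (simp add: y'_def)
    next
      case False
      have "b - y \<le> real k / (4 * K) + d"
        using Suc.prems(2) by (simp add: d_def add_divide_distrib)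
      then show ?thesis using False by (simp add: y'_def)
    qed
    then have "Res_positive y'" using y' by (intro Suc.IH)
    then show ?case
      by (rule Res_positive_step[where K = K]) (use y' K in \<open>auto simp: field_simps\<close>)
  qed
  moreover obtain k :: nat where "(b - x) * (4 * K) \<le> real k" using real_arch_simple by blast
  then have "b - x \<le> real k / (4 * K)" using K by (simp add: field_simps)
  ultimately show ?thesis by (simp add: b_def)
qed

text \<open>The missing tail is a positive factor times the resolvent of \<open>T N f\<close>, which
  again has a positive orbit.\<close>

lemma lap_le_Res:
  assumes x: "Res_positive x" and f: "f \<in> orbit_cone" and N: "0 \<le> N"
  shows "Res T (of_real x) f - lap (of_real x) N f \<in> cpos"
proof -
  have xr: "of_real x \<in> rho T" using x by (simp add: Res_positive_def)
  have "Res T (of_real x) f - lap (of_real x) N f = exp (- (x * N)) *\<^sub>R Res T (of_real x) (T N f)"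
    unfolding Res_lap[OF xr N, symmetric] by (simp add: Res_diff xr rescale_of_real Res_scaleR)
  also have "\<dots> \<in> cpos"
    using x orbit_cone_T[OF f N] by (intro cpos_scaleR orbit_cone_cpos) (auto simp: Res_positive_def)
  finally show ?thesis .
qed

text \<open>On \<open>{N..N'}\<close> the exponential at \<open>z\<close> is at most
  \<open>exp (- (Re z - x) * N)\<close> times the one at \<open>x\<close>, whose integral stays
  below the positive resolvent at \<open>x\<close>. Thus convergence can reach beyond the half-plane
  given by a growth bound.\<close>

lemma laplace_block_bound:
  assumes x: "Res_positive x" and f: "f \<in> orbit_cone" and z: "Re z > x" and N: "0 \<le> N" "N \<le> N'"
  shows "norm (lap z N' f - lap z N f) \<le> 2 * exp (- (Re z - x) * N) * norm (Res T (of_real x) f)"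
proof -
  define X where "X = integral {N..N'} (\<lambda>t. rescale (of_real x) T t f)"
  define Y where "Y = integral {N..N'} (\<lambda>t. rescale z T t f)"
  define e where "e = exp (- (Re z - x) * N)"
  have int: "(\<lambda>t. rescale w T t f) integrable_on {N..N'}" for w
    using N by (intro c0_semigroup.integrable_T[OF c0_rescale])
  have Y: "lap z N' f - lap z N f = Y"
    using c0_semigroup.L_diff[OF c0_rescale N, of z f] by (simp add: L_rescale Y_def)
  have X: "X = lap (of_real x) N' f - lap (of_real x) N f"
    using c0_semigroup.L_diff[OF c0_rescale N, of "of_real x" f] by (simp add: L_rescale X_def)
  have X_pos: "X \<in> cpos" unfolding X_def using f N by (rule lap_cpos)
  have "Res T (of_real x) f - X = (Res T (of_real x) f - lap (of_real x) N' f) + lap (of_real x) N f"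
    by (simp add: X)
  also have "\<dots> \<in> cpos"
    using N by (intro cpos_add[OF lap_le_Res[OF x f] orbit_cone_cpos[OF lap_orbit_cone[OF f]]]) auto
  finally have "fst X \<le> fst (Res T (of_real x) f)" by (simp add: cpos_iff)
  then have nX: "norm (fst X) \<le> norm (fst (Res T (of_real x) f))"
    using X_pos by (intro norm_mono_dominated) (auto simp: cpos_iff intro: order_trans[of _ 0])
  \<comment> \<open>The order compares real vectors, so the complex block is tested by rotations:
    \<open>d = 1, - 1\<close> bound its real part, \<open>d = - \<i>, \<i>\<close> its imaginary
    part.\<close>
  have dom: "fst (cscale d Y) \<le> e *\<^sub>R fst X" if d: "cmod d \<le> 1" for d
  proof -
    have I: "((\<lambda>t. e *\<^sub>R rescale (of_real x) T t f - cscale d (rescale z T t f)) has_integral e *\<^sub>R X - cscale d Y) {N..N'}"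
      unfolding X_def Y_def
      by (intro has_integral_diff has_integral_cmul integrable_integral int
          has_integral_linear[OF integrable_integral[OF int] cscale.bounded_linear_right, unfolded o_def])
    have "e *\<^sub>R X - cscale d Y \<in> {g. 0 \<le> fst g}"
    proof (rule has_integral_mem_cone[OF _ _ _ _ I])
      show "closed {g :: 'r cplx. 0 \<le> fst g}"
        using closed_vimage[OF closed_nonneg, of fst] by (simp add: vimage_def continuous_on_fst continuous_on_id)
      fix t assume t: "t \<in> {N..N'}"
      then have "T t f \<in> cpos" using f N by (auto simp: orbit_cone_def)
      then obtain q where q: "T t f = (q, 0)" "0 \<le> q" by (cases "T t f") (auto simp: cpos_iff)
      have "Re (d * exp (- (z * of_real t))) \<le> cmod (d * exp (- (z * of_real t)))"
        by (rule complex_Re_le_cmod)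
      also have "\<dots> \<le> 1 * exp (- (Re z * t))"
        unfolding norm_mult using d by (intro mult_mono) (auto simp: norm_exp_eq_Re)
      also have "\<dots> \<le> e * exp (- (x * t))"
      proof -
        have "(Re z - x) * N \<le> (Re z - x) * t" using z t by (intro mult_left_mono) auto
        then show ?thesis by (simp add: e_def algebra_simps flip: exp_add)
      qed
      finally have "Re (d * exp (- (z * of_real t))) *\<^sub>R q \<le> (e * exp (- (x * t))) *\<^sub>R q"
        using q by (intro scaleR_right_mono)
      moreover have "cscale d (rescale z T t f) = cscale (d * exp (- (z * of_real t))) (q, 0)"
        by (simp add: rescale_def q)
      ultimately show "e *\<^sub>R rescale (of_real x) T t f - cscale d (rescale z T t f) \<in> {g. 0 \<le> fst g}"
        by (simp add: rescale_of_real q cscale_def)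
    qed (auto intro: scaleR_nonneg_nonneg)
    then show ?thesis by simp
  qed
  have "norm (fst Y) \<le> norm (e *\<^sub>R fst X)"
    using dom[of 1] dom[of "- 1"] by (intro norm_mono_dominated) (simp_all add: cscale_def)
  moreover have "norm (snd Y) \<le> norm (e *\<^sub>R fst X)"
    using dom[of "- \<i>"] dom[of \<i>] by (intro norm_mono_dominated) (simp_all add: cscale_def)
  moreover have "norm (e *\<^sub>R fst X) \<le> e * norm (Res T (of_real x) f)"
    using nX norm_fst_le[of "fst (Res T (of_real x) f)" "snd (Res T (of_real x) f)"]
    by (simp add: e_def)
  moreover have "norm Y \<le> norm (fst Y) + norm (snd Y)" by (metis norm_Pair_le prod.collapse)
  ultimately have "norm Y \<le> 2 * (e * norm (Res T (of_real x) f))" by linarith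
  then show ?thesis by (simp add: Y e_def mult.assoc)
qed

section \<open>Half-planes of convergence and positive leading coefficients\<close>

definition eventually_positive :: bool where
  "eventually_positive \<longleftrightarrow> (\<forall>f\<in>cpos. \<exists>t0\<ge>0. \<forall>t\<ge>t0. T t f \<in> cpos)"

lemma eventually_positiveE:
  assumes eventually_positive "f \<in> cpos" obtains t0 where "t0 \<ge> 0" "T t0 f \<in> orbit_cone"
proof -
  obtain t0 where t0: "t0 \<ge> 0" "\<And>t. t \<ge> t0 \<Longrightarrow> T t f \<in> cpos"
    using assms unfolding eventually_positive_def by blast
  have "T t0 f \<in> orbit_cone"
    unfolding orbit_cone_def using t0(2)[of "_ + t0"] t0(1) by (auto simp: T_plus)
  with t0 show thesis using that by blast
qed

lemma laplace_converges_cone: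
  assumes rho: "\<And>x. x > a \<Longrightarrow> complex_of_real x \<in> rho T" and z: "Re z > a" and f: "f \<in> orbit_cone"
  obtains l where "((\<lambda>N. lap z N f) \<longlongrightarrow> l) at_top"
proof -
  \<comment> \<open>A real point strictly between \<open>a\<close> and \<open>Re z\<close> leaves
    room for exponential decay.\<close>
  define x where "x = (a + Re z) / 2"
  have x: "x > a" "Re z > x" using z by (auto simp: x_def field_simps)
  note pos = Res_positive_above[OF rho x(1)]
  have "((\<lambda>N. exp (- (Re z - x) * N)) \<longlongrightarrow> 0) at_top"
    using x(2) by (intro exp_neg_mult_tendsto_0) simp
  then have g: "((\<lambda>N. 2 * exp (- (Re z - x) * N) * norm (Res T (of_real x) f)) \<longlongrightarrow> 0) at_top"
    by (intro tendsto_mult_left_zero tendsto_mult_right_zero)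
  show thesis
    by (rule cauchy_at_top_real[of "\<lambda>N. lap z N f", OF laplace_block_bound[OF pos f x(2)] g]) (auto intro: that)
qed

text \<open>A counterpart of the Pringsheim-Landau theorem: for positive data, convergence in a
  half-plane is decided on the real axis. A positive \<open>f\<close> is replaced by
  \<open>T t0 f\<close> in the orbit cone, at the price of the finite integral up to
  \<open>t0\<close>; linearity covers the other vectors.\<close>

theorem eventually_positive_rho:
  assumes pos: eventually_positive and rho: "\<And>x. x > a \<Longrightarrow> complex_of_real x \<in> rho T" and z: "Re z > a"
  shows "z \<in> rho T"
proof (rule laplace_converges)
  interpret S: c0_semigroup "rescale z T" by (rule c0_rescale)
  note lap_lin = bounded_linear.linear[OF S.L_bounded_linear, unfolded L_rescale]
  fix f :: "'r cplx"
  show "\<exists>l. ((\<lambda>N. lap z N f) \<longlongrightarrow> l) at_top"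
  proof (induction f rule: cplx_induct_cpos)
    fix f :: "'r cplx" assume "f \<in> cpos"
    then obtain t0 where t0: "t0 \<ge> 0" "T t0 f \<in> orbit_cone" by (rule eventually_positiveE[OF pos])
    obtain l where l: "((\<lambda>N. lap z N (T t0 f)) \<longlongrightarrow> l) at_top"
      by (rule laplace_converges_cone[OF rho z t0(2)])
    define c where "c = exp (- (z * of_real t0))"
    have "((\<lambda>N. cscale c (lap z (- t0 + N) (T t0 f)) + lap z t0 f) \<longlongrightarrow> cscale c l + lap z t0 f) at_top"
      by (intro tendsto_add cscale.tendsto tendsto_const filterlim_compose[OF l filterlim_const_plus_at_top])
    moreover have "eventually (\<lambda>N. cscale c (lap z (- t0 + N) (T t0 f)) + lap z t0 f = lap z N f) at_top"
    proof (rule eventually_mono[OF eventually_ge_at_top[of t0]])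
      fix N assume N: "t0 \<le> N"
      have "lap z N f - lap z t0 f = rescale z T t0 (lap z (- t0 + N) f)"
        using S.T_L[of t0 "- t0 + N" f] t0 N by (simp add: L_rescale)
      also have "\<dots> = cscale c (lap z (- t0 + N) (T t0 f))"
        using t0 by (simp add: rescale_def c_def T_lap)
      finally show "cscale c (lap z (- t0 + N) (T t0 f)) + lap z t0 f = lap z N f"
        by (simp add: algebra_simps)
    qed
    ultimately have "((\<lambda>N. lap z N f) \<longlongrightarrow> cscale c l + lap z t0 f) at_top"
      by (rule Lim_transform_eventually)
    then show "\<exists>l. ((\<lambda>N. lap z N f) \<longlongrightarrow> l) at_top" by blast
  next
    fix f g :: "'r cplx"
    assume "\<exists>l. ((\<lambda>N. lap z N f) \<longlongrightarrow> l) at_top" "\<exists>l. ((\<lambda>N. lap z N g) \<longlongrightarrow> l) at_top"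
    then show "\<exists>l. ((\<lambda>N. lap z N (f - g)) \<longlongrightarrow> l) at_top"
      unfolding linear_diff[OF lap_lin] by (elim exE) (rule exI, rule tendsto_diff)
  next
    fix f :: "'r cplx"
    assume "\<exists>l. ((\<lambda>N. lap z N f) \<longlongrightarrow> l) at_top"
    moreover have "lap z N (cscale \<i> f) = cscale \<i> (lap z N f)" for N
      by (rule S.L_map[unfolded L_rescale, symmetric]) (auto simp: cscale.bounded_linear_right S.T_cscale)
    ultimately show "\<exists>l. ((\<lambda>N. lap z N (cscale \<i> f)) \<longlongrightarrow> l) at_top"
      by (auto intro: cscale.tendsto[OF tendsto_const])
  qed
qed

text \<open>The point 0 is approached from the right, where the resolvents are positive on the orbit
  cone. The passage from \<open>T t0 f\<close> back to \<open>f\<close> is free, since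
  \<open>B\<close> commutes with the semigroup and its range is fixed by it.\<close>

lemma pole_cpos:
  assumes pos: eventually_positive and rho: "\<And>x. x > 0 \<Longrightarrow> complex_of_real x \<in> rho T"
    and B: "pole_at T 0 p B" and f: "f \<in> cpos"
  shows "B f \<in> cpos"
proof -
  obtain t0 where t0: "t0 \<ge> 0" "T t0 f \<in> orbit_cone" by (rule eventually_positiveE[OF pos f])
  have "((\<lambda>x::real. cscale ((of_real x - 0) ^ p) (Res T (of_real x) (T t0 f))) \<longlongrightarrow> B (T t0 f)) (at_right 0)"
    by (rule filterlim_compose[OF pole_tendsto[OF B] filterlim_of_real_at_right])
  moreover have "eventually (\<lambda>x::real. cscale ((of_real x - 0) ^ p) (Res T (of_real x) (T t0 f)) \<in> cpos) (at_right 0)"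
  proof (rule eventually_mono[OF eventually_at_right_less])
    fix x :: real assume x: "0 < x"
    from Res_positive_above[OF rho this] have "Res T (of_real x) (T t0 f) \<in> cpos"
      using t0 orbit_cone_cpos by (auto simp: Res_positive_def)
    then show "cscale ((of_real x - 0) ^ p) (Res T (of_real x) (T t0 f)) \<in> cpos"
      using x by (simp add: cpos_scaleR flip: of_real_power)
  qed
  ultimately have "B (T t0 f) \<in> cpos"
    by (intro Lim_in_closed_set[OF closed_cpos _ trivial_limit_at_right_real])
  then show ?thesis using pole_T[OF B t0(1), of f] T_pole[OF B t0(1), of f] by simp
qed

end

subsection \<open>Eventual strong positivity\<close>

lemma gg_u_cpos: "0 \<le> u \<Longrightarrow> gg_u u f \<Longrightarrow> f \<in> (cpos :: 'r::ordered_real_vector cplx set)"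
  unfolding gg_u_def using cpos_add[of "f - (c *\<^sub>R u, 0)" "(c *\<^sub>R u, 0)" for c]
  by (force simp: scaleR_nonneg_nonneg)

lemma (in banach_lattice) principal_idealE:
  assumes "f \<in> principal_ideal (u :: 'r)"
  obtains c where "c \<ge> 0" "lat_abs (fst f) \<le> c *\<^sub>R u" "lat_abs (snd f) \<le> c *\<^sub>R u"
proof -
  obtain c where "c \<ge> 0" "cmodulus f \<le> c *\<^sub>R u" using assms by (auto simp: principal_ideal_def)
  then show thesis
    using order_trans[OF lat_abs_fst_le_cmodulus[of f]] order_trans[OF lat_abs_snd_le_cmodulus[of f]]
    by (intro that[of c]) auto
qed

lemma zero_le_add_iff: "0 \<le> a + b \<longleftrightarrow> - b \<le> (a :: 'a::ordered_ab_group_add)"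
  using diff_ge_0_iff_ge[of a "- b"] by simp

lemma norm_le_fst_snd: "norm f \<le> norm (fst f) + norm (snd f)"
  by (metis norm_Pair_le prod.collapse)

locale smoothing_semigroup = lattice_semigroup R T
  for R :: "'r::{banach,ordered_real_vector,lattice} itself" and T :: "real \<Rightarrow> 'r cplx \<Rightarrow> 'r cplx" +
  fixes u :: 'r and \<tau> :: real
  assumes quasi: "quasi_interior u"
    and real: "0 \<le> t \<Longrightarrow> snd (T t (x, 0)) = 0"
    and smoothing: "0 \<le> \<tau>" "T \<tau> f \<in> principal_ideal u"
begin

lemma u_nonneg: "0 \<le> u"
  using quasi by (simp add: quasi_interior_def)

lemma T_real: "0 \<le> t \<Longrightarrow> T t (x, 0) = (fst (T t (x, 0)), 0)"
  using real[of t x] by (simp add: prod_eq_iff)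

text \<open>For real vectors, \<open>\<i>\<close> times their image has real part 0, so a real
  semigroup commutes with taking real parts.\<close>

lemma fst_T: "0 \<le> t \<Longrightarrow> (fst (T t f), 0) = T t (fst f, 0)"
proof -
  assume t: "0 \<le> t"
  have f: "f = (fst f, 0) + cscale \<i> (snd f, 0)" by (simp add: cscale_def)
  have "T t f = T t (fst f, 0) + cscale \<i> (T t (snd f, 0))"
    by (subst f) (simp only: T_add T_cscale t)
  also have "fst \<dots> = fst (T t (fst f, 0))"
    using real[OF t] by (simp add: cscale_def)
  finally show ?thesis using T_real[OF t, of "fst f"] by simp
qed

text \<open>The Baire category theorem replaces the closed graph theorem here: \<open>T \<tau>\<close> is bounded
  from \<open>E\<close> into the ideal \<open>E\<^sub>u\<close> with its gauge norm.\<close>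

lemma smoothing_bounded:
  obtains K where "K \<ge> 0" "\<And>x. fst (T \<tau> (x, 0)) \<le> (K * norm x) *\<^sub>R u"
proof -
  \<comment> \<open>\<open>A n\<close> collects the \<open>x\<close> whose image under
    \<open>T \<tau>\<close> lies between \<open>- n u\<close> and \<open>n u\<close>; two one-sided
    conditions exhibit it as closed and convex. The smoothing hypothesis makes these sets exhaust
    the space.\<close>
  define A where "A n = {x. 0 \<le> real n *\<^sub>R u - fst (T \<tau> (x, 0))} \<inter> {x. 0 \<le> real n *\<^sub>R u + fst (T \<tau> (x, 0))}" for n
  have lin1: "bounded_linear (\<lambda>x. fst (T \<tau> (x, 0)))"
    by (intro bounded_linear_fst_comp bounded_linear_compose[OF lin[OF smoothing(1)]] bounded_linear_Pair
        bounded_linear_ident bounded_linear_zero)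
  have cont: "continuous_on UNIV (\<lambda>x. fst (T \<tau> (x, 0)))" by (rule linear_continuous_on[OF lin1])
  note ll = bounded_linear.linear[OF lin1]
  obtain n r where r: "r > 0" "cball 0 r \<subseteq> A n"
  proof (rule baire_symmetric_convex[of A])
    fix n
    have "closed ((\<lambda>x. real n *\<^sub>R u - fst (T \<tau> (x, 0))) -` {x. 0 \<le> x} \<inter> (\<lambda>x. real n *\<^sub>R u + fst (T \<tau> (x, 0))) -` {x. 0 \<le> x})"
      by (intro closed_Int closed_vimage closed_nonneg continuous_intros cont)
    then show "closed (A n)" by (simp add: A_def vimage_def)
    show "convex (A n)"
    proof (rule convexI)
      fix x y and a b :: real assume *: "x \<in> A n" "y \<in> A n" "0 \<le> a" "0 \<le> b" "a + b = 1"
      have conv: "a *\<^sub>R (U - p) + b *\<^sub>R (U - q) = U - (a *\<^sub>R p + b *\<^sub>R q)"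
        "a *\<^sub>R (U + p) + b *\<^sub>R (U + q) = U + (a *\<^sub>R p + b *\<^sub>R q)" for U p q :: 'r
      proof -
        have U: "U = a *\<^sub>R U + b *\<^sub>R U" using *(5) by (simp flip: scaleR_add_left)
        show "a *\<^sub>R (U - p) + b *\<^sub>R (U - q) = U - (a *\<^sub>R p + b *\<^sub>R q)"
          by (subst (3) U) (simp add: algebra_simps)
        show "a *\<^sub>R (U + p) + b *\<^sub>R (U + q) = U + (a *\<^sub>R p + b *\<^sub>R q)"
          by (subst (3) U) (simp add: algebra_simps)
      qed
      have "0 \<le> a *\<^sub>R (real n *\<^sub>R u - fst (T \<tau> (x, 0))) + b *\<^sub>R (real n *\<^sub>R u - fst (T \<tau> (y, 0)))"
        "0 \<le> a *\<^sub>R (real n *\<^sub>R u + fst (T \<tau> (x, 0))) + b *\<^sub>R (real n *\<^sub>R u + fst (T \<tau> (y, 0)))"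
        using * by (auto simp only: A_def Int_iff mem_Collect_eq
            intro!: add_nonneg_nonneg[OF scaleR_nonneg_nonneg scaleR_nonneg_nonneg])
      note this[unfolded conv]
      moreover have "fst (T \<tau> (a *\<^sub>R x + b *\<^sub>R y, 0)) = a *\<^sub>R fst (T \<tau> (x, 0)) + b *\<^sub>R fst (T \<tau> (y, 0))"
        using linear_add[OF ll, of "a *\<^sub>R x" "b *\<^sub>R y"] linear_cmul[OF ll] by simp
      ultimately show "a *\<^sub>R x + b *\<^sub>R y \<in> A n" by (simp add: A_def)
    qed
    show "- x \<in> A n" if "x \<in> A n" for x
      using that linear_neg[OF ll, of x] by (simp add: A_def zero_le_add_iff)
  next
    have "\<exists>n. x \<in> A n" for x
    proof -
      obtain c where c: "c \<ge> 0" "lat_abs (fst (T \<tau> (x, 0))) \<le> c *\<^sub>R u"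
        by (rule principal_idealE[OF smoothing(2)[of "(x, 0)"]])
      obtain n :: nat where "c \<le> real n" using real_arch_simple by blast
      then have "c *\<^sub>R u \<le> real n *\<^sub>R u" by (rule scaleR_right_mono[OF _ u_nonneg])
      with c(2) have "lat_abs (fst (T \<tau> (x, 0))) \<le> real n *\<^sub>R u" by (rule order_trans)
      then have "x \<in> A n"
        by (simp add: A_def lat_abs_le_iff zero_le_add_iff)
      then show ?thesis by blast
    qed
    then show "(\<Union>n. A n) = UNIV" by blast
  qed
  have "fst (T \<tau> (x, 0)) \<le> (real n / r * norm x) *\<^sub>R u" for x
  proof (cases "x = 0")
    case True
    then show ?thesis using linear_0[OF ll] by simp
  next
    case False
    define s where "s = norm x / r"
    have s: "s > 0" using False r by (simp add: s_def)
    have "(1 / s) *\<^sub>R x \<in> A n" using r False by (intro subsetD[OF r(2)]) (simp add: s_def)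
    then have "fst (T \<tau> ((1 / s) *\<^sub>R x, 0)) \<le> real n *\<^sub>R u" by (simp add: A_def)
    then have "(1 / s) *\<^sub>R fst (T \<tau> (x, 0)) \<le> real n *\<^sub>R u" using linear_cmul[OF ll] by simp
    then have "s *\<^sub>R (1 / s) *\<^sub>R fst (T \<tau> (x, 0)) \<le> s *\<^sub>R real n *\<^sub>R u"
      using s by (intro scaleR_left_mono) auto
    moreover have "s *\<^sub>R (1 / s) *\<^sub>R fst (T \<tau> (x, 0)) = fst (T \<tau> (x, 0))" using s by simp
    moreover have "s * real n = real n / r * norm x" by (simp add: s_def)
    ultimately show ?thesis by (simp only: scaleR_scaleR)
  qed
  then show thesis using r by (intro that[of "real n / r"]) auto
qed

text \<open>\<open>T \<tau>\<close> fixes the limit \<open>Q f\<close>, so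
  \<open>Q f - T (\<tau> + s) f\<close> is \<open>T \<tau>\<close> applied to a vector of small norm
  and its real part is at most a small multiple of \<open>u\<close>.\<close>

theorem converges_imp_strongly_positive:
  assumes Q: "op_gg_u u Q" and conv: "\<And>f. ((\<lambda>t. T t f) \<longlongrightarrow> Q f) at_top"
  shows "indiv_ev_strongly_pos u T"
  unfolding indiv_ev_strongly_pos_def
proof (intro allI impI)
  fix f :: "'r cplx" assume f: "strictly_pos f"
  then obtain x where x: "f = (x, 0)" by (cases f) (auto simp: strictly_pos_def)
  obtain c where c: "c > 0" "Q f - (c *\<^sub>R u, 0) \<in> cpos"
    using Q f by (auto simp: op_gg_u_def gg_u_def)
  obtain K where K: "K \<ge> 0" "\<And>x. fst (T \<tau> (x, 0)) \<le> (K * norm x) *\<^sub>R u"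
    by (rule smoothing_bounded) blast
  have TQ: "T \<tau> (Q f) = Q f"
  proof -
    have "((\<lambda>t. T \<tau> (T t f)) \<longlongrightarrow> T \<tau> (Q f)) at_top"
      by (rule bounded_linear.tendsto[OF lin[OF smoothing(1)] conv])
    moreover have "((\<lambda>t. T (\<tau> + t) f) \<longlongrightarrow> Q f) at_top"
      by (rule filterlim_compose[OF conv filterlim_const_plus_at_top])
    then have "((\<lambda>t. T \<tau> (T t f)) \<longlongrightarrow> Q f) at_top"
      by (rule Lim_transform_eventually)
         (auto intro!: eventually_mono[OF eventually_ge_at_top[of 0]] simp: T_plus smoothing)
    ultimately show ?thesis using tendsto_unique[OF trivial_limit_at_top_linorder] by blast
  qed
  have "((\<lambda>t. K * norm (fst (Q f - T t f))) \<longlongrightarrow> K * norm (fst (Q f - Q f))) at_top"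
    by (intro tendsto_intros conv)
  \<comment> \<open>\<open>Q f\<close> dominates \<open>c\<close> times \<open>u\<close>; an error
    of at most \<open>c / 2\<close> times \<open>u\<close> leaves the lower bound
    \<open>c / 2\<close>.\<close>
  then have "eventually (\<lambda>t. K * norm (fst (Q f - T t f)) < c / 2) at_top"
    using c by (intro order_tendstoD(2)) auto
  then obtain t1 where t1: "\<And>t. t \<ge> t1 \<Longrightarrow> K * norm (fst (Q f - T t f)) < c / 2"
    by (auto simp: eventually_at_top_linorder)
  \<comment> \<open>The added 1 makes the time strictly positive, as the definition demands.\<close>
  define t2 where "t2 = max t1 0 + \<tau> + 1"
  have "gg_u u (T t f)" if t: "t \<ge> t2" for t
  proof -
    define s where "s = t - \<tau>"
    have s: "s \<ge> t1" "s \<ge> 0" "t = \<tau> + s" using t by (auto simp: s_def t2_def)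
    have Tt: "T t f = T \<tau> (T s f)" using T_plus[OF smoothing(1) s(2)] s(3) by simp
    have "fst (T \<tau> (fst (Q f - T s f), 0)) \<le> (K * norm (fst (Q f - T s f))) *\<^sub>R u" by (rule K)
    also have "\<dots> \<le> (c / 2) *\<^sub>R u"
      using t1[OF s(1)] by (intro scaleR_right_mono u_nonneg) simp
    also have "fst (T \<tau> (fst (Q f - T s f), 0)) = fst (T \<tau> (Q f - T s f))"
      using fst_T[OF smoothing(1), of "Q f - T s f"] by (metis fst_conv)
    also have "\<dots> = fst (Q f) - fst (T t f)" by (simp add: T_diff smoothing TQ Tt)
    finally have "fst (Q f) \<le> (c / 2) *\<^sub>R u + fst (T t f)" by (simp only: diff_le_eq)
    moreover have "c *\<^sub>R u \<le> fst (Q f)" using c(2) by (simp add: cpos_iff)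
    moreover have "c *\<^sub>R u = (c / 2) *\<^sub>R u + (c / 2) *\<^sub>R u" by (simp flip: scaleR_add_left)
    ultimately have "(c / 2) *\<^sub>R u + (c / 2) *\<^sub>R u \<le> (c / 2) *\<^sub>R u + fst (T t f)"
      by (metis order_trans)
    then have "(c / 2) *\<^sub>R u \<le> fst (T t f)" by (simp only: add_le_cancel_left)
    moreover have "snd (T t f) = 0" using real[of t x] x s smoothing by simp
    ultimately show ?thesis
      unfolding gg_u_def using c by (intro exI[of _ "c/2"]) (simp add: cpos_iff)
  qed
  moreover have "t2 > 0" using smoothing by (simp add: t2_def)
  ultimately show "\<exists>t0>0. \<forall>t\<ge>t0. gg_u u (T t f)" by blast
qed

text \<open>By positivity \<open>P\<close> vanishes on every real vector between multiples of
  \<open>- u\<close> and \<open>u\<close>, hence on the ideal of \<open>u\<close>, which is dense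
  since \<open>u\<close> is quasi-interior.\<close>

lemma op_zero_of_u:
  fixes P :: "'r cplx \<Rightarrow> 'r cplx"
  assumes P: "bounded_linear P" and cp: "\<And>f. f \<in> cpos \<Longrightarrow> P f \<in> cpos" and Pu: "P (u, 0) = 0"
    and sc: "\<And>c f. P (cscale c f) = cscale c (P f)"
  shows "P f = 0"
proof -
  note l = bounded_linear.linear[OF P]
  have real0: "P (y, 0) = 0" if "lat_abs y \<le> c *\<^sub>R u" for y c
  proof -
    have "P (c *\<^sub>R (u, 0) - (y, 0)) \<in> cpos" "P (c *\<^sub>R (u, 0) + (y, 0)) \<in> cpos"
      using that by (auto intro!: cp simp: lat_abs_le_iff zero_le_add_iff)
    then show ?thesis
      using cpos_antisym[of "P (y, 0)"] unfolding linear_diff[OF l] linear_add[OF l] linear_cmul[OF l] Pu by simp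
  qed
  have ideal: "P g = 0" if g: "g \<in> principal_ideal u" for g
  proof -
    obtain c where c: "c \<ge> 0" "lat_abs (fst g) \<le> c *\<^sub>R u" "lat_abs (snd g) \<le> c *\<^sub>R u"
      by (rule principal_idealE[OF g])
    have "g = (fst g, 0) + cscale \<i> (snd g, 0)" by (simp add: cscale_def)
    then have "P g = P (fst g, 0) + cscale \<i> (P (snd g, 0))" using linear_add[OF l] sc by metis
    then show ?thesis by (simp add: real0[OF c(2)] real0[OF c(3)] cscale.zero_right)
  qed
  obtain K where K: "K > 0" "\<And>f. norm (P f) \<le> norm f * K"
    using bounded_linear.pos_bounded[OF P] by blast
  have "norm (P f) \<le> e" if e: "e > 0" for e
  proof -
    obtain g where g: "g \<in> principal_ideal u" "cnorm (f - g) < e / (2 * K)"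
      using quasi K e unfolding quasi_interior_def by (metis divide_pos_pos mult_pos_pos zero_less_numeral)
    have "norm (P f) = norm (P (f - g))" using ideal[OF g(1)] by (simp add: linear_diff[OF l])
    also have "\<dots> \<le> norm (f - g) * K" by (rule K)
    also have "\<dots> \<le> (2 * cnorm (f - g)) * K" using K by (intro mult_right_mono norm_le_cnorm) auto
    also have "\<dots> \<le> (2 * (e / (2 * K))) * K" using g K by (intro mult_right_mono mult_left_mono) auto
    also have "\<dots> = e" using K by simp
    finally show ?thesis .
  qed
  then have "norm (P f) \<le> 0" using field_le_epsilon[of "norm (P f)" 0] by simp
  then show ?thesis by simp
qed

section \<open>Consequences of individual eventual strong positivity\<close>

context
  assumes isp: "indiv_ev_strongly_pos u T"
begin

lemma isp_cpos: "f \<in> cpos \<Longrightarrow> \<exists>t0\<ge>0. \<forall>t\<ge>t0. T t f \<in> cpos"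
proof (cases "f = 0")
  case True
  then show ?thesis by (auto simp: T_zero intro: exI[of _ 0])
next
  case False
  assume "f \<in> cpos"
  with False isp obtain t0 where "t0 > 0" "\<And>t. t \<ge> t0 \<Longrightarrow> gg_u u (T t f)"
    unfolding indiv_ev_strongly_pos_def strictly_pos_def by blast
  then show ?thesis using gg_u_cpos[OF u_nonneg] by (intro exI[of _ t0]) auto
qed

lemma isp_eventually_positive: eventually_positive
  unfolding eventually_positive_def using isp_cpos by blast

text \<open>Being fixed at the multiples of one \<open>s\<close> suffices to wait until the orbit
  lies above a multiple of \<open>u\<close>. So periodic vectors are covered as well as fixed
  ones.\<close>

lemma fixed_dominates_u:
  assumes "f \<in> cpos" "f \<noteq> 0" "\<And>n::nat. T (real n * s) f = f" "s > 0"
  shows "gg_u u f"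
proof -
  have "strictly_pos f" using assms by (simp add: strictly_pos_def)
  with isp obtain t0 where t0: "\<And>t. t \<ge> t0 \<Longrightarrow> gg_u u (T t f)"
    unfolding indiv_ev_strongly_pos_def by blast
  obtain n :: nat where "t0 / s \<le> real n" using real_arch_simple by blast
  then have "t0 \<le> real n * s" using assms(4) by (simp add: field_simps)
  from t0[OF this] show ?thesis using assms(3) by simp
qed

text \<open>At time \<open>\<tau>\<close> the orbit of a positive vector lies between
  \<open>- d v\<close> and \<open>d v\<close>. Both gaps are positive, hence eventually positive
  under the semigroup, while \<open>v\<close> is fixed: the orbit is trapped. The trapping time
  depends on the vector, so the common \<open>M\<close> comes from the uniform boundedness
  principle.\<close>

lemma bounded_of_fixed_vector:
  assumes v: "\<And>t. 0 \<le> t \<Longrightarrow> T t (v, 0) = (v, 0)" and k: "k > 0" "u \<le> k *\<^sub>R v"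
  shows "\<exists>M. \<forall>t\<ge>0. \<forall>f. norm (T t f) \<le> M * norm f"
proof -
  have bdd: "\<exists>K. \<forall>t\<in>{0..}. norm (T t f) \<le> K" for f
  proof (induction f rule: cplx_induct_cpos)
    fix f :: "'r cplx" assume "f \<in> cpos"
    then obtain x where x: "f = (x, 0)" by (cases f) auto
    define y where "y = fst (T \<tau> f)"
    have Ty: "T \<tau> f = (y, 0)" using T_real[OF smoothing(1), of x] by (simp add: y_def x)
    obtain c where c: "c \<ge> 0" "lat_abs y \<le> c *\<^sub>R u"
      by (rule principal_idealE[OF smoothing(2)[of f]]) (auto simp: y_def)
    define d where "d = c * k"
    have "c *\<^sub>R u \<le> c *\<^sub>R (k *\<^sub>R v)" using c k by (intro scaleR_left_mono)
    then have yd: "lat_abs y \<le> d *\<^sub>R v" using c(2) by (simp add: d_def)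
    have yd': "0 \<le> d *\<^sub>R v - y" "0 \<le> d *\<^sub>R v - (- y)"
      using yd unfolding lat_abs_le_iff diff_ge_0_iff_ge by auto
    obtain t1 where t1: "t1 \<ge> 0" "\<And>t. t \<ge> t1 \<Longrightarrow> T t (d *\<^sub>R v - y, 0) \<in> cpos"
      using isp_cpos[of "(d *\<^sub>R v - y, 0)"] yd' by auto
    obtain t2 where t2: "t2 \<ge> 0" "\<And>t. t \<ge> t2 \<Longrightarrow> T t (d *\<^sub>R v - (- y), 0) \<in> cpos"
      using isp_cpos[of "(d *\<^sub>R v - (- y), 0)"] yd' by auto
    have Tv: "T t (d *\<^sub>R v - w, 0) = d *\<^sub>R (v, 0) - T t (w, 0)" if "0 \<le> t" for t w
    proof -
      have "(d *\<^sub>R v - w, 0) = d *\<^sub>R (v, 0) - (w, 0 :: 'r)" by simp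
      then show ?thesis using that by (simp only: T_diff T_scaleR v)
    qed
    have late: "norm (T (t + \<tau>) f) \<le> norm (d *\<^sub>R v)" if t: "t \<ge> max t1 t2" for t
    proof -
      have t0: "0 \<le> t" using t t1 by auto
      have "T t (- y, 0) = - T t (y, 0)" using T_minus[OF t0, of "(y, 0)"] by simp
      then have "d *\<^sub>R (v, 0) - T t (y, 0) \<in> cpos" "d *\<^sub>R (v, 0) - - T t (y, 0) \<in> cpos"
        using t1(2)[of t] t2(2)[of t] t by (auto simp only: Tv[OF t0] max.bounded_iff)
      then have "norm (fst (T t (y, 0))) \<le> norm (d *\<^sub>R v)"
        by (intro norm_mono_dominated) (auto simp: cpos_iff zero_le_add_iff minus_le_iff)
      then show ?thesis
        using norm_le_fst_snd[of "T t (y, 0)"] real[OF t0, of y] T_plus[OF t0 smoothing(1), of f] Ty by simp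
    qed
    obtain K where K: "\<And>t f. 0 \<le> t \<Longrightarrow> t \<le> max t1 t2 + \<tau> \<Longrightarrow> norm (T t f) \<le> K * norm f"
      by (rule bounded_on_interval) blast
    have "norm (T t f) \<le> max (K * norm f) (norm (d *\<^sub>R v))" if "0 \<le> t" for t
    proof (cases "t \<le> max t1 t2 + \<tau>")
      case True
      then show ?thesis using K[OF that True, of f] by simp
    next
      case False
      then have "max t1 t2 \<le> t - \<tau>" by linarith
      from late[OF this] show ?thesis by simp
    qed
    then show "\<exists>K. \<forall>t\<in>{0..}. norm (T t f) \<le> K" by auto
  next
    fix f g :: "'r cplx"
    assume "\<exists>K. \<forall>t\<in>{0..}. norm (T t f) \<le> K" "\<exists>K. \<forall>t\<in>{0..}. norm (T t g) \<le> K"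
    then obtain K K' where KK: "\<forall>t\<in>{0..}. norm (T t f) \<le> K" "\<forall>t\<in>{0..}. norm (T t g) \<le> K'" by (elim exE)
    have "norm (T t (f - g)) \<le> K + K'" if "t \<in> {0..}" for t
      using KK[rule_format, OF that] that norm_triangle_ineq4[of "T t f" "T t g"] by (simp add: T_diff)
    then show "\<exists>K. \<forall>t\<in>{0..}. norm (T t (f - g)) \<le> K" by blast
  next
    fix f :: "'r cplx"
    assume "\<exists>K. \<forall>t\<in>{0..}. norm (T t f) \<le> K"
    then obtain K where KK: "\<forall>t\<in>{0..}. norm (T t f) \<le> K" by (elim exE)
    have "norm (T t (cscale \<i> f)) \<le> 2 * K" if "t \<in> {0..}" for t
      using KK[rule_format, OF that] that norm_cscale_le[of \<i> "T t f"] by (simp add: T_cscale)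
    then show "\<exists>K. \<forall>t\<in>{0..}. norm (T t (cscale \<i> f)) \<le> K" by blast
  qed
  have lin': "bounded_linear (T t)" if "t \<in> {0..}" for t using lin that by simp
  show ?thesis
  proof (rule uniform_boundedness[of "{0..}" T, OF lin' bdd])
    fix M assume "\<And>t f. t \<in> {0..} \<Longrightarrow> norm (T t f) \<le> M * norm f"
    then show ?thesis by (intro exI[of _ M]) simp
  qed
qed

text \<open>The least \<open>c\<close> is attained since the cone is closed. A nonzero gap
  \<open>c v - a\<close> is periodic and positive, so it dominates a multiple of \<open>u\<close>,
  hence of \<open>v\<close>, and \<open>c\<close> could be lowered.\<close>

lemma periodic_vector_multiple:
  assumes v: "\<And>t. 0 \<le> t \<Longrightarrow> T t (v, 0) = (v, 0)" "0 \<le> v" "v \<noteq> 0" and k: "k > 0" "u \<le> k *\<^sub>R v"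
    and a: "T s (a, 0) = (a, 0)" "s > 0" "lat_abs a \<le> b *\<^sub>R v"
  shows "\<exists>c. a = c *\<^sub>R v"
proof -
  define S where "S = {c. 0 \<le> c *\<^sub>R v - a}"
  have "closed ((\<lambda>c. c *\<^sub>R v - a) -` {x. 0 \<le> x})"
    by (intro closed_vimage closed_nonneg continuous_intros)
  then have S_closed: "closed S" by (simp add: S_def vimage_def)
  have S_ne: "S \<noteq> {}" using a(3) by (auto simp: S_def lat_abs_le_iff)
  \<comment> \<open>Adding \<open>c v - a\<close> and \<open>b v + a\<close> gives a nonnegative
    \<open>(c + b) v\<close>; as \<open>v\<close> is positive and nonzero, this rules out
    \<open>c < - b\<close>.\<close>
  have S_lb: "- b \<le> c" if "c \<in> S" for c
  proof (rule ccontr)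
    assume "\<not> - b \<le> c"
    then have cb: "- (c + b) > 0" by simp
    have "0 \<le> (c *\<^sub>R v - a) + (b *\<^sub>R v - (- a))"
      using that a(3) by (intro add_nonneg_nonneg) (auto simp only: S_def lat_abs_le_iff diff_ge_0_iff_ge mem_Collect_eq)
    then have "0 \<le> (c + b) *\<^sub>R v" by (simp add: scaleR_add_left)
    moreover have "0 \<le> (- (c + b)) *\<^sub>R v" using cb v(2) by (intro scaleR_nonneg_nonneg) auto
    then have "(c + b) *\<^sub>R v \<le> 0" by (simp only: scaleR_minus_left neg_0_le_iff_le)
    ultimately have "(c + b) *\<^sub>R v = 0" by (rule antisym[rotated])
    then show False using cb v(3) by simp
  qed
  then have bdd: "bdd_below S" by (intro bdd_belowI)
  define c where "c = Inf S"
  have cS: "c \<in> S" unfolding c_def by (rule closed_contains_Inf[OF S_ne bdd S_closed])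
  have Ta: "T (real n * s) (c *\<^sub>R v - a, 0) = (c *\<^sub>R v - a, 0)" for n :: nat
  proof (induction n)
    case (Suc n)
    have e: "(c *\<^sub>R v - a, 0) = c *\<^sub>R (v, 0) - (a, 0 :: 'r)" by simp
    have "T s (c *\<^sub>R v - a, 0) = (c *\<^sub>R v - a, 0)"
      unfolding e using a v by (simp only: T_diff T_scaleR less_imp_le)
    then show ?case using Suc a(2) T_plus[of s "real n * s" "(c *\<^sub>R v - a, 0)"] by (simp add: distrib_right)
  qed simp
  have "c *\<^sub>R v - a = 0"
  proof (rule ccontr)
    assume ne: "c *\<^sub>R v - a \<noteq> 0"
    have "gg_u u (c *\<^sub>R v - a, 0)"
      using ne cS a(2) by (intro fixed_dominates_u[OF _ _ Ta]) (auto simp: S_def zero_prod_def)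
    then obtain e where e: "e > 0" "e *\<^sub>R u \<le> c *\<^sub>R v - a" by (auto simp: gg_u_def)
    txt \<open>\<open>v = T \<tau> v\<close> lies in the ideal generated by \<open>u\<close>, so \<open>u\<close> and \<open>v\<close> dominate each other.\<close>
    obtain d where d: "d \<ge> 0" "lat_abs (fst (T \<tau> (v, 0))) \<le> d *\<^sub>R u"
      by (rule principal_idealE[OF smoothing(2)[of "(v, 0)"]])
    then have vd: "v \<le> d *\<^sub>R u" using v(1)[OF smoothing(1)] by (simp add: lat_abs_le_iff)
    have d0: "d > 0" using vd v d(1) by (cases "d = 0") auto
    have "(e / d) *\<^sub>R v \<le> (e / d) *\<^sub>R (d *\<^sub>R u)" using e d0 vd by (intro scaleR_left_mono) auto
    also have "\<dots> = e *\<^sub>R u" using d0 by simp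
    also note e(2)
    finally have "c - e / d \<in> S"
      by (simp add: S_def scaleR_diff_left algebra_simps)
    then have "c \<le> c - e / d" unfolding c_def using cInf_lower[OF _ bdd] by auto
    then show False using e d0 by (simp add: divide_le_0_iff)
  qed
  then show ?thesis by (intro exI[of _ c]) simp
qed

theorem strongly_positive_imp:
  assumes right: "\<And>z. Re z > 0 \<Longrightarrow> z \<in> rho T"
    and sup: "\<And>\<delta>. \<delta> > 0 \<Longrightarrow> \<exists>z. Re z > - \<delta> \<and> z \<notin> rho T"
    and poles: "\<And>\<mu>. Re \<mu> = 0 \<Longrightarrow> \<mu> \<notin> rho T \<Longrightarrow> \<exists>p B. pole_at T \<mu> p B"
  shows "\<exists>M P. 0 \<notin> rho T \<and> pole_at T 0 1 P \<and> op_gg_u u P \<and> (\<forall>t\<ge>0. \<forall>f. norm (T t f) \<le> M * norm f)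
    \<and> (\<forall>x. x \<noteq> 0 \<longrightarrow> \<i> * of_real x \<in> rho T)"
proof -
  note pos = isp_eventually_positive
  \<comment> \<open>If a disc around 0 were free of spectrum, so would be the real axis beyond
    \<open>- \<delta>\<close>, hence a half-plane reaching left of 0, against
    \<open>sup\<close>.\<close>
  have zero: "0 \<notin> rho T"
  proof
    assume "0 \<in> rho T"
    then obtain \<delta> where \<delta>: "\<delta> > 0" "ball 0 \<delta> \<subseteq> rho T"
      using open_rho unfolding open_contains_ball by blast
    have "complex_of_real x \<in> rho T" if "x > - \<delta>" for x
    proof (cases "x > 0")
      case False
      then show ?thesis using that by (intro subsetD[OF \<delta>(2)]) (simp add: dist_norm)
    qed (simp add: right)
    from eventually_positive_rho[OF pos this] sup[OF \<delta>(1)] show False by auto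
  qed
  then obtain p P where P: "pole_at T 0 p P" using poles[of 0] by auto
  have P_pos: "P f \<in> cpos" if "f \<in> cpos" for f
    by (rule pole_cpos[OF pos _ P that]) (simp add: right)
  have P_fix: "T t (P f) = P f" if "0 \<le> t" for t f
    using T_pole[OF P that] by simp
  note Pl = bounded_linear.linear[OF pole_bounded_linear[OF P]]
  \<comment> \<open>A leading coefficient vanishing on \<open>cpos\<close> would vanish everywhere,
    as positive vectors generate the space.\<close>
  obtain f0 where f0: "f0 \<in> cpos" "P f0 \<noteq> 0"
  proof (rule ccontr)
    assume "\<not> thesis"
    then have "\<And>f. f \<in> cpos \<Longrightarrow> P f = 0" using that by blast
    then have "P f = 0" for f
      by (induction f rule: cplx_induct_cpos)
         (simp_all add: linear_diff[OF Pl] pole_cscale[OF P] cscale.zero_right)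
    then show False using pole_nontrivial[OF P] by metis
  qed
  define v where "v = fst (P f0)"
  have Pv: "P f0 = (v, 0)" using P_pos[OF f0(1)] by (simp add: v_def cpos_iff prod_eq_iff)
  have v: "0 \<le> v" "v \<noteq> 0" "\<And>t. 0 \<le> t \<Longrightarrow> T t (v, 0) = (v, 0)"
    using P_pos[OF f0(1)] f0(2) P_fix[of _ f0] by (auto simp: Pv zero_prod_def)
  have "gg_u u (v, 0)" using v by (intro fixed_dominates_u[of _ 1]) (auto simp: zero_prod_def)
  then obtain c where c: "c > 0" "c *\<^sub>R u \<le> v" by (auto simp: gg_u_def)
  define k where "k = 1 / c"
  have "k *\<^sub>R (c *\<^sub>R u) \<le> k *\<^sub>R v" using c by (intro scaleR_left_mono) (auto simp: k_def)
  then have k: "k > 0" "u \<le> k *\<^sub>R v" using c by (auto simp: k_def)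
  have "\<exists>M. \<forall>t\<ge>0. \<forall>f. norm (T t f) \<le> M * norm f"
    by (rule bounded_of_fixed_vector[OF v(3) k])
  then obtain M where M': "\<forall>t\<ge>0. \<forall>f. norm (T t f) \<le> M * norm f" by (elim exE)
  then have M: "norm (T t f) \<le> M * norm f" if "0 \<le> t" for t f using that by simp
  have P1: "pole_at T 0 1 P" using P pole_order_1[OF P M] by simp
  have "gg_u u (P f)" if f: "strictly_pos f" for f
  proof -
    have fp: "f \<in> cpos" "f \<noteq> 0" using f by (auto simp: strictly_pos_def)
    \<comment> \<open>If \<open>P f = 0\<close>, then \<open>T t f\<close> above \<open>c u\<close>
      gives \<open>P (T t f) = 0\<close> above \<open>c P u\<close>, which is itself positive. So
      \<open>P u = 0\<close>, and then \<open>P\<close> would be 0.\<close>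
    have "P f \<noteq> 0"
    proof
      assume Pf: "P f = 0"
      obtain t where t: "t > 0" "\<forall>s\<ge>t. gg_u u (T s f)"
        using isp[unfolded indiv_ev_strongly_pos_def, rule_format, OF f] by (elim exE conjE)
      then have "gg_u u (T t f)" by simp
      then obtain c where c: "c > 0" "T t f - (c *\<^sub>R u, 0) \<in> cpos" unfolding gg_u_def by (elim exE conjE)
      have "P (T t f - c *\<^sub>R (u, 0)) \<in> cpos" using c by (intro P_pos) simp
      moreover have "P (T t f) = 0" using t(1) P_fix[of t f] Pf pole_T[OF P, of t f] by simp
      ultimately have 1: "- (c *\<^sub>R P (u, 0)) \<in> cpos"
        unfolding linear_diff[OF Pl] linear_cmul[OF Pl] by simp
      have "c *\<^sub>R P (u, 0) \<in> cpos" using c u_nonneg by (intro cpos_scaleR P_pos) auto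
      from cpos_antisym[OF this 1] have "P (u, 0) = 0" using c by simp
      from op_zero_of_u[OF pole_bounded_linear[OF P] P_pos this pole_cscale[OF P]] f0(2) show False by simp
    qed
    then show ?thesis using P_pos[OF fp(1)] P_fix by (intro fixed_dominates_u[of _ 1]) auto
  qed
  then have gg: "op_gg_u u P" by (simp add: op_gg_u_def)
  have "\<i> * of_real x \<in> rho T" if x: "x \<noteq> 0" for x :: real
  proof (rule ccontr)
    assume "\<i> * of_real x \<notin> rho T"
    then obtain q B where B: "pole_at T (\<i> * of_real x) q B" using poles[of "\<i> * of_real x"] by auto
    obtain g where g: "B g \<noteq> 0" using pole_nontrivial[OF B] by metis
    have eig: "T t (B g) = cscale (exp (\<i> * of_real x * of_real t)) (B g)" if "0 \<le> t" for t
      by (rule T_pole[OF B that])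
    \<comment> \<open>Stated for every multiple of the eigenvector: \<open>d = 1\<close> yields its
      real part and \<open>d = \<i>\<close> the negative of its imaginary part.\<close>
    have multiple: "\<exists>c. fst (cscale d (B g)) = c *\<^sub>R v" for d
    proof -
      define z where "z = cscale d (B g)"
      have Tz: "T t z = cscale (exp (\<i> * of_real x * of_real t)) z" if "0 \<le> t" for t
        using eig[OF that] that by (simp add: z_def T_cscale mult.commute)
      define s where "s = 2 * pi / \<bar>x\<bar>"
      have s: "s > 0" using x by (simp add: s_def)
      have "exp (\<i> * of_real x * of_real s) = cis (x * s)" by (simp add: cis_conv_exp mult.assoc)
      also have "\<dots> = 1" using x by (simp add: s_def complex_eq_iff abs_if)
      finally have "T s z = z" using Tz[of s] s by simp
      then have fixz: "T s (fst z, 0) = (fst z, 0)" using fst_T[of s z] s by simp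
      \<comment> \<open>\<open>w\<close> is the eigenvector rotated back by time
        \<open>\<tau>\<close>, so that \<open>z = T \<tau> w\<close> lies in the ideal of
        \<open>u\<close> and its real part is dominated by a multiple of \<open>v\<close>.\<close>
      define w where "w = cscale (exp (- (\<i> * of_real x * of_real \<tau>))) z"
      have "T \<tau> w = z" using Tz[OF smoothing(1)] smoothing(1) by (simp add: w_def T_cscale mult_exp_exp)
      with smoothing(2)[of w] have "z \<in> principal_ideal u" by simp
      then obtain b where b: "b \<ge> 0" "lat_abs (fst z) \<le> b *\<^sub>R u" "lat_abs (snd z) \<le> b *\<^sub>R u"
        by (rule principal_idealE)
      have "b *\<^sub>R u \<le> b *\<^sub>R (k *\<^sub>R v)" using b k by (intro scaleR_left_mono)
      with b(2) have "lat_abs (fst z) \<le> (b * k) *\<^sub>R v" by simp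
      from periodic_vector_multiple[OF v(3) v(1,2) k fixz s this] show ?thesis by (simp add: z_def)
    qed
    obtain c where c: "fst (B g) = c *\<^sub>R v" using multiple[of 1] by auto
    obtain d where d: "- snd (B g) = d *\<^sub>R v" using multiple[of \<i>] by (auto simp: cscale_def)
    have Bg: "B g = c *\<^sub>R (v, 0) + cscale \<i> ((- d) *\<^sub>R (v, 0))"
      using c d by (simp add: prod_eq_iff cscale_def) (metis minus_minus)
    have fixB: "T t (B g) = B g" if "0 \<le> t" for t
      unfolding Bg using that by (simp only: T_add T_cscale T_scaleR v(3))
    \<comment> \<open>Half a period: the eigenvector, now known to be fixed, would equal its own
      negative.\<close>
    define s where "s = pi / \<bar>x\<bar>"
    have s: "s > 0" using x by (simp add: s_def)
    have "exp (\<i> * of_real x * of_real s) = cis (x * s)" by (simp add: cis_conv_exp mult.assoc)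
    also have "\<dots> = - 1" using x by (simp add: s_def complex_eq_iff abs_if)
    finally have "B g = - B g" using eig[of s] fixB[of s] s by (simp add: cscale.minus_left)
    then have "2 *\<^sub>R B g = 0" by (metis add.right_inverse scaleR_2)
    then show False using g by simp
  qed
  with zero P1 gg M' show ?thesis by (intro exI[of _ M] exI[of _ P]) simp
qed

end

end

subsection \<open>Generator, resolvent and spectral projection of the semigroup\<close>

context banach_lattice
begin

lemma bounded_op_iff:
  "bounded_op B \<longleftrightarrow> bounded_linear B \<and> (\<forall>c f. B (cscale c f) = cscale c (B (f :: 'r cplx)))"
proof -
  have bdd: "(\<exists>K. \<forall>f. cnorm (B f) \<le> K * cnorm f) \<longleftrightarrow> (\<exists>K. \<forall>f. norm (B f) \<le> K * norm f)"
    using bounded_by_cnorm_iff[of "{()}" "\<lambda>_. B"] by simp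
  show ?thesis
  proof
    assume B: "bounded_op B"
    then obtain K where K: "\<And>f. norm (B f) \<le> K * norm f" unfolding bounded_op_def bdd by blast
    have "bounded_linear B"
    proof (rule bounded_linear_intro)
      show "B (f + g) = B f + B g" for f g using B by (simp add: bounded_op_def)
      show "B (r *\<^sub>R f) = r *\<^sub>R B f" for r f
        using B unfolding bounded_op_def by (metis cscale_of_real)
      show "norm (B f) \<le> norm f * K" for f using K[of f] by (simp add: mult.commute)
    qed
    then show "bounded_linear B \<and> (\<forall>c f. B (cscale c f) = cscale c (B f))"
      using B by (simp add: bounded_op_def)
  next
    assume B: "bounded_linear B \<and> (\<forall>c f. B (cscale c f) = cscale c (B f))"
    then obtain K where "\<And>f. norm (B f) \<le> norm f * K" using bounded_linear.bounded by blast
    then have "\<exists>K. \<forall>f. norm (B f) \<le> K * norm f" by (metis mult.commute)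
    then show "bounded_op B"
      using B linear_add[OF bounded_linear.linear] unfolding bounded_op_def bdd by blast
  qed
qed

text \<open>Each passage between \<open>norm\<close> and \<open>cnorm\<close> costs a factor 2, once
  for the argument and once for the value. The supremum in \<open>op_norm\<close> is usable because
  the set is bounded above.\<close>

lemma norm_le_op_norm:
  assumes B: "bounded_linear (B :: 'r cplx \<Rightarrow> 'r cplx)"
  shows "norm (B f) \<le> 4 * op_norm B * norm f"
proof (cases "f = 0")
  case True
  then show ?thesis using linear_0[OF bounded_linear.linear[OF B]] by simp
next
  case False
  obtain K where K: "K > 0" "\<And>f. norm (B f) \<le> norm f * K" using bounded_linear.pos_bounded[OF B] by blast
  have bdd: "bdd_above {cnorm (B f) | f. cnorm f \<le> 1}"
  proof (rule bdd_aboveI, safe)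
    fix f :: "'r cplx" assume f: "cnorm f \<le> 1"
    have "cnorm (B f) \<le> 2 * (norm f * K)" using cnorm_le_norm[of "B f"] K(2)[of f] by linarith
    also have "norm f \<le> 2 * 1" using norm_le_cnorm[of f] f by linarith
    then have "2 * (norm f * K) \<le> 2 * (2 * 1 * K)" using K by (intro mult_left_mono mult_right_mono) auto
    finally show "cnorm (B f) \<le> 2 * (2 * 1 * K)" .
  qed
  define g where "g = (1 / (2 * norm f)) *\<^sub>R f"
  have "cnorm g \<le> 1" using cnorm_le_norm[of g] False by (simp add: g_def)
  then have "cnorm (B g) \<le> op_norm B" unfolding op_norm_def by (intro cSup_upper bdd) blast
  then have "norm (B g) \<le> 2 * op_norm B" using norm_le_cnorm[of "B g"] by linarith
  moreover have "norm (B g) = norm (B f) / (2 * norm f)"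
    using linear_cmul[OF bounded_linear.linear[OF B]] by (simp add: g_def)
  ultimately show ?thesis using False by (simp add: field_simps)
qed

end

context lattice_semigroup
begin

lemma gen_rel_iff_cnorm: "((\<lambda>h. cnorm (inverse h *\<^sub>R (T h f - f) - g)) \<longlongrightarrow> 0) (at_right 0) \<longleftrightarrow> gen_rel T f g"
  by (simp add: cnorm_tendsto_iff gen_rel_def LIM_zero_iff)

lemma gen_dom_iff: "f \<in> gen_dom T \<longleftrightarrow> (\<exists>g. gen_rel T f g)"
  by (simp add: gen_dom_def gen_rel_iff_cnorm)

lemma gen_eq: "gen_rel T f g \<Longrightarrow> gen T f = g"
  unfolding gen_def gen_rel_iff_cnorm using gen_rel_unique by blast

lemma res_op_resolvent:
  assumes B: "res_op T z B"
  shows "z \<in> resolvent_set T" "resolvent T z = B"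
proof -
  have BB: "gen_rel T (B f) (cscale z (B f) - f)" "gen_rel T f g \<Longrightarrow> B (cscale z f - g) = f" for f g
    using B by (auto simp: res_op_def)
  have dom: "B f \<in> gen_dom T" "cscale z (B f) - gen T (B f) = f" for f
    using BB(1)[of f] by (auto simp: gen_dom_iff gen_eq)
  have inj: "inj_on (\<lambda>f. cscale z f - gen T f) (gen_dom T)"
  proof (rule inj_onI)
    fix f f' assume "f \<in> gen_dom T" "f' \<in> gen_dom T" and eq: "cscale z f - gen T f = cscale z f' - gen T f'"
    then obtain g g' where g: "gen_rel T f g" "gen_rel T f' g'" by (auto simp: gen_dom_iff)
    then show "f = f'" using eq BB(2)[OF g(1)] BB(2)[OF g(2)] by (simp add: gen_eq)
  qed
  show res: "resolvent T z = B"
  proof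
    fix g
    have "resolvent T z (cscale z (B g) - gen T (B g)) = B g"
      unfolding resolvent_def by (rule the_inv_into_f_f[OF inj dom(1)])
    then show "resolvent T z g = B g" by (simp add: dom)
  qed
  have "f \<in> (\<lambda>f. cscale z f - gen T f) ` gen_dom T" for f
    using dom[of f] by (intro image_eqI[of _ _ "B f"]) auto
  then have "bij_betw (\<lambda>f. cscale z f - gen T f) (gen_dom T) UNIV"
    unfolding bij_betw_def using inj by blast
  moreover obtain K where "\<And>g. norm (B g) \<le> norm g * K"
    using B bounded_linear.pos_bounded[of B] unfolding res_op_def by blast
  then have "\<exists>K. \<forall>g. norm (B g) \<le> K * norm g" by (intro exI[of _ K]) (simp add: mult.commute)
  then have "\<exists>K. \<forall>g. cnorm (B g) \<le> K * cnorm g"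
    using bounded_by_cnorm_iff[of "{()}" "\<lambda>_. B"] by simp
  ultimately show "z \<in> resolvent_set T" by (simp add: resolvent_set_def res)
qed

text \<open>The definition asks for a bijection with an inverse bounded in \<open>cnorm\<close>. The
  bound is translated to \<open>norm\<close>, and \<open>res_op_exI\<close> supplies linearity of
  the inverse.\<close>

lemma resolvent_set_eq: "resolvent_set T = rho T"
proof (intro equalityI subsetI)
  fix z assume "z \<in> rho T"
  then show "z \<in> resolvent_set T" using res_op_resolvent(1)[OF res_op_Res] by blast
next
  fix z assume z: "z \<in> resolvent_set T"
  then have bij: "bij_betw (\<lambda>f. cscale z f - gen T f) (gen_dom T) UNIV" by (simp add: resolvent_set_def)
  have "\<exists>K. \<forall>g. cnorm (resolvent T z g) \<le> K * cnorm g" using z by (simp add: resolvent_set_def)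
  then have "\<exists>K. \<forall>g. norm (resolvent T z g) \<le> K * norm g"
    using bounded_by_cnorm_iff[of "{()}" "\<lambda>_. resolvent T z"] by simp
  then obtain K where K: "\<And>g. norm (resolvent T z g) \<le> K * norm g" by blast
  show "z \<in> rho T"
  proof (rule res_op_exI(1))
    fix f
    define h where "h = resolvent T z f"
    have f: "f \<in> (\<lambda>f. cscale z f - gen T f) ` gen_dom T" using bij_betw_imp_surj_on[OF bij] by simp
    have h: "h \<in> gen_dom T" "cscale z h - gen T h = f"
      unfolding h_def resolvent_def
      using the_inv_into_into[OF bij_betw_imp_inj_on[OF bij] f subset_refl]
        f_the_inv_into_f[OF bij_betw_imp_inj_on[OF bij] f] by simp_all
    then obtain g where g: "gen_rel T h g" by (auto simp: gen_dom_iff)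
    then have "g = cscale z h - f" using h(2) by (auto simp: gen_eq)
    with g K[of f] show "\<exists>h. gen_rel T h (cscale z h - f) \<and> norm h \<le> K * norm f" by (auto simp: h_def)
  next
    fix h assume h: "gen_rel T h (cscale z h)"
    show "h = 0"
    proof (rule inj_onD[OF bij_betw_imp_inj_on[OF bij]])
      show "cscale z h - gen T h = cscale z 0 - gen T 0"
        using gen_eq[OF h] gen_eq[OF gen_rel_zero] by (simp add: cscale.zero_right)
    qed (use h gen_rel_zero in \<open>auto simp: gen_dom_iff\<close>)
  qed
qed

lemma resolvent_eq: "z \<in> rho T \<Longrightarrow> resolvent T z = Res T z"
  using res_op_resolvent(2)[OF res_op_Res] .

lemma gen_spectrum_iff: "z \<in> gen_spectrum T \<longleftrightarrow> z \<notin> rho T"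
  by (simp add: gen_spectrum_def resolvent_set_eq)

text \<open>The exponential growth bound caps the real parts of the spectrum, which gives the
  \<open>Sup\<close> in \<open>spectral_bound\<close> its meaning.\<close>

lemma right_of_spectral_bound:
  assumes "Re z > spectral_bound T" shows "z \<in> rho T"
    and "\<delta> > 0 \<Longrightarrow> gen_spectrum T \<noteq> {} \<Longrightarrow> \<exists>z. Re z > spectral_bound T - \<delta> \<and> z \<notin> rho T"
proof -
  obtain M w where M: "M \<ge> 1" "w \<ge> 0" "\<And>t f. 0 \<le> t \<Longrightarrow> norm (T t f) \<le> M * exp (w * t) * norm f"
    using exponential_growth by metis
  have "Re z \<le> w" if "z \<in> gen_spectrum T" for z
    using laplace_growth(1)[OF M(3), of z] that by (fastforce simp: gen_spectrum_iff)
  then have bdd: "bdd_above (Re ` gen_spectrum T)" by (intro bdd_aboveI2)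
  show "z \<in> rho T"
  proof (rule ccontr)
    assume "z \<notin> rho T"
    then have "Re z \<le> spectral_bound T"
      unfolding spectral_bound_def by (intro cSup_upper bdd) (auto simp: gen_spectrum_iff)
    with assms show False by simp
  qed
  assume "\<delta> > 0" "gen_spectrum T \<noteq> {}"
  then have "spectral_bound T - \<delta> < Sup (Re ` gen_spectrum T)" by (simp add: spectral_bound_def)
  then have "\<exists>y\<in>Re ` gen_spectrum T. spectral_bound T - \<delta> < y"
    using \<open>gen_spectrum T \<noteq> {}\<close> by (subst (asm) less_cSup_iff) (auto intro: bdd)
  then show "\<exists>z. Re z > spectral_bound T - \<delta> \<and> z \<notin> rho T" by (auto simp: gen_spectrum_iff)
qed

text \<open>Coefficient bounds are read off at a single point \<open>z0\<close> at distance
  \<open>r / 2\<close>: the term of index \<open>n\<close> is the difference of two consecutive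
  remainders, which are bounded because they converge. Closer to \<open>\<mu>\<close>, the series
  behind the leading term is then geometric with ratio at most 1/2.\<close>

lemma laurent_leading_estimate:
  assumes r: "r > 0" and Bop: "\<And>n. bounded_op (B n)"
    and lau: "\<And>z. 0 < cmod (z - \<mu>) \<Longrightarrow> cmod (z - \<mu>) < r \<Longrightarrow> z \<in> rho T \<and>
        (\<lambda>N. op_norm (\<lambda>f. Res T z f - (\<Sum>n<N. cscale ((z - \<mu>) powi (int n - int m)) (B n f)))) \<longlonglongrightarrow> 0"
    and k: "k \<le> m" "\<And>n f. n < k \<Longrightarrow> B n f = 0"
  obtains C where "\<And>z f. 0 < cmod (z - \<mu>) \<Longrightarrow> cmod (z - \<mu>) < r / 4 \<Longrightarrow>
    norm (cscale ((z - \<mu>) ^ (m - k)) (Res T z f) - B k f) \<le> C * cmod (z - \<mu>) * norm f"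
proof -
  have Bl: "bounded_linear (B n)" for n using Bop by (simp add: bounded_op_iff)
  define S where "S z N f = (\<Sum>n<N. cscale ((z - \<mu>) powi (int n - int m)) (B n f))" for z N f
  have Sl: "bounded_linear (S z N)" for z N
    unfolding S_def by (intro bounded_linear_sum bounded_linear_compose[OF cscale.bounded_linear_right] Bl)
  have err: "norm (Res T z f - S z N f) \<le> 4 * op_norm (\<lambda>f. Res T z f - S z N f) * norm f"
    if "0 < cmod (z - \<mu>)" "cmod (z - \<mu>) < r" for z N f
    using that lau by (intro norm_le_op_norm bounded_linear_sub Res_bounded_linear Sl) auto
  have S_lim: "(\<lambda>N. S z N f) \<longlonglongrightarrow> Res T z f" if z: "0 < cmod (z - \<mu>)" "cmod (z - \<mu>) < r" for z f
  proof -
    have "(\<lambda>N. 4 * op_norm (\<lambda>f. Res T z f - S z N f) * norm f) \<longlonglongrightarrow> 4 * 0 * norm f"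
      using lau[OF z] unfolding S_def by (intro tendsto_intros) auto
    then have "(\<lambda>N. Res T z f - S z N f) \<longlonglongrightarrow> 0"
      by (intro Lim_null_comparison[OF always_eventually[OF allI[OF err[OF z]]]]) simp
    from tendsto_diff[OF tendsto_const[of "Res T z f"] this] show ?thesis by simp
  qed
  define \<rho> where "\<rho> = r / 2"
  have \<rho>: "\<rho> > 0" "\<rho> < r" using r by (auto simp: \<rho>_def)
  define z0 where "z0 = \<mu> + of_real \<rho>"
  have z0: "0 < cmod (z0 - \<mu>)" "cmod (z0 - \<mu>) < r" using \<rho> by (auto simp: z0_def)
  obtain A where A: "A > 0" "\<And>N. \<bar>op_norm (\<lambda>f. Res T z0 f - S z0 N f)\<bar> \<le> A"
  proof -
    have "Bseq (\<lambda>N. op_norm (\<lambda>f. Res T z0 f - S z0 N f))"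
      using lau[OF z0] unfolding S_def by (intro convergent_imp_Bseq convergentI) auto
    then show ?thesis using that unfolding Bseq_def by auto
  qed
  \<comment> \<open>Two remainders, each with the factor 4 of
    \<open>norm_le_op_norm\<close>.\<close>
  define A' where "A' = 8 * A * \<rho> ^ m"
  have Bn: "norm (B n f) \<le> A' / \<rho> ^ n * norm f" for n f
  proof -
    have e: "norm (Res T z0 f - S z0 N f) \<le> 4 * A * norm f" for N
    proof (rule order_trans[OF err[OF z0]])
      show "4 * op_norm (\<lambda>f. Res T z0 f - S z0 N f) * norm f \<le> 4 * A * norm f"
        using A(2)[of N] by (intro mult_right_mono) auto
    qed
    have "(\<rho> powi (int n - int m)) *\<^sub>R B n f = (Res T z0 f - S z0 n f) - (Res T z0 f - S z0 (Suc n) f)"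
      by (simp add: S_def z0_def flip: of_real_power_int)
    also have "norm \<dots> \<le> 4 * A * norm f + 4 * A * norm f"
      by (rule order_trans[OF norm_triangle_ineq4 add_mono[OF e e]])
    finally have "\<rho> powi (int n - int m) * norm (B n f) \<le> 8 * A * norm f"
      using \<rho> by (simp add: power_int_def)
    moreover have "\<rho> powi (int n - int m) = \<rho> ^ n / \<rho> ^ m" using \<rho> by (simp add: power_int_diff)
    ultimately show ?thesis using \<rho> by (simp add: A'_def field_simps)
  qed
  \<comment> \<open>A factor 2 from \<open>norm_cscale_le\<close> and a factor 2 from the geometric
    series.\<close>
  define C where "C = 4 * A' / \<rho> ^ Suc k"
  have "norm (cscale ((z - \<mu>) ^ (m - k)) (Res T z f) - B k f) \<le> C * cmod (z - \<mu>) * norm f"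
    if z: "0 < cmod (z - \<mu>)" "cmod (z - \<mu>) < r / 4" for z f
  proof -
    define w where "w = z - \<mu>"
    define q where "q = cmod w / \<rho>"
    have w: "w \<noteq> 0" "cmod w < r / 4" using z by (auto simp: w_def)
    have q: "0 \<le> q" "q \<le> 1/2" using w \<rho> by (auto simp: q_def \<rho>_def field_simps)
    have part: "norm (cscale (w ^ (m - k)) (S z N f) - B k f) \<le> C * cmod w * norm f" if N: "N > k" for N
    proof -
      have "cscale (w ^ (m - k)) (S z N f) = (\<Sum>n<N. cscale (w ^ (m - k) * w powi (int n - int m)) (B n f))"
        by (simp add: S_def w_def cscale.sum_right)
      also have "\<dots> = (\<Sum>n\<in>{k..<N}. cscale (w ^ (m - k) * w powi (int n - int m)) (B n f))"
        by (intro sum.mono_neutral_right) (auto simp: k(2) cscale.zero_right)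
      also have "\<dots> = (\<Sum>n\<in>{k..<N}. cscale (w ^ (n - k)) (B n f))"
      proof (rule sum.cong[OF refl])
        fix n assume n: "n \<in> {k..<N}"
        have "w ^ (m - k) * w powi (int n - int m) = w powi (int (m - k) + (int n - int m))"
          using w by (simp add: power_int_add)
        also have "int (m - k) + (int n - int m) = int (n - k)" using n k(1) by auto
        finally show "cscale (w ^ (m - k) * w powi (int n - int m)) (B n f) = cscale (w ^ (n - k)) (B n f)" by simp
      qed
      also have "\<dots> = B k f + (\<Sum>n\<in>{Suc k..<N}. cscale (w ^ (n - k)) (B n f))"
        using N by (simp add: sum.atLeast_Suc_lessThan)
      finally have "cscale (w ^ (m - k)) (S z N f) - B k f = (\<Sum>n\<in>{Suc k..<N}. cscale (w ^ (n - k)) (B n f))"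
        by simp
      \<comment> \<open>One factor \<open>q\<close> is split off each term to exhibit
        \<open>cmod w\<close>; the others are replaced by 1/2.\<close>
      also have "norm \<dots> \<le> (\<Sum>n\<in>{Suc k..<N}. (2 * A' / \<rho> ^ k * norm f * q) * (1/2) ^ (n - Suc k))"
      proof (rule sum_norm_le)
        fix n assume n: "n \<in> {Suc k..<N}"
        have "norm (cscale (w ^ (n - k)) (B n f)) \<le> 2 * cmod (w ^ (n - k)) * (A' / \<rho> ^ n * norm f)"
          by (rule order_trans[OF norm_cscale_le]) (intro mult_left_mono Bn, simp)
        also have "\<dots> = (2 * A' / \<rho> ^ k * norm f) * q ^ (n - k)"
          using n \<rho> by (simp add: q_def norm_power power_divide power_diff field_simps)
        also have "q ^ (n - k) = q * q ^ (n - Suc k)" using n by (simp flip: power_Suc add: Suc_diff_Suc)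
        also have "(2 * A' / \<rho> ^ k * norm f) * (q * q ^ (n - Suc k)) \<le> (2 * A' / \<rho> ^ k * norm f) * (q * (1/2) ^ (n - Suc k))"
          using q A \<rho> by (intro mult_left_mono power_mono) (auto simp: A'_def)
        finally show "norm (cscale (w ^ (n - k)) (B n f)) \<le> (2 * A' / \<rho> ^ k * norm f * q) * (1/2) ^ (n - Suc k)"
          by (simp only: mult.assoc)
      qed
      also have "\<dots> = (2 * A' / \<rho> ^ k * norm f * q) * (\<Sum>n\<in>{Suc k..<N}. (1/2) ^ (n - Suc k))"
        by (simp only: sum_distrib_left)
      also have "(\<Sum>n\<in>{Suc k..<N}. (1/2::real) ^ (n - Suc k)) = (\<Sum>j<N - Suc k. (1/2) ^ j)"
        by (rule sum.reindex_bij_witness[of _ "\<lambda>j. j + Suc k" "\<lambda>n. n - Suc k"]) auto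
      also have "(\<Sum>j<N - Suc k. (1/2::real) ^ j) \<le> 2"
        using sum_le_suminf[OF summable_geometric[of "1/2::real"], of "{..<N - Suc k}"]
          suminf_geometric[of "1/2::real"] by simp
      then have "(2 * A' / \<rho> ^ k * norm f * q) * (\<Sum>j<N - Suc k. (1/2::real) ^ j) \<le> (2 * A' / \<rho> ^ k * norm f * q) * 2"
        using A \<rho> q by (intro mult_left_mono) (auto simp: A'_def)
      also have "\<dots> = C * cmod w * norm f" using \<rho> by (simp add: C_def q_def mult_ac)
      finally show ?thesis .
    qed
    have "(\<lambda>N. norm (cscale (w ^ (m - k)) (S z N f) - B k f)) \<longlonglongrightarrow> norm (cscale (w ^ (m - k)) (Res T z f) - B k f)"
      using z r by (intro tendsto_intros cscale.tendsto S_lim) auto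
    then show ?thesis
      using part unfolding w_def[symmetric] by (intro LIMSEQ_le_const2) (auto intro!: exI[of _ "Suc k"])
  qed
  then show thesis by (rule that)
qed

text \<open>The index \<open>n\<close> belongs to the exponent \<open>n - m\<close>, so the first
  nonzero coefficient with \<open>n < m\<close> leads the principal part. If there is none, the
  resolvent stays bounded near \<open>\<mu>\<close>, and \<open>rho_neighbour\<close> would put
  \<open>\<mu>\<close> into the resolvent set.\<close>

lemma resolvent_pole_imp_pole_at:
  assumes pole: "resolvent_pole T \<mu>" and \<mu>: "\<mu> \<notin> rho T"
  shows "\<exists>p B. pole_at T \<mu> p B"
proof -
  obtain r m B where r: "r > 0" and B: "\<forall>n. bounded_op (B n)"
    and lau: "\<forall>z. 0 < cmod (z - \<mu>) \<and> cmod (z - \<mu>) < r \<longrightarrow>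
        z \<in> resolvent_set T \<and>
        ((\<lambda>N. op_norm (\<lambda>f. resolvent T z f -
             (\<Sum>n<N. cscale ((z - \<mu>) powi (int n - int m)) (B n f)))) \<longlonglongrightarrow> 0)"
    using pole unfolding resolvent_pole_def by (elim exE conjE) (rule that)
  have lau': "z \<in> rho T \<and>
        (\<lambda>N. op_norm (\<lambda>f. Res T z f - (\<Sum>n<N. cscale ((z - \<mu>) powi (int n - int m)) (B n f)))) \<longlonglongrightarrow> 0"
    if z: "0 < cmod (z - \<mu>)" "cmod (z - \<mu>) < r" for z
    using lau[rule_format, OF conjI[OF z]] by (auto simp: resolvent_set_eq resolvent_eq)
  show ?thesis
  proof (cases "\<exists>n<m. \<exists>f. B n f \<noteq> 0")
    case True
    define k where "k = (LEAST n. \<exists>f. B n f \<noteq> 0)"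
    from True obtain n where n: "n < m" "\<exists>f. B n f \<noteq> 0" by blast
    have k: "\<exists>f. B k f \<noteq> 0" unfolding k_def by (rule LeastI_ex) (use n in blast)
    have "k \<le> n" unfolding k_def by (rule Least_le) (rule n(2))
    then have km: "k < m" using n by simp
    have k0: "B i f = 0" if "i < k" for i f
      using not_less_Least[of i "\<lambda>n. \<exists>f. B n f \<noteq> 0"] that by (auto simp: k_def)
    obtain C where C: "\<And>z f. 0 < cmod (z - \<mu>) \<Longrightarrow> cmod (z - \<mu>) < r / 4 \<Longrightarrow>
      norm (cscale ((z - \<mu>) ^ (m - k)) (Res T z f) - B k f) \<le> C * cmod (z - \<mu>) * norm f"
      by (rule laurent_leading_estimate[OF r B[rule_format] lau' less_imp_le[OF km] k0]) auto
    have "pole_at T \<mu> (m - k) (B k)"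
      unfolding pole_at_def
    proof (intro conjI exI allI impI)
      show "1 \<le> m - k" using km by simp
      show "bounded_linear (B k)" using B by (simp add: bounded_op_iff)
      show "B k (SOME f. B k f \<noteq> 0) \<noteq> 0" using k by (rule someI_ex)
      show "r / 4 > 0" using r by simp
    next
      fix z assume z: "0 < cmod (z - \<mu>) \<and> cmod (z - \<mu>) < r / 4"
      then show "z \<in> rho T" using lau' r by auto
      fix f
      show "norm (cscale ((z - \<mu>) ^ (m - k)) (Res T z f) - B k f) \<le> C * cmod (z - \<mu>) * norm f"
        using z by (intro C) auto
    qed
    then show ?thesis by blast
  next
    case False
    then have B0: "B n f = 0" if "n < m" for n f using that by blast
    obtain C where C: "\<And>z f. 0 < cmod (z - \<mu>) \<Longrightarrow> cmod (z - \<mu>) < r / 4 \<Longrightarrow>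
      norm (cscale ((z - \<mu>) ^ (m - m)) (Res T z f) - B m f) \<le> C * cmod (z - \<mu>) * norm f"
      by (rule laurent_leading_estimate[OF r B[rule_format] lau' order_refl B0]) auto
    have "bounded_linear (B m)" using B by (simp add: bounded_op_iff)
    then obtain K where K: "K > 0" "\<And>f. norm (B m f) \<le> norm f * K" using bounded_linear.pos_bounded by blast
    define L where "L = \<bar>C\<bar> * r + K"
    have L: "L > 0" using r K by (simp add: L_def add_nonneg_pos)
    define x where "x = Min {r / 8, 1 / (4 * L)}"
    have x: "x > 0" "x < r / 4" "x \<le> 1 / (4 * L)" using r L by (auto simp: x_def)
    define z where "z = \<mu> + of_real x"
    have z: "0 < cmod (z - \<mu>)" "cmod (z - \<mu>) < r / 4" "cmod (\<mu> - z) = x"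
      using x by (auto simp: z_def)
    have zr: "z \<in> rho T" using lau' z r by auto
    have "norm (Res T z f) \<le> L * norm f" for f
    proof -
      have "norm (Res T z f) \<le> norm (Res T z f - B m f) + norm (B m f)"
        using norm_triangle_sub[of "Res T z f" "B m f"] by simp
      also have "\<dots> \<le> \<bar>C\<bar> * r * norm f + norm f * K"
      proof (intro add_mono K)
        have "norm (Res T z f - B m f) \<le> C * cmod (z - \<mu>) * norm f" using C[OF z(1,2), of f] by simp
        also have "\<dots> \<le> \<bar>C\<bar> * r * norm f"
          using z r by (intro mult_right_mono mult_mono) auto
        finally show "norm (Res T z f - B m f) \<le> \<bar>C\<bar> * r * norm f" .
      qed
      finally show ?thesis by (simp add: L_def algebra_simps)
    qed
    moreover have "4 * L * cmod (\<mu> - z) \<le> 1" using x L z by (simp add: field_simps)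
    ultimately have "\<mu> \<in> rho T" by (rule rho_neighbour(1)[OF zr])
    with \<mu> show ?thesis by simp
  qed
qed

text \<open>The radius in the definition is an unspecified choice, so the circle integral is needed
  for every radius whose closed disc meets the spectrum in \<open>\<mu>\<close> alone;
  \<open>ex\<close> shows that such a radius exists.\<close>

lemma spectral_proj_eq:
  assumes P: "pole_at T \<mu> 1 P" and \<mu>: "\<mu> \<notin> rho T"
  shows "spectral_proj T \<mu> = P"
proof
  fix f
  define r where "r = (SOME r. r > 0 \<and> cball \<mu> r \<inter> gen_spectrum T = {\<mu>})"
  have ex: "\<exists>r. r > 0 \<and> cball \<mu> r \<inter> gen_spectrum T = {\<mu>}"
  proof -
    obtain r0 where r0: "r0 > 0" "\<forall>z. 0 < cmod (z - \<mu>) \<and> cmod (z - \<mu>) < r0 \<longrightarrow> z \<in> rho T"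
      using P unfolding pole_at_def by blast
    have "cball \<mu> (r0 / 2) \<inter> gen_spectrum T = {\<mu>}"
    proof (intro equalityI subsetI)
      fix z assume z: "z \<in> cball \<mu> (r0 / 2) \<inter> gen_spectrum T"
      then have "cmod (z - \<mu>) < r0" using r0(1) by (simp add: dist_norm norm_minus_commute)
      with z r0(2) have "\<not> 0 < cmod (z - \<mu>)" by (simp add: gen_spectrum_iff) blast
      then show "z \<in> {\<mu>}" by simp
    next
      fix z assume "z \<in> {\<mu>}"
      then show "z \<in> cball \<mu> (r0 / 2) \<inter> gen_spectrum T"
        using r0(1) \<mu> by (simp add: gen_spectrum_iff)
    qed
    then show ?thesis using r0(1) by (intro exI[of _ "r0 / 2"]) simp
  qed
  have r: "r > 0" "cball \<mu> r \<inter> gen_spectrum T = {\<mu>}"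
    using someI_ex[OF ex] by (simp_all only: r_def)
  have rho: "z \<in> rho T" if z: "z \<noteq> \<mu>" "cmod (z - \<mu>) \<le> r" for z
  proof (rule ccontr)
    assume "z \<notin> rho T"
    then have "z \<in> cball \<mu> r \<inter> gen_spectrum T"
      using z(2) by (simp add: gen_spectrum_iff dist_norm norm_minus_commute)
    with r(2) z(1) show False by simp
  qed
  have "integral {0..2*pi} (\<lambda>\<theta>. cscale (\<i> * of_real r * exp (\<i> * of_real \<theta>))
      (resolvent T (\<mu> + of_real r * exp (\<i> * of_real \<theta>)) f)) =
    integral {0..2*pi} (\<lambda>\<theta>. cscale (\<i> * of_real r * exp (\<i> * of_real \<theta>))
      (Res T (\<mu> + of_real r * exp (\<i> * of_real \<theta>)) f))"
    using r(1) by (intro integral_cong) (simp add: resolvent_eq rho norm_mult)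
  also have "\<dots> = cscale (2 * of_real pi * \<i>) (P f)"
    by (rule circle_integral_simple_pole[OF P r(1) rho])
  finally show "spectral_proj T \<mu> f = P f"
    unfolding spectral_proj_def Let_def r_def[symmetric] by simp
qed

end

section \<open>Transfer to the rescaled semigroup and assembly\<close>

lemma gg_u_scaleR:
  fixes u :: "'r::ordered_real_vector"
  assumes "c > 0" shows "gg_u u (c *\<^sub>R f) \<longleftrightarrow> gg_u u f"
proof -
  have imp: "gg_u u (c *\<^sub>R f)" if c: "c > 0" and f: "gg_u u f" for c and f :: "'r cplx"
  proof -
    obtain d where d: "d > 0" "f - (d *\<^sub>R u, 0) \<in> cpos" using f unfolding gg_u_def by blast
    have "c *\<^sub>R (f - (d *\<^sub>R u, 0)) \<in> cpos" using c d by (intro cpos_scaleR) auto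
    then show ?thesis
      unfolding gg_u_def using d c by (intro exI[of _ "c * d"]) (simp add: scaleR_diff_right)
  qed
  show ?thesis
  proof
    assume "gg_u u (c *\<^sub>R f)"
    from imp[OF _ this, of "1 / c"] show "gg_u u f" using assms by simp
  qed (rule imp[OF assms])
qed

theorem theorem5p2:
  fixes T :: "real \<Rightarrow> ('r::{banach,ordered_real_vector,lattice}) cplx \<Rightarrow> 'r cplx"
    and u :: 'r
  assumes BL: "banach_lattice_norm TYPE('r)"
    and C0: "C0_semigroup T"
    and real: "real_semigroup T"
    and nonempty: "gen_spectrum T \<noteq> {}"
    and per_finite: "finite (peripheral_spectrum T)"
    and per_poles: "\<forall>\<mu>\<in>peripheral_spectrum T. resolvent_pole T \<mu>"
    and qi: "quasi_interior u"
    and smoothing: "\<exists>t0\<ge>0. \<forall>f. T t0 f \<in> principal_ideal u"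
  shows "(indiv_ev_strongly_pos u T \<longleftrightarrow>
            ((\<exists>M. \<forall>t\<ge>0. \<forall>f. cnorm (exp (- spectral_bound T * t) *\<^sub>R T t f) \<le> M * cnorm f)
             \<and> peripheral_spectrum T = {complex_of_real (spectral_bound T)}
             \<and> op_gg_u u (spectral_proj T (complex_of_real (spectral_bound T)))))
       \<and> (indiv_ev_strongly_pos u T \<longleftrightarrow>
            (\<exists>Q. bounded_op Q \<and> op_gg_u u Q \<and>
               (\<forall>f. ((\<lambda>t. cnorm (exp (- spectral_bound T * t) *\<^sub>R T t f - Q f)) \<longlongrightarrow> 0) at_top)))
       \<and> (\<forall>Q. indiv_ev_strongly_pos u T \<longrightarrow> bounded_op Q \<longrightarrow> op_gg_u u Q \<longrightarrow>
               (\<forall>f. ((\<lambda>t. cnorm (exp (- spectral_bound T * t) *\<^sub>R T t f - Q f)) \<longlongrightarrow> 0) at_top) \<longrightarrow>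
               spectral_proj T (complex_of_real (spectral_bound T)) = Q)"
proof -
  interpret banach_lattice "TYPE('r)" by unfold_locales (rule BL)
  have c0: "c0_semigroup T"
  proof (rule c0_semigroup.intro)
    have op: "bounded_op (T t)" if "0 \<le> t" for t using C0 that by (simp add: C0_semigroup_def)
    show "bounded_linear (T t)" "T t (cscale c f) = cscale c (T t f)" if "0 \<le> t" for t c f
      using op[OF that] by (simp_all add: bounded_op_iff)
    show "T 0 f = f" for f using C0 by (simp add: C0_semigroup_def)
    show "T (s + t) f = T s (T t f)" if "0 \<le> s" "0 \<le> t" for s t f
      using C0 that by (simp add: C0_semigroup_def)
    show "((\<lambda>t. T t f) \<longlongrightarrow> f) (at_right 0)" for f
      using C0 by (simp add: C0_semigroup_def cnorm_tendsto_iff LIM_zero_iff)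
  qed
  interpret T: lattice_semigroup "TYPE('r)" T
    by (intro lattice_semigroup.intro banach_lattice_axioms c0)
  define s where "s = spectral_bound T"
  define V where "V = rescale (of_real s) T"
  have V: "V t f = exp (- s * t) *\<^sub>R T t f" for t f by (simp add: V_def T.rescale_of_real)
  have rho_V: "z \<in> rho V \<longleftrightarrow> z + of_real s \<in> rho T" for z
    unfolding V_def by (rule rho_rescale[OF c0])
  have pole_V: "pole_at V \<mu> p B \<longleftrightarrow> pole_at T (\<mu> + of_real s) p B" for \<mu> p B
    unfolding V_def by (rule pole_at_rescale[OF c0])
  obtain \<tau> where \<tau>: "\<tau> \<ge> 0" "\<forall>f. T \<tau> f \<in> principal_ideal u" using smoothing by blast
  interpret V: lattice_semigroup "TYPE('r)" V
    unfolding V_def by (intro lattice_semigroup.intro banach_lattice_axioms c0_semigroup_rescale c0)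
  interpret V: smoothing_semigroup "TYPE('r)" V u \<tau>
  proof
    show "quasi_interior u" by (rule qi)
    show "snd (V t (x, 0)) = 0" if "0 \<le> t" for t x
      using real that by (simp add: real_semigroup_def V)
    show "0 \<le> \<tau>" by (rule \<tau>)
    \<comment> \<open>The rescaling factor is moved into the argument, where smoothing holds for
      every vector.\<close>
    have "V \<tau> f = T \<tau> (exp (- s * \<tau>) *\<^sub>R f)" for f by (simp only: V T.T_scaleR[OF \<tau>(1)])
    then show "V \<tau> f \<in> principal_ideal u" for f using \<tau>(2) by simp
  qed
  have isp: "indiv_ev_strongly_pos u V \<longleftrightarrow> indiv_ev_strongly_pos u T"
    by (simp add: indiv_ev_strongly_pos_def V gg_u_scaleR)
  have bounded: "(\<exists>M. \<forall>t\<ge>0. \<forall>f. cnorm (exp (- spectral_bound T * t) *\<^sub>R T t f) \<le> M * cnorm f) \<longleftrightarrow>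
      (\<exists>M. \<forall>t\<ge>0. \<forall>f. norm (V t f) \<le> M * norm f)"
    using bounded_by_cnorm_iff[of "{0..}" "\<lambda>t. V t"] by (simp add: V Ball_def flip: s_def)
  have conv: "((\<lambda>t. cnorm (exp (- spectral_bound T * t) *\<^sub>R T t f - Q f)) \<longlongrightarrow> 0) at_top \<longleftrightarrow>
      ((\<lambda>t. V t f) \<longlongrightarrow> Q f) at_top" for f Q
    unfolding cnorm_tendsto_iff s_def[symmetric] V[symmetric] LIM_zero_iff ..
  have per_iff: "z \<in> peripheral_spectrum T \<longleftrightarrow> z \<notin> rho T \<and> Re z = s" for z
    by (simp add: peripheral_spectrum_def T.gen_spectrum_iff s_def)
  \<comment> \<open>Rescaling carries the peripheral spectrum to the spectrum of \<open>V\<close> on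
    the imaginary axis, where the pole hypothesis therefore applies.\<close>
  have poles: "\<exists>p B. pole_at V \<mu> p B" if "Re \<mu> = 0" "\<mu> \<notin> rho V" for \<mu>
  proof -
    have "\<mu> + of_real s \<in> peripheral_spectrum T" using that by (simp add: per_iff rho_V)
    then show ?thesis
      unfolding pole_V using per_poles that by (intro T.resolvent_pole_imp_pole_at) (auto simp: rho_V)
  qed
  have proj: "spectral_proj T (of_real s) = P" if "pole_at V 0 1 P" "0 \<notin> rho V" for P
    using that by (intro T.spectral_proj_eq) (auto simp: pole_V rho_V)
  have i_imp: "\<exists>M P. 0 \<notin> rho V \<and> pole_at V 0 1 P \<and> op_gg_u u P \<and> (\<forall>t\<ge>0. \<forall>f. norm (V t f) \<le> M * norm f)
      \<and> (\<forall>x. x \<noteq> 0 \<longrightarrow> \<i> * of_real x \<in> rho V)" if "indiv_ev_strongly_pos u T"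
  proof (rule V.strongly_positive_imp)
    show "indiv_ev_strongly_pos u V" using that isp by simp
    show "z \<in> rho V" if "Re z > 0" for z
      unfolding rho_V using that by (intro T.right_of_spectral_bound(1)) (simp add: s_def)
    show "\<exists>z. Re z > - \<delta> \<and> z \<notin> rho V" if \<delta>: "\<delta> > 0" for \<delta>
    proof -
      have "spectral_bound T < Re (complex_of_real (s + 1))" by (simp add: s_def)
      from T.right_of_spectral_bound(2)[OF this \<delta> nonempty]
      obtain z where "Re z > s - \<delta>" "z \<notin> rho T" by (auto simp: s_def)
      then show ?thesis by (intro exI[of _ "z - of_real s"]) (simp add: rho_V)
    qed
  qed (rule poles)
  have ii_imp: "\<exists>P. pole_at V 0 1 P \<and> 0 \<notin> rho V \<and> (\<forall>f. ((\<lambda>t. V t f) \<longlongrightarrow> P f) at_top)"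
    if bdd: "\<exists>M. \<forall>t\<ge>0. \<forall>f. norm (V t f) \<le> M * norm f" and per: "peripheral_spectrum T = {of_real s}"
  proof -
    obtain M where M: "\<And>t f. 0 \<le> t \<Longrightarrow> norm (V t f) \<le> M * norm f" using bdd by blast
    have z0: "0 \<notin> rho V" using per per_iff[of "of_real s"] by (simp add: rho_V)
    then obtain p P where P: "pole_at V 0 p P" using poles[of 0] by auto
    have iR: "\<i> * of_real x \<in> rho V" if x: "x \<noteq> 0" for x
    proof (rule ccontr)
      assume "\<i> * of_real x \<notin> rho V"
      then have "\<i> * of_real x + of_real s \<in> peripheral_spectrum T" by (simp add: per_iff rho_V)
      then show False using per x by (simp add: complex_eq_iff)
    qed
    have "((\<lambda>t. V t f) \<longlongrightarrow> P f) at_top" for f by (rule V.dominant_simple_pole_converges[OF P M iR])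
    then show ?thesis using P V.pole_order_1[OF P M] z0 by auto
  qed
  have i_ii: "(\<exists>M. \<forall>t\<ge>0. \<forall>f. norm (V t f) \<le> M * norm f) \<and> peripheral_spectrum T = {of_real s}
      \<and> op_gg_u u (spectral_proj T (of_real s))" if i: "indiv_ev_strongly_pos u T"
  proof -
    obtain M P where P: "0 \<notin> rho V" "pole_at V 0 1 P" "op_gg_u u P" "\<forall>t\<ge>0. \<forall>f. norm (V t f) \<le> M * norm f"
      "\<forall>x. x \<noteq> 0 \<longrightarrow> \<i> * of_real x \<in> rho V"
      using i_imp[OF i] by (elim exE conjE)
    have "z = of_real s" if "z \<in> peripheral_spectrum T" for z
    proof (rule ccontr)
      assume "z \<noteq> of_real s"
      moreover have z: "z \<notin> rho T" "Re z = s" using that by (auto simp: per_iff)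
      ultimately have "Im z \<noteq> 0" by (auto simp: complex_eq_iff)
      then have "\<i> * of_real (Im z) + of_real s \<in> rho T" using P(5) by (simp add: rho_V)
      moreover have "\<i> * of_real (Im z) + of_real s = z" using z(2) by (simp add: complex_eq_iff)
      ultimately show False using z(1) by simp
    qed
    moreover have "of_real s \<in> peripheral_spectrum T" using P(1) by (simp add: per_iff rho_V)
    ultimately have "peripheral_spectrum T = {of_real s}" by blast
    then show ?thesis
      unfolding proj[OF P(2,1)] using P(3,4) by (intro conjI exI[of _ M]) simp_all
  qed
  have ii_iii: "\<exists>Q. bounded_op Q \<and> op_gg_u u Q \<and> (\<forall>f. ((\<lambda>t. V t f) \<longlongrightarrow> Q f) at_top)
      \<and> spectral_proj T (of_real s) = Q"
    if ii: "\<exists>M. \<forall>t\<ge>0. \<forall>f. norm (V t f) \<le> M * norm f" "peripheral_spectrum T = {of_real s}"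
      "op_gg_u u (spectral_proj T (of_real s))"
  proof -
    obtain P where P: "pole_at V 0 1 P" "0 \<notin> rho V" "\<forall>f. ((\<lambda>t. V t f) \<longlongrightarrow> P f) at_top"
      using ii_imp[OF ii(1,2)] by (elim exE conjE)
    have "bounded_op P" using P(1) by (simp add: bounded_op_iff V.pole_bounded_linear V.pole_cscale)
    then show ?thesis using P(3) ii(3) proj[OF P(1,2)] by (intro exI[of _ P]) simp
  qed
  have iii_i: "indiv_ev_strongly_pos u T"
    if "op_gg_u u Q" "\<forall>f. ((\<lambda>t. V t f) \<longlongrightarrow> Q f) at_top" for Q
    using V.converges_imp_strongly_positive[OF that(1)] that(2) isp by simp
  \<comment> \<open>Under (i) the rescaled semigroup also converges to the spectral projection, and
    limits are unique.\<close>
  have uniq: "spectral_proj T (of_real s) = Q"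
    if i: "indiv_ev_strongly_pos u T" and Q: "\<forall>f. ((\<lambda>t. V t f) \<longlongrightarrow> Q f) at_top" for Q
  proof -
    have "\<exists>Q. bounded_op Q \<and> op_gg_u u Q \<and> (\<forall>f. ((\<lambda>t. V t f) \<longlongrightarrow> Q f) at_top)
        \<and> spectral_proj T (of_real s) = Q"
      using i_ii[OF i] by (intro ii_iii) simp_all
    then obtain Q' where Q': "\<forall>f. ((\<lambda>t. V t f) \<longlongrightarrow> Q' f) at_top" "spectral_proj T (of_real s) = Q'"
      by (elim exE conjE)
    have "Q' f = Q f" for f
      using tendsto_unique[OF trivial_limit_at_top_linorder] Q'(1) Q by blast
    then show ?thesis using Q'(2) by (simp add: fun_eq_iff)
  qed
  have "indiv_ev_strongly_pos u T \<longleftrightarrow> (\<exists>M. \<forall>t\<ge>0. \<forall>f. norm (V t f) \<le> M * norm f)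
      \<and> peripheral_spectrum T = {of_real s} \<and> op_gg_u u (spectral_proj T (of_real s))"
  proof (intro iffI i_ii)
    assume ii: "(\<exists>M. \<forall>t\<ge>0. \<forall>f. norm (V t f) \<le> M * norm f)
      \<and> peripheral_spectrum T = {of_real s} \<and> op_gg_u u (spectral_proj T (of_real s))"
    then have "\<exists>Q. bounded_op Q \<and> op_gg_u u Q \<and> (\<forall>f. ((\<lambda>t. V t f) \<longlongrightarrow> Q f) at_top)
        \<and> spectral_proj T (of_real s) = Q" by (intro ii_iii) simp_all
    then obtain Q where "op_gg_u u Q" "\<forall>f. ((\<lambda>t. V t f) \<longlongrightarrow> Q f) at_top" by (elim exE conjE)
    then show "indiv_ev_strongly_pos u T" by (rule iii_i)
  qed
  moreover have "indiv_ev_strongly_pos u T \<longleftrightarrow>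
      (\<exists>Q. bounded_op Q \<and> op_gg_u u Q \<and> (\<forall>f. ((\<lambda>t. V t f) \<longlongrightarrow> Q f) at_top))"
  proof
    assume "indiv_ev_strongly_pos u T"
    from i_ii[OF this] have "\<exists>Q. bounded_op Q \<and> op_gg_u u Q \<and> (\<forall>f. ((\<lambda>t. V t f) \<longlongrightarrow> Q f) at_top)
        \<and> spectral_proj T (of_real s) = Q" by (intro ii_iii) simp_all
    then show "\<exists>Q. bounded_op Q \<and> op_gg_u u Q \<and> (\<forall>f. ((\<lambda>t. V t f) \<longlongrightarrow> Q f) at_top)" by blast
  next
    assume "\<exists>Q. bounded_op Q \<and> op_gg_u u Q \<and> (\<forall>f. ((\<lambda>t. V t f) \<longlongrightarrow> Q f) at_top)"
    then obtain Q where "op_gg_u u Q" "\<forall>f. ((\<lambda>t. V t f) \<longlongrightarrow> Q f) at_top" by (elim exE conjE)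
    then show "indiv_ev_strongly_pos u T" by (rule iii_i)
  qed
  ultimately show ?thesis
    unfolding bounded conv unfolding s_def[symmetric] by (intro conjI allI impI uniq) (assumption | erule spec)+
qed

end
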